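(* The adjoint functors $\mathrm{E2CE}\colon\mathbf{Esys}\to\mathbf{CEsys}$ (left adjoint) and $\mathrm{CE2E}\colon\mathbf{CEsys}\to\mathbf{Esys}$ (right adjoint) described in the context induce an (adjoint) equivalence between the category $\mathbf{Esys}$ of E-systems and the category $\mathbf{rCEsys}$ of rooted CE-systems.
   Context: **Slice notation.** A strict category is a (small) category regarded as an algebraic structure, so that equality of objects is meaningful. For a strict category $\mathcal F$ and object $\Gamma$, $A\in\mathcal F/\Gamma$ means $A$ is an object of the slice, i.e. an arrow $A\colon\Gamma.A\to\Gamma$. For $P\in\mathcal F/\Gamma.A$, $A.P:=A\circ P\in\mathcal F/\Gamma$. We identify $(\mathcal F/\Gamma)/A$ with $\mathcal F/\Gamma.A$. **CE-systems.** A CE-system consists of two strict categories $\mathcal F,\mathcal C$ with the same objects, an identity-on-objects functor $I\colon\mathcal F\to\mathcal C$, a chosen object $1$ terminal in $\mathcal F$, and, for every $f\colon\Delta\to\Gamma$ in $\mathcal C$ and $A\in\mathcal F/\Gamma$, a choice of $f^*A\in\mathcal F/\Delta$ and of an arrow $\pi_2(f,A)\colon\Delta.f^*A\to\Gamma.A$ in $\mathcal C$ such that $I(A)\circ\pi_2(f,A)=f\circ I(f^*A)$ is a pullback square in $\mathcal C$, functorially: (a) $f^*\mathrm{id}_\Gamma=\mathrm{id}_\Delta$, $\pi_2(f,\mathrm{id}_\Gamma)=f$; (b) $\mathrm{id}_\Gamma^*A=A$, $\pi_2(\mathrm{id}_\Gamma,A)=\mathrm{id}_{\Gamma.A}$;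 (c) $(f\circ g)^*A=g^*(f^*A)$, $\pi_2(f\circ g,A)=\pi_2(f,A)\circ\pi_2(g,f^*A)$; (d) for $P\in\mathcal F/\Gamma.A$, $f^*(A.P)=f^*A\circ\pi_2(f,A)^*P$, $\pi_2(f,A.P)=\pi_2(\pi_2(f,A),P)$. Each $f$ induces a functor $f^*\colon\mathcal F/\Gamma\to\mathcal F/\Delta$. The CE-system is rooted if $1$ is terminal in $\mathcal C$. A CE-homomorphism is a pair of functors $(F_{\mathcal F},F_{\mathcal C})$ commuting with the functors $I$, with $F_{\mathcal F}(1)=1$, $F_{\mathcal F}(f^*A)=(F_{\mathcal C}f)^*(F_{\mathcal F}A)$ and $F_{\mathcal C}(\pi_2(f,A))=\pi_2(F_{\mathcal C}f,F_{\mathcal F}A)$. $\mathbf{CEsys}$ is the category of CE-systems and CE-homomorphisms, and $\mathbf{rCEsys}$ its full subcategory on the rooted CE-systems. **E-systems.** A term structure on a strict category $\mathcal F$ is a family of sets $T(A)$ indexed by all arrows $A$ of $\mathcal F$; a functor with term structure is a functor $G$ with functions $T(A)\to T(G(A))$ for all arrows $A$. Slices $\mathcal F/\Gamma$ inherit the term structure (the terms of an arrow of $\mathcal F/\Gamma$ are those of the underlying arrow of $\mathcal F$); $G$ induces $G/\Gamma\colon\mathcal F/\Gamma\to\mathcal D/G(\Gamma)$. Equalities between functors with term structure are on objects, arrows and terms. A pre-E-system $\mathbb E$ is a strict category $\mathcal F$ with term structure $T$, a chosen terminal object $[\,]$, and: for each $A\in\mathcal F/\Gamma$ and $x\in T(A)$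 a functor with term structure $S_x\colon\mathcal F/\Gamma.A\to\mathcal F/\Gamma$ with $S_x(\mathrm{id}_{\Gamma.A})=\mathrm{id}_\Gamma$; for each $A\in\mathcal F/\Gamma$ a functor with term structure $W_A\colon\mathcal F/\Gamma\to\mathcal F/\Gamma.A$ with $W_{\mathrm{id}_\Gamma}=\mathrm{id}$, $W_{A.P}=W_P\circ W_A$, $W_A(\mathrm{id}_\Gamma)=\mathrm{id}_{\Gamma.A}$; for each $A\in\mathcal F/\Gamma$ an element $\mathsf{idtm}_A\in T(W_A(A))$. A pre-E-homomorphism is a functor with term structure $H$ with $H([\,])=[\,]$, $(H/\Gamma)\circ S_x=S_{H(x)}\circ(H/\Gamma.A)$, $(H/\Gamma.A)\circ W_A=W_{H(A)}\circ(H/\Gamma)$, $H(\mathsf{idtm}_A)=\mathsf{idtm}_{H(A)}$. The slice $\mathbb E/\Gamma$ is $\mathcal F/\Gamma$ with chosen terminal object $\mathrm{id}_\Gamma$ and the structure inherited from $\mathbb E$. An E-system is a pre-E-system in which (1) each $S_x$ and (2) each $W_A$ is a pre-E-homomorphism (between slices), (3) $S_x\circ W_A=\mathrm{id}_{\mathbb E/\Gamma}$, (4) $S_x(\mathsf{idtm}_A)=x$ for $x\in T(A)$, (5) $S_{\mathsf{idtm}_A}\circ(W_A/A)=\mathrm{id}_{\mathbb E/\Gamma.A}$. E-homomorphisms are pre-E-homomorphisms between E-systems. $\mathbf{Esys}$ is the category of E-systems and E-homomorphisms. **The functor $\mathrm{CE2E}$.** For a CE-system on $I\colon\mathcal F\to\mathcal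 C$: the underlying category is $\mathcal F$ with its chosen terminal object, $T(A)=\{x\colon\Gamma\to\Gamma.A\text{ in }\mathcal C\mid I(A)\circ x=\mathrm{id}_\Gamma\}$ for $A\in\mathcal F/\Gamma$, $W_A=I(A)^*$, $S_x=x^*$, where $f^*$ acts on terms by pulling back sections (for $B\in\mathcal F/\Gamma$, $Q\in\mathcal F/\Gamma.B$, $y\in T(Q)$, $f^*y$ is the section of $I(\pi_2(f,B)^*Q)$ with $\pi_2(f,B.Q)\circ f^*y=y\circ\pi_2(f,B)$), and $\mathsf{idtm}_A$ is the unique section of $I(W_A(A))$ with $\pi_2(I(A),A)\circ\mathsf{idtm}_A=\mathrm{id}_{\Gamma.A}$. A homomorphism $F$ is sent to $F_{\mathcal F}$ with action on terms given by $F_{\mathcal C}$. **The functor $\mathrm{E2CE}$.** In an E-system, for $A,B\in\mathcal F/\Gamma$ let $\mathrm{thom}(A,B)=T(W_A(B))$; for $f\in\mathrm{thom}(A,B)$ let $f^*=S_f\circ(W_A/B)\colon\mathbb E/\Gamma.B\to\mathbb E/\Gamma.A$; for $g\in\mathrm{thom}(B,C)$ let $g\cdot f=f^*(g)\in\mathrm{thom}(A,C)$. These are the arrows and composition of a strict category $\mathcal C_{\mathbb E}(\Gamma)$ with the objects of $\mathcal F/\Gamma$ and identities $\mathsf{idtm}_A$. For $x\in T(A)$, $u\in T(S_x(P))$ let $x.u=S_u(S_x(\mathsf{idtm}_{A.P}))\in T(A.P)$. $\mathrm{E2CE}(\mathbb E)$ has category of families $\mathcal F/[\,]$ with chosen terminal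 object $\mathrm{id}_{[\,]}$, second category $\mathcal C_{\mathbb E}([\,])$, identity-on-objects functor sending an arrow $Q\colon A.Q\to A$ to $W_Q(\mathsf{idtm}_A)\in\mathrm{thom}(A.Q,A)$, and, for $f\in\mathrm{thom}(A,B)$ and $R\in\mathcal F/[\,].B$, chosen pullback given by $f^*R=f^*(R)$ and $\pi_2(f,R)=(W_{f^*R}(f)).\mathsf{idtm}_{f^*R}\in\mathrm{thom}(A.f^*R,B.R)$. An E-homomorphism $H$ is sent to the pair consisting of $H/[\,]$ and the functor acting as $H/[\,]$ on objects and by the action of $H$ on terms on arrows. *)

theory Defs
  imports "HOL-Library.FuncSet" "HOL-Library.Infinite_Typeclass"
begin

section \<open>Strict categories\<close>

text \<open>
  A strict category is presented by its slices: \<open>Over C \<Gamma>\<close> is the set of all arrows with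
  codomain \<open>\<Gamma>\<close>, and \<open>src C \<Gamma> A\<close> is the domain \<open>\<Gamma>.A\<close> of \<open>A \<in> Over C \<Gamma>\<close>. The composite
  \<open>A \<circ> P\<close> (also written \<open>A.P\<close>) of \<open>A \<in> Over C \<Gamma>\<close> and \<open>P \<in> Over C (\<Gamma>.A)\<close> is \<open>cmp C \<Gamma> A P\<close>.
  An arrow is thus a pair of a codomain and an element of \<open>Over\<close>; the sets \<open>Over C \<Gamma>\<close> for
  different \<open>\<Gamma>\<close> need not be disjoint, and every operation on arrows takes the codomain as
  an additional argument. The advantage is that an arrow \<open>P\<close> of a slice \<open>C/\<Gamma>\<close> with codomain
  \<open>A\<close> is literally an element of \<open>Over C (\<Gamma>.A)\<close>, so that \<open>(C/\<Gamma>)/A\<close> and \<open>C/\<Gamma>.A\<close> have the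
  same objects, arrows and terms, and no transport along this identification is needed.
\<close>

record ('o, 'a) cat =
  Ob :: "'o set"
  Over :: "'o \<Rightarrow> 'a set"
  src :: "'o \<Rightarrow> 'a \<Rightarrow> 'o"
  idn :: "'o \<Rightarrow> 'a"
  cmp :: "'o \<Rightarrow> 'a \<Rightarrow> 'a \<Rightarrow> 'a"

locale strict_category =
  fixes C :: "('o, 'a, 'z) cat_scheme"
  assumes src_Ob: "\<lbrakk>\<Gamma> \<in> Ob C; A \<in> Over C \<Gamma>\<rbrakk> \<Longrightarrow> src C \<Gamma> A \<in> Ob C"
    and idn_Over: "\<Gamma> \<in> Ob C \<Longrightarrow> idn C \<Gamma> \<in> Over C \<Gamma>"
    and src_idn: "\<Gamma> \<in> Ob C \<Longrightarrow> src C \<Gamma> (idn C \<Gamma>) = \<Gamma>"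
    and cmp_Over: "\<lbrakk>\<Gamma> \<in> Ob C; A \<in> Over C \<Gamma>; P \<in> Over C (src C \<Gamma> A)\<rbrakk>
      \<Longrightarrow> cmp C \<Gamma> A P \<in> Over C \<Gamma>"
    and src_cmp: "\<lbrakk>\<Gamma> \<in> Ob C; A \<in> Over C \<Gamma>; P \<in> Over C (src C \<Gamma> A)\<rbrakk>
      \<Longrightarrow> src C \<Gamma> (cmp C \<Gamma> A P) = src C (src C \<Gamma> A) P"
    and cmp_idn_left: "\<lbrakk>\<Gamma> \<in> Ob C; A \<in> Over C \<Gamma>\<rbrakk> \<Longrightarrow> cmp C \<Gamma> (idn C \<Gamma>) A = A"
    and cmp_idn_right: "\<lbrakk>\<Gamma> \<in> Ob C; A \<in> Over C \<Gamma>\<rbrakk> \<Longrightarrow> cmp C \<Gamma> A (idn C (src C \<Gamma> A)) = A"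
    and cmp_assoc: "\<lbrakk>\<Gamma> \<in> Ob C; A \<in> Over C \<Gamma>; P \<in> Over C (src C \<Gamma> A);
        Q \<in> Over C (src C (src C \<Gamma> A) P)\<rbrakk>
      \<Longrightarrow> cmp C \<Gamma> (cmp C \<Gamma> A P) Q = cmp C \<Gamma> A (cmp C (src C \<Gamma> A) P Q)"

definition hom :: "('o, 'a, 'z) cat_scheme \<Rightarrow> 'o \<Rightarrow> 'o \<Rightarrow> 'a set" where
  "hom C X Y = {f \<in> Over C Y. src C Y f = X}"

definition terminal :: "('o, 'a, 'z) cat_scheme \<Rightarrow> 'o \<Rightarrow> bool" where
  "terminal C u \<longleftrightarrow> u \<in> Ob C \<and> (\<forall>X \<in> Ob C. \<exists>!f. f \<in> hom C X u)"

definition iso :: "('o, 'a, 'z) cat_scheme \<Rightarrow> 'o \<Rightarrow> 'o \<Rightarrow> 'a \<Rightarrow> bool" where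
  "iso C X Y f \<longleftrightarrow> f \<in> hom C X Y \<and>
    (\<exists>g \<in> hom C Y X. cmp C Y f g = idn C Y \<and> cmp C X g f = idn C X)"

text \<open>\<open>pullback C \<Gamma> f g p q\<close>: the square \<open>f \<circ> p = g \<circ> q\<close> over \<open>\<Gamma>\<close> is a pullback.\<close>

definition pullback ::
  "('o, 'a, 'z) cat_scheme \<Rightarrow> 'o \<Rightarrow> 'a \<Rightarrow> 'a \<Rightarrow> 'a \<Rightarrow> 'a \<Rightarrow> bool" where
  "pullback C \<Gamma> f g p q \<longleftrightarrow>
    f \<in> Over C \<Gamma> \<and> g \<in> Over C \<Gamma> \<and> p \<in> Over C (src C \<Gamma> f) \<and> q \<in> Over C (src C \<Gamma> g) \<and>
    src C (src C \<Gamma> f) p = src C (src C \<Gamma> g) q \<and> cmp C \<Gamma> f p = cmp C \<Gamma> g q \<and>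
    (\<forall>X \<in> Ob C. \<forall>h \<in> hom C X (src C \<Gamma> f). \<forall>k \<in> hom C X (src C \<Gamma> g).
      cmp C \<Gamma> f h = cmp C \<Gamma> g k \<longrightarrow>
      (\<exists>!u. u \<in> hom C X (src C (src C \<Gamma> f) p) \<and>
        cmp C (src C \<Gamma> f) p u = h \<and> cmp C (src C \<Gamma> g) q u = k))"

definition slice_cat :: "('o, 'a, 'z) cat_scheme \<Rightarrow> 'o \<Rightarrow> ('a, 'a) cat" where
  "slice_cat C \<Gamma> =
    \<lparr>Ob = Over C \<Gamma>,
     Over = \<lambda>A. Over C (src C \<Gamma> A),
     src = \<lambda>A P. cmp C \<Gamma> A P,
     idn = \<lambda>A. idn C (src C \<Gamma> A),
     cmp = \<lambda>A P Q. cmp C (src C \<Gamma> A) P Q\<rparr>"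

definition full_subcat :: "('o, 'a) cat \<Rightarrow> ('o \<Rightarrow> bool) \<Rightarrow> ('o, 'a) cat" where
  "full_subcat C \<Phi> =
    C\<lparr>Ob := {X \<in> Ob C. \<Phi> X}, Over := \<lambda>Y. {f \<in> Over C Y. \<Phi> (src C Y f)}\<rparr>"


section \<open>Functors, adjunctions, adjoint equivalences\<close>

record ('o, 'a, 'p, 'b) fnct =
  fob :: "'o \<Rightarrow> 'p"
  far :: "'o \<Rightarrow> 'a \<Rightarrow> 'b"

locale strict_functor =
  fixes C :: "('o, 'a, 'y) cat_scheme" and D :: "('p, 'b, 'z) cat_scheme"
    and F :: "('o, 'a, 'p, 'b, 'w) fnct_scheme"
  assumes fob_Ob: "\<Gamma> \<in> Ob C \<Longrightarrow> fob F \<Gamma> \<in> Ob D"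
    and far_Over: "\<lbrakk>\<Gamma> \<in> Ob C; A \<in> Over C \<Gamma>\<rbrakk> \<Longrightarrow> far F \<Gamma> A \<in> Over D (fob F \<Gamma>)"
    and src_far: "\<lbrakk>\<Gamma> \<in> Ob C; A \<in> Over C \<Gamma>\<rbrakk>
      \<Longrightarrow> src D (fob F \<Gamma>) (far F \<Gamma> A) = fob F (src C \<Gamma> A)"
    and far_idn: "\<Gamma> \<in> Ob C \<Longrightarrow> far F \<Gamma> (idn C \<Gamma>) = idn D (fob F \<Gamma>)"
    and far_cmp: "\<lbrakk>\<Gamma> \<in> Ob C; A \<in> Over C \<Gamma>; P \<in> Over C (src C \<Gamma> A)\<rbrakk>
      \<Longrightarrow> far F \<Gamma> (cmp C \<Gamma> A P) = cmp D (fob F \<Gamma>) (far F \<Gamma> A) (far F (src C \<Gamma> A) P)"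

definition fid :: "('o, 'a, 'o, 'a) fnct" where
  "fid = \<lparr>fob = \<lambda>\<Gamma>. \<Gamma>, far = \<lambda>\<Gamma> A. A\<rparr>"

definition fcomp :: "('p, 'b, 'q, 'c) fnct \<Rightarrow> ('o, 'a, 'p, 'b) fnct \<Rightarrow> ('o, 'a, 'q, 'c) fnct" where
  "fcomp G F =
    \<lparr>fob = \<lambda>\<Gamma>. fob G (fob F \<Gamma>), far = \<lambda>\<Gamma> A. far G (fob F \<Gamma>) (far F \<Gamma> A)\<rparr>"

text \<open>
  \<open>frestr C F\<close> agrees with \<open>F\<close> on \<open>C\<close> and is \<open>undefined\<close> elsewhere; \<open>frestr C F = F\<close> selects
  a unique representative, so that functors out of \<open>C\<close> are equal iff they agree on \<open>C\<close>.
\<close>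

definition frestr :: "('o, 'a, 'z) cat_scheme \<Rightarrow> ('o, 'a, 'p, 'b) fnct \<Rightarrow> ('o, 'a, 'p, 'b) fnct" where
  "frestr C F =
    \<lparr>fob = restrict (fob F) (Ob C),
     far = (\<lambda>\<Gamma>. restrict (far F \<Gamma>) {A \<in> Over C \<Gamma>. \<Gamma> \<in> Ob C})\<rparr>"

locale nat_trans =
  fixes C :: "('o, 'a) cat" and D :: "('p, 'b) cat"
    and F G :: "('o, 'a, 'p, 'b) fnct" and \<alpha> :: "'o \<Rightarrow> 'b"
  assumes component: "X \<in> Ob C \<Longrightarrow> \<alpha> X \<in> hom D (fob F X) (fob G X)"
    and naturality: "\<lbrakk>X \<in> Ob C; Y \<in> Ob C; f \<in> hom C X Y\<rbrakk>
      \<Longrightarrow> cmp D (fob G Y) (\<alpha> Y) (far F Y f) = cmp D (fob G Y) (far G Y f) (\<alpha> X)"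

locale adjunction =
  fixes C :: "('o, 'a) cat" and D :: "('p, 'b) cat"
    and L :: "('o, 'a, 'p, 'b) fnct" and R :: "('p, 'b, 'o, 'a) fnct"
    and \<eta> :: "'o \<Rightarrow> 'a" and \<epsilon> :: "'p \<Rightarrow> 'b"
  assumes category_C: "strict_category C"
    and category_D: "strict_category D"
    and functor_L: "strict_functor C D L"
    and functor_R: "strict_functor D C R"
    and unit: "nat_trans C C fid (fcomp R L) \<eta>"
    and counit: "nat_trans D D (fcomp L R) fid \<epsilon>"
    and triangle_L: "X \<in> Ob C
      \<Longrightarrow> cmp D (fob L X) (\<epsilon> (fob L X)) (far L (fob R (fob L X)) (\<eta> X)) = idn D (fob L X)"
    and triangle_R: "Y \<in> Ob D
      \<Longrightarrow> cmp C (fob R Y) (far R Y (\<epsilon> Y)) (\<eta> (fob R Y)) = idn C (fob R Y)"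

locale adjoint_equivalence = adjunction +
  assumes unit_iso: "X \<in> Ob C \<Longrightarrow> iso C X (fob R (fob L X)) (\<eta> X)"
    and counit_iso: "Y \<in> Ob D \<Longrightarrow> iso D (fob L (fob R Y)) Y (\<epsilon> Y)"


section \<open>Term structures\<close>

record ('o, 'a, 't) tcat = "('o, 'a) cat" +
  Tm :: "'o \<Rightarrow> 'a \<Rightarrow> 't set"

record ('o, 'a, 't, 'p, 'b, 's) tfnct = "('o, 'a, 'p, 'b) fnct" +
  ftm :: "'o \<Rightarrow> 'a \<Rightarrow> 't \<Rightarrow> 's"

locale tfunctor = strict_functor C D F
  for C :: "('o, 'a, 't, 'y) tcat_scheme" and D :: "('p, 'b, 's, 'z) tcat_scheme"
    and F :: "('o, 'a, 't, 'p, 'b, 's) tfnct" +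
  assumes ftm_Tm: "\<lbrakk>\<Gamma> \<in> Ob C; A \<in> Over C \<Gamma>; x \<in> Tm C \<Gamma> A\<rbrakk>
    \<Longrightarrow> ftm F \<Gamma> A x \<in> Tm D (fob F \<Gamma>) (far F \<Gamma> A)"

definition tfun_eq :: "('o, 'a, 't, 'z) tcat_scheme \<Rightarrow>
    ('o, 'a, 't, 'p, 'b, 's) tfnct \<Rightarrow> ('o, 'a, 't, 'p, 'b, 's) tfnct \<Rightarrow> bool" where
  "tfun_eq C F G \<longleftrightarrow>
    (\<forall>\<Gamma> \<in> Ob C. fob F \<Gamma> = fob G \<Gamma> \<and>
      (\<forall>A \<in> Over C \<Gamma>. far F \<Gamma> A = far G \<Gamma> A \<and>
        (\<forall>x \<in> Tm C \<Gamma> A. ftm F \<Gamma> A x = ftm G \<Gamma> A x)))"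

definition tid :: "('o, 'a, 't, 'o, 'a, 't) tfnct" where
  "tid = \<lparr>fob = \<lambda>\<Gamma>. \<Gamma>, far = \<lambda>\<Gamma> A. A, ftm = \<lambda>\<Gamma> A x. x\<rparr>"

definition tcomp :: "('p, 'b, 's, 'q, 'c, 'r) tfnct \<Rightarrow> ('o, 'a, 't, 'p, 'b, 's) tfnct
    \<Rightarrow> ('o, 'a, 't, 'q, 'c, 'r) tfnct" where
  "tcomp G F =
    \<lparr>fob = \<lambda>\<Gamma>. fob G (fob F \<Gamma>),
     far = \<lambda>\<Gamma> A. far G (fob F \<Gamma>) (far F \<Gamma> A),
     ftm = \<lambda>\<Gamma> A x. ftm G (fob F \<Gamma>) (far F \<Gamma> A) (ftm F \<Gamma> A x)\<rparr>"

definition trestr :: "('o, 'a, 't, 'z) tcat_scheme \<Rightarrow> ('o, 'a, 't, 'p, 'b, 's) tfnct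
    \<Rightarrow> ('o, 'a, 't, 'p, 'b, 's) tfnct" where
  "trestr C F =
    \<lparr>fob = restrict (fob F) (Ob C),
     far = (\<lambda>\<Gamma>. restrict (far F \<Gamma>) {A \<in> Over C \<Gamma>. \<Gamma> \<in> Ob C}),
     ftm = (\<lambda>\<Gamma> A. restrict (ftm F \<Gamma> A) {x \<in> Tm C \<Gamma> A. \<Gamma> \<in> Ob C \<and> A \<in> Over C \<Gamma>})\<rparr>"

text \<open>\<open>slice_fun C G \<Gamma>\<close> is \<open>G/\<Gamma> : C/\<Gamma> \<rightarrow> D/G(\<Gamma>)\<close> for \<open>G : C \<rightarrow> D\<close>.\<close>

definition slice_fun :: "('o, 'a, 'z) cat_scheme \<Rightarrow> ('o, 'a, 't, 'p, 'b, 's) tfnct \<Rightarrow> 'o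
    \<Rightarrow> ('a, 'a, 't, 'b, 'b, 's) tfnct" where
  "slice_fun C G \<Gamma> =
    \<lparr>fob = \<lambda>A. far G \<Gamma> A,
     far = \<lambda>A P. far G (src C \<Gamma> A) P,
     ftm = \<lambda>A P x. ftm G (src C \<Gamma> A) P x\<rparr>"


section \<open>E-systems\<close>

text \<open>
  \<open>Sub E \<Gamma> A x\<close> is the functor \<open>S\<^sub>x : F/\<Gamma>.A \<rightarrow> F/\<Gamma>\<close> for \<open>A \<in> F/\<Gamma>\<close> and \<open>x \<in> T(A)\<close>,
  and \<open>Wk E \<Gamma> A\<close> is \<open>W\<^sub>A : F/\<Gamma> \<rightarrow> F/\<Gamma>.A\<close>.
\<close>

record ('o, 'a, 't) esys = "('o, 'a, 't) tcat" +
  root :: "'o"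
  Sub :: "'o \<Rightarrow> 'a \<Rightarrow> 't \<Rightarrow> ('a, 'a, 't, 'a, 'a, 't) tfnct"
  Wk :: "'o \<Rightarrow> 'a \<Rightarrow> ('a, 'a, 't, 'a, 'a, 't) tfnct"
  idtm :: "'o \<Rightarrow> 'a \<Rightarrow> 't"

definition slice :: "('o, 'a, 't) esys \<Rightarrow> 'o \<Rightarrow> ('a, 'a, 't) esys" where
  "slice E \<Gamma> =
    \<lparr>Ob = Ob (slice_cat E \<Gamma>),
     Over = Over (slice_cat E \<Gamma>),
     src = src (slice_cat E \<Gamma>),
     idn = idn (slice_cat E \<Gamma>),
     cmp = cmp (slice_cat E \<Gamma>),
     Tm = \<lambda>A P. Tm E (src E \<Gamma> A) P,
     root = idn E \<Gamma>,
     Sub = \<lambda>A P x. Sub E (src E \<Gamma> A) P x,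
     Wk = \<lambda>A P. Wk E (src E \<Gamma> A) P,
     idtm = \<lambda>A P. idtm E (src E \<Gamma> A) P\<rparr>"

locale pre_E_system = strict_category E
  for E :: "('o, 'a, 't) esys" +
  assumes terminal_root: "terminal E (root E)"
    and Sub_functor: "\<lbrakk>\<Gamma> \<in> Ob E; A \<in> Over E \<Gamma>; x \<in> Tm E \<Gamma> A\<rbrakk>
      \<Longrightarrow> tfunctor (slice E (src E \<Gamma> A)) (slice E \<Gamma>) (Sub E \<Gamma> A x)"
    and Sub_idn: "\<lbrakk>\<Gamma> \<in> Ob E; A \<in> Over E \<Gamma>; x \<in> Tm E \<Gamma> A\<rbrakk>
      \<Longrightarrow> fob (Sub E \<Gamma> A x) (idn E (src E \<Gamma> A)) = idn E \<Gamma>"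
    and Wk_functor: "\<lbrakk>\<Gamma> \<in> Ob E; A \<in> Over E \<Gamma>\<rbrakk>
      \<Longrightarrow> tfunctor (slice E \<Gamma>) (slice E (src E \<Gamma> A)) (Wk E \<Gamma> A)"
    and Wk_by_idn: "\<Gamma> \<in> Ob E \<Longrightarrow> tfun_eq (slice E \<Gamma>) (Wk E \<Gamma> (idn E \<Gamma>)) tid"
    and Wk_by_cmp: "\<lbrakk>\<Gamma> \<in> Ob E; A \<in> Over E \<Gamma>; P \<in> Over E (src E \<Gamma> A)\<rbrakk>
      \<Longrightarrow> tfun_eq (slice E \<Gamma>) (Wk E \<Gamma> (cmp E \<Gamma> A P))
            (tcomp (Wk E (src E \<Gamma> A) P) (Wk E \<Gamma> A))"
    and Wk_idn: "\<lbrakk>\<Gamma> \<in> Ob E; A \<in> Over E \<Gamma>\<rbrakk>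
      \<Longrightarrow> fob (Wk E \<Gamma> A) (idn E \<Gamma>) = idn E (src E \<Gamma> A)"
    and idtm_Tm: "\<lbrakk>\<Gamma> \<in> Ob E; A \<in> Over E \<Gamma>\<rbrakk>
      \<Longrightarrow> idtm E \<Gamma> A \<in> Tm E (src E \<Gamma> A) (fob (Wk E \<Gamma> A) A)"

locale pre_E_hom = tfunctor E D H
  for E :: "('o, 'a, 't) esys" and D :: "('p, 'b, 's) esys"
    and H :: "('o, 'a, 't, 'p, 'b, 's) tfnct" +
  assumes hom_root: "fob H (root E) = root D"
    and hom_Sub: "\<lbrakk>\<Gamma> \<in> Ob E; A \<in> Over E \<Gamma>; x \<in> Tm E \<Gamma> A\<rbrakk>
      \<Longrightarrow> tfun_eq (slice E (src E \<Gamma> A))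
            (tcomp (slice_fun E H \<Gamma>) (Sub E \<Gamma> A x))
            (tcomp (Sub D (fob H \<Gamma>) (far H \<Gamma> A) (ftm H \<Gamma> A x)) (slice_fun E H (src E \<Gamma> A)))"
    and hom_Wk: "\<lbrakk>\<Gamma> \<in> Ob E; A \<in> Over E \<Gamma>\<rbrakk>
      \<Longrightarrow> tfun_eq (slice E \<Gamma>)
            (tcomp (slice_fun E H (src E \<Gamma> A)) (Wk E \<Gamma> A))
            (tcomp (Wk D (fob H \<Gamma>) (far H \<Gamma> A)) (slice_fun E H \<Gamma>))"
    and hom_idtm: "\<lbrakk>\<Gamma> \<in> Ob E; A \<in> Over E \<Gamma>\<rbrakk>
      \<Longrightarrow> ftm H (src E \<Gamma> A) (fob (Wk E \<Gamma> A) A) (idtm E \<Gamma> A) = idtm D (fob H \<Gamma>) (far H \<Gamma> A)"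

text \<open>
  A functor between slices acts on the terms of \<open>B \<in> F/\<Delta>\<close>, an object of \<open>F/\<Delta>\<close>, by regarding
  \<open>B\<close> as the arrow of \<open>F/\<Delta>\<close> from \<open>B\<close> to the terminal object \<open>id\<^sub>\<Delta>\<close>. This reading is used
  here in \<open>Sub_idtm\<close>, and below wherever \<open>ftm\<close> is applied at an identity.
\<close>

locale E_system = pre_E_system E
  for E :: "('o, 'a, 't) esys" +
  assumes Sub_hom: "\<lbrakk>\<Gamma> \<in> Ob E; A \<in> Over E \<Gamma>; x \<in> Tm E \<Gamma> A\<rbrakk>
      \<Longrightarrow> pre_E_hom (slice E (src E \<Gamma> A)) (slice E \<Gamma>) (Sub E \<Gamma> A x)"
    and Wk_hom: "\<lbrakk>\<Gamma> \<in> Ob E; A \<in> Over E \<Gamma>\<rbrakk>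
      \<Longrightarrow> pre_E_hom (slice E \<Gamma>) (slice E (src E \<Gamma> A)) (Wk E \<Gamma> A)"
    and Sub_Wk: "\<lbrakk>\<Gamma> \<in> Ob E; A \<in> Over E \<Gamma>; x \<in> Tm E \<Gamma> A\<rbrakk>
      \<Longrightarrow> tfun_eq (slice E \<Gamma>) (tcomp (Sub E \<Gamma> A x) (Wk E \<Gamma> A)) tid"
    and Sub_idtm: "\<lbrakk>\<Gamma> \<in> Ob E; A \<in> Over E \<Gamma>; x \<in> Tm E \<Gamma> A\<rbrakk>
      \<Longrightarrow> ftm (Sub E \<Gamma> A x) (idn E (src E \<Gamma> A)) (fob (Wk E \<Gamma> A) A) (idtm E \<Gamma> A) = x"
    and Sub_by_idtm: "\<lbrakk>\<Gamma> \<in> Ob E; A \<in> Over E \<Gamma>\<rbrakk>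
      \<Longrightarrow> tfun_eq (slice E (src E \<Gamma> A))
            (tcomp (Sub E (src E \<Gamma> A) (fob (Wk E \<Gamma> A) A) (idtm E \<Gamma> A))
                   (slice_fun (slice E \<Gamma>) (Wk E \<Gamma> A) A))
            tid"

text \<open>
  The objects, arrows and terms of the systems in \<open>Esys\<close> are drawn from an arbitrary but fixed
  type \<open>'u\<close>, which plays the role of a universe of small sets. An arrow with codomain \<open>D\<close> is a
  pair of its domain and an E-homomorphism.
\<close>

definition Esys :: "(('u, 'u, 'u) esys,
    ('u, 'u, 'u) esys \<times> ('u, 'u, 'u, 'u, 'u, 'u) tfnct) cat" where
  "Esys =
    \<lparr>Ob = {E. E_system E},
     Over = \<lambda>D. {(E, H). E_system E \<and> pre_E_hom E D H \<and> trestr E H = H},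
     src = \<lambda>D (E, H). E,
     idn = \<lambda>E. (E, trestr E tid),
     cmp = \<lambda>D (E, H) (E', K). (E', trestr E' (tcomp H K))\<rparr>"


section \<open>CE-systems\<close>

text \<open>
  \<open>Inc\<close> is the action on arrows of the identity-on-objects functor \<open>I\<close>. For an arrow
  \<open>f \<in> Over (Con S) \<Gamma>\<close> and \<open>A \<in> Over (Fam S) \<Gamma>\<close>, \<open>pb S \<Gamma> f A\<close> is \<open>f\<^sup>*A\<close> and \<open>pr2 S \<Gamma> f A\<close>
  is \<open>\<pi>\<^sub>2(f, A)\<close>, an arrow with codomain \<open>\<Gamma>.A\<close>.
\<close>

record ('o, 'a, 'c) cesys =
  Fam :: "('o, 'a) cat"
  Con :: "('o, 'c) cat"
  Inc :: "'o \<Rightarrow> 'a \<Rightarrow> 'c"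
  one :: "'o"
  pb :: "'o \<Rightarrow> 'c \<Rightarrow> 'a \<Rightarrow> 'a"
  pr2 :: "'o \<Rightarrow> 'c \<Rightarrow> 'a \<Rightarrow> 'c"

locale CE_system =
  fixes S :: "('o, 'a, 'c) cesys"
  assumes Fam_category: "strict_category (Fam S)"
    and Con_category: "strict_category (Con S)"
    and same_Ob: "Ob (Con S) = Ob (Fam S)"
    and Inc_functor: "strict_functor (Fam S) (Con S) \<lparr>fob = \<lambda>\<Gamma>. \<Gamma>, far = Inc S\<rparr>"
    and terminal_one: "terminal (Fam S) (one S)"
    and pb_Over: "\<lbrakk>\<Gamma> \<in> Ob (Fam S); f \<in> hom (Con S) \<Delta> \<Gamma>; A \<in> Over (Fam S) \<Gamma>\<rbrakk>
      \<Longrightarrow> pb S \<Gamma> f A \<in> Over (Fam S) \<Delta>"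
    and pr2_hom: "\<lbrakk>\<Gamma> \<in> Ob (Fam S); f \<in> hom (Con S) \<Delta> \<Gamma>; A \<in> Over (Fam S) \<Gamma>\<rbrakk>
      \<Longrightarrow> pr2 S \<Gamma> f A \<in> hom (Con S) (src (Fam S) \<Delta> (pb S \<Gamma> f A)) (src (Fam S) \<Gamma> A)"
    and pb_pullback: "\<lbrakk>\<Gamma> \<in> Ob (Fam S); f \<in> hom (Con S) \<Delta> \<Gamma>; A \<in> Over (Fam S) \<Gamma>\<rbrakk>
      \<Longrightarrow> pullback (Con S) \<Gamma> (Inc S \<Gamma> A) f (pr2 S \<Gamma> f A) (Inc S \<Delta> (pb S \<Gamma> f A))"
    and pb_idn: "\<lbrakk>\<Gamma> \<in> Ob (Fam S); f \<in> hom (Con S) \<Delta> \<Gamma>\<rbrakk>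
      \<Longrightarrow> pb S \<Gamma> f (idn (Fam S) \<Gamma>) = idn (Fam S) \<Delta>"
    and pr2_idn: "\<lbrakk>\<Gamma> \<in> Ob (Fam S); f \<in> hom (Con S) \<Delta> \<Gamma>\<rbrakk>
      \<Longrightarrow> pr2 S \<Gamma> f (idn (Fam S) \<Gamma>) = f"
    and pb_along_idn: "\<lbrakk>\<Gamma> \<in> Ob (Fam S); A \<in> Over (Fam S) \<Gamma>\<rbrakk>
      \<Longrightarrow> pb S \<Gamma> (idn (Con S) \<Gamma>) A = A"
    and pr2_along_idn: "\<lbrakk>\<Gamma> \<in> Ob (Fam S); A \<in> Over (Fam S) \<Gamma>\<rbrakk>
      \<Longrightarrow> pr2 S \<Gamma> (idn (Con S) \<Gamma>) A = idn (Con S) (src (Fam S) \<Gamma> A)"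
    and pb_along_cmp: "\<lbrakk>\<Gamma> \<in> Ob (Fam S); f \<in> hom (Con S) \<Delta> \<Gamma>; g \<in> Over (Con S) \<Delta>;
        A \<in> Over (Fam S) \<Gamma>\<rbrakk>
      \<Longrightarrow> pb S \<Gamma> (cmp (Con S) \<Gamma> f g) A = pb S \<Delta> g (pb S \<Gamma> f A)"
    and pr2_along_cmp: "\<lbrakk>\<Gamma> \<in> Ob (Fam S); f \<in> hom (Con S) \<Delta> \<Gamma>; g \<in> Over (Con S) \<Delta>;
        A \<in> Over (Fam S) \<Gamma>\<rbrakk>
      \<Longrightarrow> pr2 S \<Gamma> (cmp (Con S) \<Gamma> f g) A
        = cmp (Con S) (src (Fam S) \<Gamma> A) (pr2 S \<Gamma> f A) (pr2 S \<Delta> g (pb S \<Gamma> f A))"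
    and pb_cmp: "\<lbrakk>\<Gamma> \<in> Ob (Fam S); f \<in> hom (Con S) \<Delta> \<Gamma>; A \<in> Over (Fam S) \<Gamma>;
        P \<in> Over (Fam S) (src (Fam S) \<Gamma> A)\<rbrakk>
      \<Longrightarrow> pb S \<Gamma> f (cmp (Fam S) \<Gamma> A P)
        = cmp (Fam S) \<Delta> (pb S \<Gamma> f A) (pb S (src (Fam S) \<Gamma> A) (pr2 S \<Gamma> f A) P)"
    and pr2_cmp: "\<lbrakk>\<Gamma> \<in> Ob (Fam S); f \<in> hom (Con S) \<Delta> \<Gamma>; A \<in> Over (Fam S) \<Gamma>;
        P \<in> Over (Fam S) (src (Fam S) \<Gamma> A)\<rbrakk>
      \<Longrightarrow> pr2 S \<Gamma> f (cmp (Fam S) \<Gamma> A P) = pr2 S (src (Fam S) \<Gamma> A) (pr2 S \<Gamma> f A) P"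

definition rooted :: "('o, 'a, 'c) cesys \<Rightarrow> bool" where
  "rooted S \<longleftrightarrow> terminal (Con S) (one S)"

locale CE_hom =
  fixes S :: "('o, 'a, 'c) cesys" and S' :: "('p, 'b, 'd) cesys"
    and FF :: "('o, 'a, 'p, 'b) fnct" and FC :: "('o, 'c, 'p, 'd) fnct"
  assumes functor_Fam: "strict_functor (Fam S) (Fam S') FF"
    and functor_Con: "strict_functor (Con S) (Con S') FC"
    and commute_Ob: "\<Gamma> \<in> Ob (Fam S) \<Longrightarrow> fob FC \<Gamma> = fob FF \<Gamma>"
    and commute_Inc: "\<lbrakk>\<Gamma> \<in> Ob (Fam S); A \<in> Over (Fam S) \<Gamma>\<rbrakk>
      \<Longrightarrow> far FC \<Gamma> (Inc S \<Gamma> A) = Inc S' (fob FF \<Gamma>) (far FF \<Gamma> A)"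
    and hom_one: "fob FF (one S) = one S'"
    and hom_pb: "\<lbrakk>\<Gamma> \<in> Ob (Fam S); f \<in> hom (Con S) \<Delta> \<Gamma>; A \<in> Over (Fam S) \<Gamma>\<rbrakk>
      \<Longrightarrow> far FF \<Delta> (pb S \<Gamma> f A) = pb S' (fob FF \<Gamma>) (far FC \<Gamma> f) (far FF \<Gamma> A)"
    and hom_pr2: "\<lbrakk>\<Gamma> \<in> Ob (Fam S); f \<in> hom (Con S) \<Delta> \<Gamma>; A \<in> Over (Fam S) \<Gamma>\<rbrakk>
      \<Longrightarrow> far FC (src (Fam S) \<Gamma> A) (pr2 S \<Gamma> f A)
        = pr2 S' (fob FF \<Gamma>) (far FC \<Gamma> f) (far FF \<Gamma> A)"

definition CEsys :: "(('u, 'u, 'u) cesys,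
    ('u, 'u, 'u) cesys \<times> ('u, 'u, 'u, 'u) fnct \<times> ('u, 'u, 'u, 'u) fnct) cat" where
  "CEsys =
    \<lparr>Ob = {S. CE_system S},
     Over = \<lambda>S'. {(S, FF, FC). CE_system S \<and> CE_hom S S' FF FC \<and>
       frestr (Fam S) FF = FF \<and> frestr (Con S) FC = FC},
     src = \<lambda>S' (S, FF, FC). S,
     idn = \<lambda>S. (S, frestr (Fam S) fid, frestr (Con S) fid),
     cmp = \<lambda>S'' (S', GF, GC) (S, FF, FC).
       (S, frestr (Fam S) (fcomp GF FF), frestr (Con S) (fcomp GC FC))\<rparr>"

definition rCEsys :: "(('u, 'u, 'u) cesys,
    ('u, 'u, 'u) cesys \<times> ('u, 'u, 'u, 'u) fnct \<times> ('u, 'u, 'u, 'u) fnct) cat" where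
  "rCEsys = full_subcat CEsys rooted"


section \<open>From CE-systems to E-systems\<close>

definition sections :: "('o, 'a, 'c) cesys \<Rightarrow> 'o \<Rightarrow> 'a \<Rightarrow> 'c set" where
  "sections S \<Gamma> A = {x \<in> hom (Con S) \<Gamma> (src (Fam S) \<Gamma> A).
    cmp (Con S) \<Gamma> (Inc S \<Gamma> A) x = idn (Con S) \<Gamma>}"

text \<open>
  \<open>pb_fun S \<Gamma> f\<close> is \<open>f\<^sup>* : F/\<Gamma> \<rightarrow> F/\<Delta>\<close> for \<open>f : \<Delta> \<rightarrow> \<Gamma>\<close>; its action on the arrows
  \<open>Q \<in> F/\<Gamma>.B\<close> is the one forced by \<open>f\<^sup>*(B.Q) = f\<^sup>*B \<circ> \<pi>\<^sub>2(f, B)\<^sup>*Q\<close>.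
\<close>

definition pb_fun :: "('o, 'a, 'c) cesys \<Rightarrow> 'o \<Rightarrow> 'c \<Rightarrow> ('a, 'a, 'c, 'a, 'a, 'c) tfnct" where
  "pb_fun S \<Gamma> f =
    \<lparr>fob = \<lambda>B. pb S \<Gamma> f B,
     far = \<lambda>B Q. pb S (src (Fam S) \<Gamma> B) (pr2 S \<Gamma> f B) Q,
     ftm = \<lambda>B Q y.
       let \<Delta> = src (Con S) \<Gamma> f; \<Gamma>B = src (Fam S) \<Gamma> B; \<Gamma>BQ = src (Fam S) \<Gamma>B Q
       in THE z. z \<in> sections S (src (Fam S) \<Delta> (pb S \<Gamma> f B)) (pb S \<Gamma>B (pr2 S \<Gamma> f B) Q) \<and>
            cmp (Con S) \<Gamma>BQ (pr2 S \<Gamma> f (cmp (Fam S) \<Gamma> B Q)) z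
            = cmp (Con S) \<Gamma>BQ y (pr2 S \<Gamma> f B)\<rparr>"

definition CE2E_ob :: "('o, 'a, 'c) cesys \<Rightarrow> ('o, 'a, 'c) esys" where
  "CE2E_ob S =
    \<lparr>Ob = Ob (Fam S),
     Over = Over (Fam S),
     src = src (Fam S),
     idn = idn (Fam S),
     cmp = cmp (Fam S),
     Tm = sections S,
     root = one S,
     Sub = \<lambda>\<Gamma> A x. pb_fun S (src (Fam S) \<Gamma> A) x,
     Wk = \<lambda>\<Gamma> A. pb_fun S \<Gamma> (Inc S \<Gamma> A),
     idtm = \<lambda>\<Gamma> A. THE z.
       z \<in> sections S (src (Fam S) \<Gamma> A) (pb S \<Gamma> (Inc S \<Gamma> A) A) \<and>
       cmp (Con S) (src (Fam S) \<Gamma> A) (pr2 S \<Gamma> (Inc S \<Gamma> A) A) z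
       = idn (Con S) (src (Fam S) \<Gamma> A)\<rparr>"

definition CE2E_hom :: "('o, 'a, 'c) cesys \<Rightarrow> ('o, 'a, 'p, 'b) fnct \<Rightarrow> ('o, 'c, 'p, 'd) fnct
    \<Rightarrow> ('o, 'a, 'c, 'p, 'b, 'd) tfnct" where
  "CE2E_hom S FF FC = trestr (CE2E_ob S)
    \<lparr>fob = fob FF, far = far FF, ftm = \<lambda>\<Gamma> A x. far FC (src (Fam S) \<Gamma> A) x\<rparr>"

definition CE2E :: "(('u, 'u, 'u) cesys,
    ('u, 'u, 'u) cesys \<times> ('u, 'u, 'u, 'u) fnct \<times> ('u, 'u, 'u, 'u) fnct,
    ('u, 'u, 'u) esys, ('u, 'u, 'u) esys \<times> ('u, 'u, 'u, 'u, 'u, 'u) tfnct) fnct" where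
  "CE2E = \<lparr>fob = CE2E_ob, far = \<lambda>S' (S, FF, FC). (CE2E_ob S, CE2E_hom S FF FC)\<rparr>"


section \<open>From E-systems to CE-systems\<close>

definition thom :: "('o, 'a, 't) esys \<Rightarrow> 'o \<Rightarrow> 'a \<Rightarrow> 'a \<Rightarrow> 't set" where
  "thom E \<Gamma> A B = Tm E (src E \<Gamma> A) (fob (Wk E \<Gamma> A) B)"

text \<open>\<open>tstar E \<Gamma> A B f\<close> is \<open>f\<^sup>* = S\<^sub>f \<circ> (W\<^sub>A/B) : E/\<Gamma>.B \<rightarrow> E/\<Gamma>.A\<close> for \<open>f \<in> thom(A, B)\<close>.\<close>

definition tstar :: "('o, 'a, 't) esys \<Rightarrow> 'o \<Rightarrow> 'a \<Rightarrow> 'a \<Rightarrow> 't \<Rightarrow> ('a, 'a, 't, 'a, 'a, 't) tfnct" where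
  "tstar E \<Gamma> A B f = tcomp (Sub E (src E \<Gamma> A) (fob (Wk E \<Gamma> A) B) f)
    (slice_fun (slice E \<Gamma>) (Wk E \<Gamma> A) B)"

text \<open>\<open>tcmp E \<Gamma> A B C g f\<close> is \<open>g \<cdot> f\<close> for \<open>g \<in> thom(B, C)\<close> and \<open>f \<in> thom(A, B)\<close>.\<close>

definition tcmp :: "('o, 'a, 't) esys \<Rightarrow> 'o \<Rightarrow> 'a \<Rightarrow> 'a \<Rightarrow> 'a \<Rightarrow> 't \<Rightarrow> 't \<Rightarrow> 't" where
  "tcmp E \<Gamma> A B C g f =
    ftm (tstar E \<Gamma> A B f) (idn E (src E \<Gamma> B)) (fob (Wk E \<Gamma> B) C) g"

text \<open>
  \<open>tpair E \<Gamma> A P x u\<close> is \<open>x.u \<in> T(A.P)\<close> for \<open>A \<in> F/\<Gamma>\<close>, \<open>P \<in> F/\<Gamma>.A\<close>, \<open>x \<in> T(A)\<close> and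
  \<open>u \<in> T(S\<^sub>x(P))\<close>. Here \<open>W\<^bsub>A.P\<^esub>(A.P) \<in> F/\<Gamma>.A.P\<close> is regarded as an arrow of \<open>F/\<Gamma>.A\<close> with
  codomain \<open>P\<close>, to which \<open>S\<^sub>x\<close> is applied.
\<close>

definition tpair :: "('o, 'a, 't) esys \<Rightarrow> 'o \<Rightarrow> 'a \<Rightarrow> 'a \<Rightarrow> 't \<Rightarrow> 't \<Rightarrow> 't" where
  "tpair E \<Gamma> A P x u =
    (let AP = cmp E \<Gamma> A P; W = fob (Wk E \<Gamma> AP) AP; SP = fob (Sub E \<Gamma> A x) P
     in ftm (Sub E \<Gamma> SP u) (idn E (src E \<Gamma> SP)) (far (Sub E \<Gamma> A x) P W)
          (ftm (Sub E \<Gamma> A x) P W (idtm E \<Gamma> AP)))"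

text \<open>
  The sets \<open>thom(A, B)\<close> need not be disjoint, so an arrow \<open>f \<in> thom(A, B)\<close> of the second
  category is tagged with its domain \<open>A\<close>. To stay inside the universe \<open>'u\<close>, pairs are encoded
  by an injection \<open>tag : 'u \<times> 'u \<rightarrow> 'u\<close>, which exists for every infinite type.
\<close>

definition tag :: "'u::infinite \<times> 'u \<Rightarrow> 'u" where
  "tag = (SOME t. inj t)"

lemma inj_tag: "inj (tag :: 'u::infinite \<times> 'u \<Rightarrow> 'u)"
proof -
  include cardinal_syntax
  have "|UNIV \<times> UNIV :: ('u \<times> 'u) set| =o |UNIV :: 'u set|"
    by (rule card_of_Times_same_infinite) (rule infinite_UNIV)
  then obtain t :: "'u \<times> 'u \<Rightarrow> 'u" where "bij_betw t (UNIV \<times> UNIV) UNIV"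
    using card_of_ordIso by blast
  then have "\<exists>t :: 'u \<times> 'u \<Rightarrow> 'u. inj t"
    by (auto simp: bij_betw_def)
  then show ?thesis
    unfolding tag_def by (rule someI_ex)
qed

definition untag :: "'u::infinite \<Rightarrow> 'u \<times> 'u" where
  "untag = inv tag"

definition E2C :: "('u::infinite, 'u, 'u) esys \<Rightarrow> 'u \<Rightarrow> ('u, 'u) cat" where
  "E2C E \<Gamma> =
    \<lparr>Ob = Over E \<Gamma>,
     Over = \<lambda>B. {tag (A, f) | A f. A \<in> Over E \<Gamma> \<and> f \<in> thom E \<Gamma> A B},
     src = \<lambda>B h. fst (untag h),
     idn = \<lambda>A. tag (A, idtm E \<Gamma> A),
     cmp = \<lambda>C h k. let (B, g) = untag h; (A, f) = untag k in tag (A, tcmp E \<Gamma> A B C g f)\<rparr>"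

definition E2CE_ob :: "('u::infinite, 'u, 'u) esys \<Rightarrow> ('u, 'u, 'u) cesys" where
  "E2CE_ob E =
    (let \<Gamma> = root E in
     \<lparr>Fam = slice_cat E \<Gamma>,
      Con = E2C E \<Gamma>,
      Inc = \<lambda>A Q. tag (cmp E \<Gamma> A Q,
        ftm (Wk E (src E \<Gamma> A) Q) (idn E (src E \<Gamma> A)) (fob (Wk E \<Gamma> A) A) (idtm E \<Gamma> A)),
      one = idn E \<Gamma>,
      pb = \<lambda>B h R. let (A, f) = untag h in fob (tstar E \<Gamma> A B f) R,
      pr2 = \<lambda>B h R.
        let (A, f) = untag h;
            \<Gamma>A = src E \<Gamma> A;
            fR = fob (tstar E \<Gamma> A B f) R;
            AfR = cmp E \<Gamma> A fR;
            WAB = fob (Wk E \<Gamma> A) B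
        in tag (AfR,
             tpair E (src E \<Gamma> AfR)
               (fob (Wk E \<Gamma>A fR) WAB)
               (far (Wk E \<Gamma> AfR) B R)
               (ftm (Wk E \<Gamma>A fR) (idn E \<Gamma>A) WAB f)
               (idtm E \<Gamma>A fR))\<rparr>)"

definition E2CE_hom :: "('u::infinite, 'u, 'u) esys \<Rightarrow> ('u, 'u, 'u, 'u, 'u, 'u) tfnct
    \<Rightarrow> ('u, 'u, 'u, 'u) fnct \<times> ('u, 'u, 'u, 'u) fnct" where
  "E2CE_hom E H =
    (let \<Gamma> = root E; G = slice_fun E H \<Gamma> in
     (frestr (slice_cat E \<Gamma>) \<lparr>fob = fob G, far = far G\<rparr>,
      frestr (E2C E \<Gamma>)
        \<lparr>fob = fob G,
         far = \<lambda>B h. let (A, f) = untag h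
           in tag (fob G A, ftm H (src E \<Gamma> A) (fob (Wk E \<Gamma> A) B) f)\<rparr>))"

definition E2CE :: "(('u::infinite, 'u, 'u) esys,
    ('u, 'u, 'u) esys \<times> ('u, 'u, 'u, 'u, 'u, 'u) tfnct,
    ('u, 'u, 'u) cesys,
    ('u, 'u, 'u) cesys \<times> ('u, 'u, 'u, 'u) fnct \<times> ('u, 'u, 'u, 'u) fnct) fnct" where
  "E2CE = \<lparr>fob = E2CE_ob, far = \<lambda>D (E, H). (E2CE_ob E, E2CE_hom E H)\<rparr>"

end

theory Submission
  imports Defs
begin

text \<open>
  For an E-homomorphism \<open>K : E/\<Gamma> \<rightarrow> E/\<Delta>\<close> and \<open>R \<in> F/\<Gamma>\<close>, the E-homomorphisms \<open>U : E/\<Gamma>.R \<rightarrow> E/\<Delta>\<close>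
  with \<open>U \<circ> W\<^sub>R = K\<close> correspond bijectively to the terms of \<open>K(R)\<close>, by \<open>U \<mapsto> U(idtm\<^sub>R)\<close> and
  \<open>v \<mapsto> S\<^sub>v \<circ> (K/R)\<close>. Hence the arrows \<open>A \<rightarrow> B\<close> of the second category of \<open>E2CE(E)\<close> are the
  E-homomorphisms \<open>E/B \<rightarrow> E/A\<close> over \<open>E/[]\<close>: the arrow \<open>f\<close> corresponds to \<open>f\<^sup>*\<close>, the inclusion of
  \<open>Q\<close> to \<open>W\<^sub>Q\<close>, and \<open>\<pi>\<^sub>2(f, R)\<close> to the slice \<open>f\<^sup>*/R\<close>. Under this dictionary the functoriality laws
  of a CE-system are immediate, and the pullback property is the bijection above, applied to \<open>R\<close>
  and to \<open>f\<^sup>*R\<close>.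

  The unit sends \<open>\<Gamma>\<close> to the arrow \<open>\<Gamma> \<rightarrow> []\<close> and a term \<open>x\<close> to the section corresponding to \<open>S\<^sub>x\<close>;
  it is bijective on objects, arrows and terms. The counit sends \<open>A\<close> to its domain and a section
  \<open>f\<close> of \<open>I(A)\<^sup>*B\<close> to \<open>\<pi>\<^sub>2(I(A), B) \<circ> f\<close>. By the pullback property its image consists of the arrows
  over \<open>1\<close>, and these are all arrows exactly when \<open>1\<close> is terminal in the second category.
\<close>

section \<open>Functors between slices\<close>

text \<open>The obstacle is equality. Functors between slices are total functions on a type, so they
  agree only on carriers, and the records of (E/\<Gamma>)/A and E/\<Gamma>.A differ off the
  carriers. Every equation of functors is therefore an instance of \<open>tfun_eq\<close> over a
  slice, and the arguments are chains of such equations under congruence of \<open>tcomp\<close>;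
  replacing the outer functor of a composite costs a typing fact about the inner one. The bijection
  between functors and terms spends the axioms as follows: \<open>Sub_Wk\<close> and
  \<open>Sub_idtm\<close> give the extension S_v (K/R) and its value v, while
  \<open>Sub_by_idtm\<close> makes an extension unique. The rooted CE-systems enter because T(id)
  has exactly one element in any E-system: S_x and W_id act there as identities, whereas S_x(idtm) =
  x. Hence the second category of every E2CE(E) has 1 terminal, E2CE lands in the full subcategory,
  and the adjunction restricts to it. Conversely, in a rooted system every arrow of the second
  category lies over 1, which makes the counit surjective on arrows.\<close>

lemma slice_simps [simp]:
  "Ob (slice E \<Gamma>) = Over E \<Gamma>"
  "Over (slice E \<Gamma>) = (\<lambda>A. Over E (src E \<Gamma> A))"
  "src (slice E \<Gamma>) = (\<lambda>A P. cmp E \<Gamma> A P)"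
  "idn (slice E \<Gamma>) = (\<lambda>A. idn E (src E \<Gamma> A))"
  "cmp (slice E \<Gamma>) = (\<lambda>A P Q. cmp E (src E \<Gamma> A) P Q)"
  "Tm (slice E \<Gamma>) = (\<lambda>A P. Tm E (src E \<Gamma> A) P)"
  "root (slice E \<Gamma>) = idn E \<Gamma>"
  "Sub (slice E \<Gamma>) = (\<lambda>A P x. Sub E (src E \<Gamma> A) P x)"
  "Wk (slice E \<Gamma>) = (\<lambda>A P. Wk E (src E \<Gamma> A) P)"
  "idtm (slice E \<Gamma>) = (\<lambda>A P. idtm E (src E \<Gamma> A) P)"
  by (simp_all add: slice_def slice_cat_def)

lemma slice_cat_simps [simp]:
  "Ob (slice_cat E \<Gamma>) = Over E \<Gamma>"
  "Over (slice_cat E \<Gamma>) = (\<lambda>A. Over E (src E \<Gamma> A))"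
  "src (slice_cat E \<Gamma>) = (\<lambda>A P. cmp E \<Gamma> A P)"
  "idn (slice_cat E \<Gamma>) = (\<lambda>A. idn E (src E \<Gamma> A))"
  "cmp (slice_cat E \<Gamma>) = (\<lambda>A P Q. cmp E (src E \<Gamma> A) P Q)"
  by (simp_all add: slice_cat_def)

lemma slice_fun_simps [simp]:
  "fob (slice_fun C G \<Gamma>) = (\<lambda>A. far G \<Gamma> A)"
  "far (slice_fun C G \<Gamma>) = (\<lambda>A P. far G (src C \<Gamma> A) P)"
  "ftm (slice_fun C G \<Gamma>) = (\<lambda>A P x. ftm G (src C \<Gamma> A) P x)"
  by (simp_all add: slice_fun_def)

lemma tcomp_simps [simp]:
  "fob (tcomp G F) = (\<lambda>\<Gamma>. fob G (fob F \<Gamma>))"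
  "far (tcomp G F) = (\<lambda>\<Gamma> A. far G (fob F \<Gamma>) (far F \<Gamma> A))"
  "ftm (tcomp G F) = (\<lambda>\<Gamma> A x. ftm G (fob F \<Gamma>) (far F \<Gamma> A) (ftm F \<Gamma> A x))"
  by (simp_all add: tcomp_def)

lemma tid_simps [simp]:
  "fob tid = (\<lambda>\<Gamma>. \<Gamma>)" "far tid = (\<lambda>\<Gamma> A. A)" "ftm tid = (\<lambda>\<Gamma> A x. x)"
  by (simp_all add: tid_def)

lemma tcomp_assoc: "tcomp (tcomp F G) H = tcomp F (tcomp G H)"
  by (simp add: tcomp_def)

lemma slice_fun_tid [simp]: "slice_fun C tid \<Gamma> = tid"
  by (simp add: slice_fun_def tid_def)

lemma tcomp_tid [simp]: "tcomp F tid = F" "tcomp tid F = F"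
  by (simp_all add: tcomp_def)

lemma tfun_eqI:
  assumes "\<And>\<Gamma>. \<Gamma> \<in> Ob C \<Longrightarrow> fob F \<Gamma> = fob G \<Gamma>"
    and "\<And>\<Gamma> A. \<lbrakk>\<Gamma> \<in> Ob C; A \<in> Over C \<Gamma>\<rbrakk> \<Longrightarrow> far F \<Gamma> A = far G \<Gamma> A"
    and "\<And>\<Gamma> A x. \<lbrakk>\<Gamma> \<in> Ob C; A \<in> Over C \<Gamma>; x \<in> Tm C \<Gamma> A\<rbrakk> \<Longrightarrow> ftm F \<Gamma> A x = ftm G \<Gamma> A x"
  shows "tfun_eq C F G"
  using assms by (simp add: tfun_eq_def)

lemma tfun_eq_fob: "\<lbrakk>tfun_eq C F G; \<Gamma> \<in> Ob C\<rbrakk> \<Longrightarrow> fob F \<Gamma> = fob G \<Gamma>"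
  and tfun_eq_far: "\<lbrakk>tfun_eq C F G; \<Gamma> \<in> Ob C; A \<in> Over C \<Gamma>\<rbrakk> \<Longrightarrow> far F \<Gamma> A = far G \<Gamma> A"
  and tfun_eq_ftm: "\<lbrakk>tfun_eq C F G; \<Gamma> \<in> Ob C; A \<in> Over C \<Gamma>; x \<in> Tm C \<Gamma> A\<rbrakk>
    \<Longrightarrow> ftm F \<Gamma> A x = ftm G \<Gamma> A x"
  by (simp_all add: tfun_eq_def)

lemma tfun_eq_refl [simp]: "tfun_eq C F F"
  by (simp add: tfun_eq_def)

lemma tfun_eq_sym: "tfun_eq C F G \<Longrightarrow> tfun_eq C G F"
  by (simp add: tfun_eq_def)

lemma tfun_eq_trans [trans]: "\<lbrakk>tfun_eq C F G; tfun_eq C G H\<rbrakk> \<Longrightarrow> tfun_eq C F H"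
  by (simp add: tfun_eq_def)

lemma tcomp_cong_right: "tfun_eq C F F' \<Longrightarrow> tfun_eq C (tcomp G F) (tcomp G F')"
  by (simp add: tfun_eq_def)

text \<open>The functors \<open>G\<close> and \<open>G'\<close> agree only on the carrier of
  \<open>D\<close>, so \<open>F\<close> must be known to map \<open>C\<close> into \<open>D\<close>;
  this is the price of partial equality that recurs in every chain below.\<close>

lemma tcomp_cong_left:
  assumes "tfunctor C D F" and "tfun_eq D G G'"
  shows "tfun_eq C (tcomp G F) (tcomp G' F)"
proof -
  interpret tfunctor C D F by fact
  show ?thesis
    using assms(2) fob_Ob far_Over ftm_Tm by (simp add: tfun_eq_def)
qed

lemma tfunctor_tcomp:
  assumes "strict_category C" and "tfunctor C D F" and "tfunctor D B G"
  shows "tfunctor C B (tcomp G F)"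
proof -
  interpret strict_category C by fact
  interpret F: tfunctor C D F by fact
  interpret G: tfunctor D B G by fact
  show ?thesis
    by unfold_locales
      (auto simp: src_Ob F.fob_Ob F.far_Over F.src_far F.far_idn F.far_cmp F.ftm_Tm
        G.fob_Ob G.far_Over G.src_far G.far_idn G.far_cmp G.ftm_Tm)
qed

lemma tfunctor_cong:
  assumes "strict_category C" and "tfunctor C D F" and eq: "tfun_eq C F G"
  shows "tfunctor C D G"
proof -
  interpret strict_category C by fact
  interpret F: tfunctor C D F by fact
  show ?thesis
    by unfold_locales
      (use F.fob_Ob F.far_Over F.src_far F.far_idn F.far_cmp F.ftm_Tm src_Ob idn_Over cmp_Over in
        \<open>auto simp: tfun_eq_fob[OF eq, symmetric] tfun_eq_far[OF eq, symmetric]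
          tfun_eq_ftm[OF eq, symmetric]\<close>)
qed

lemma strict_category_slice_cat:
  assumes "strict_category E" and "\<Gamma> \<in> Ob E"
  shows "strict_category (slice_cat E \<Gamma>)"
proof -
  interpret strict_category E by fact
  show ?thesis
    by unfold_locales
      (use assms(2) in \<open>auto simp: src_Ob idn_Over src_idn cmp_Over src_cmp cmp_idn_left
        cmp_idn_right cmp_assoc\<close>)
qed

lemma strict_category_slice:
  assumes "strict_category E" and "\<Gamma> \<in> Ob E"
  shows "strict_category (slice E \<Gamma>)"
proof -
  interpret strict_category E by fact
  show ?thesis
    by unfold_locales
      (use assms(2) in \<open>auto simp: src_Ob idn_Over src_idn cmp_Over src_cmp cmp_idn_left
        cmp_idn_right cmp_assoc\<close>)
qed

text \<open>The two records differ: in the double slice \<open>Over\<close> and \<open>Tm\<close>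
  are taken at the source of the composite A.P, in the single slice at the source of P. They agree
  for genuine P by \<open>src_cmp\<close>, so the identification is transferred through predicates
  instead of an equality of records.\<close>

lemma tfun_eq_slice_slice:
  assumes "strict_category E" and "\<Gamma> \<in> Ob E" and "A \<in> Over E \<Gamma>"
  shows "tfun_eq (slice (slice E \<Gamma>) A) F G \<longleftrightarrow> tfun_eq (slice E (src E \<Gamma> A)) F G"
proof -
  interpret strict_category E by fact
  show ?thesis
    using assms(2,3) by (auto simp: tfun_eq_def src_cmp)
qed

lemma slice_fun_cong:
  assumes "strict_category E" and "tfun_eq E F G" and "\<Gamma> \<in> Ob E"
  shows "tfun_eq (slice E \<Gamma>) (slice_fun E F \<Gamma>) (slice_fun E G \<Gamma>)"
proof -
  interpret strict_category E by fact
  show ?thesis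
    using assms(2,3) by (auto simp: tfun_eq_def src_Ob)
qed

lemma slice_fun_tcomp:
  assumes "tfunctor E D F" and "\<Gamma> \<in> Ob E"
  shows "tfun_eq (slice E \<Gamma>) (slice_fun E (tcomp G F) \<Gamma>)
    (tcomp (slice_fun D G (fob F \<Gamma>)) (slice_fun E F \<Gamma>))"
proof -
  interpret tfunctor E D F by fact
  show ?thesis
    using assms(2) by (auto simp: tfun_eq_def src_far)
qed

lemma tfunctor_slice_fun:
  assumes "strict_category E" and "tfunctor E D F" and "\<Gamma> \<in> Ob E"
  shows "tfunctor (slice E \<Gamma>) (slice D (fob F \<Gamma>)) (slice_fun E F \<Gamma>)"
proof -
  interpret strict_category E by fact
  interpret F: tfunctor E D F by fact
  show ?thesis
    by unfold_locales
      (use assms(3) in \<open>auto simp: src_Ob src_cmp F.far_Over F.src_far F.far_idn F.far_cmp F.ftm_Tm\<close>)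
qed

lemma tfunctor_slice_slice:
  assumes "strict_category E" and "\<Gamma> \<in> Ob E" and "A \<in> Over E \<Gamma>"
    and "strict_category D" and "\<Delta> \<in> Ob D" and "B \<in> Over D \<Delta>"
  shows "tfunctor (slice (slice E \<Gamma>) A) (slice (slice D \<Delta>) B) F
    \<longleftrightarrow> tfunctor (slice E (src E \<Gamma> A)) (slice D (src D \<Delta> B)) F"
proof
  interpret E: strict_category E by fact
  interpret D: strict_category D by fact
  {
    assume "tfunctor (slice (slice E \<Gamma>) A) (slice (slice D \<Delta>) B) F"
    then interpret F: tfunctor "slice (slice E \<Gamma>) A" "slice (slice D \<Delta>) B" F .
    show "tfunctor (slice E (src E \<Gamma> A)) (slice D (src D \<Delta> B)) F"
      by unfold_locales
        (use assms F.fob_Ob F.far_Over F.src_far F.far_idn F.far_cmp F.ftm_Tm in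
          \<open>auto simp: E.src_cmp D.src_cmp E.cmp_Over E.src_Ob\<close>)
  next
    assume "tfunctor (slice E (src E \<Gamma> A)) (slice D (src D \<Delta> B)) F"
    then interpret F: tfunctor "slice E (src E \<Gamma> A)" "slice D (src D \<Delta> B)" F .
    show "tfunctor (slice (slice E \<Gamma>) A) (slice (slice D \<Delta>) B) F"
      by unfold_locales
        (use assms F.fob_Ob F.far_Over F.src_far F.far_idn F.far_cmp F.ftm_Tm in
          \<open>auto simp: E.src_cmp D.src_cmp E.cmp_Over E.src_Ob\<close>)
  }
qed

section \<open>Homomorphisms of pre-E-systems\<close>

text \<open>Being an E-homomorphism is insensitive to values off the carrier; this is what lets a
  homomorphism be replaced by its normal form under \<open>trestr\<close>.\<close>

lemma pre_E_hom_cong: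
  assumes "pre_E_system E" and "pre_E_system D" and "pre_E_hom E D H" and eq: "tfun_eq E H K"
  shows "pre_E_hom E D K"
proof -
  interpret E: pre_E_system E by fact
  interpret D: pre_E_system D by fact
  interpret H: pre_E_hom E D H by fact
  have K: "tfunctor E D K"
    by (rule tfunctor_cong[OF E.strict_category_axioms H.tfunctor_axioms eq])
  note [simp] = tfun_eq_fob[OF eq] tfun_eq_far[OF eq] tfun_eq_ftm[OF eq]
  have sl: "tfun_eq (slice E \<Gamma>) (slice_fun E H \<Gamma>) (slice_fun E K \<Gamma>)" if "\<Gamma> \<in> Ob E" for \<Gamma>
    by (rule slice_fun_cong[OF E.strict_category_axioms eq that])
  show ?thesis
  proof (rule pre_E_hom.intro[OF K], unfold_locales)
    have "root E \<in> Ob E"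
      using E.terminal_root by (simp add: terminal_def)
    then show "fob K (root E) = root D"
      using H.hom_root by simp
  next
    fix \<Gamma> A x
    assume *: "\<Gamma> \<in> Ob E" "A \<in> Over E \<Gamma>" "x \<in> Tm E \<Gamma> A"
    then have **: "src E \<Gamma> A \<in> Ob E" by (simp add: E.src_Ob)
    have "tfun_eq (slice E (src E \<Gamma> A)) (tcomp (slice_fun E K \<Gamma>) (Sub E \<Gamma> A x))
      (tcomp (slice_fun E H \<Gamma>) (Sub E \<Gamma> A x))"
      by (rule tcomp_cong_left[OF E.Sub_functor[OF *]], rule tfun_eq_sym, rule sl[OF *(1)])
    also note H.hom_Sub[OF *]
    also have "tfun_eq (slice E (src E \<Gamma> A))
      (tcomp (Sub D (fob H \<Gamma>) (far H \<Gamma> A) (ftm H \<Gamma> A x)) (slice_fun E H (src E \<Gamma> A)))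
      (tcomp (Sub D (fob H \<Gamma>) (far H \<Gamma> A) (ftm H \<Gamma> A x)) (slice_fun E K (src E \<Gamma> A)))"
      by (rule tcomp_cong_right[OF sl[OF **]])
    finally show "tfun_eq (slice E (src E \<Gamma> A)) (tcomp (slice_fun E K \<Gamma>) (Sub E \<Gamma> A x))
      (tcomp (Sub D (fob K \<Gamma>) (far K \<Gamma> A) (ftm K \<Gamma> A x)) (slice_fun E K (src E \<Gamma> A)))"
      using * by simp
  next
    fix \<Gamma> A
    assume *: "\<Gamma> \<in> Ob E" "A \<in> Over E \<Gamma>"
    then have **: "src E \<Gamma> A \<in> Ob E" by (simp add: E.src_Ob)
    have "tfun_eq (slice E \<Gamma>) (tcomp (slice_fun E K (src E \<Gamma> A)) (Wk E \<Gamma> A))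
      (tcomp (slice_fun E H (src E \<Gamma> A)) (Wk E \<Gamma> A))"
      by (rule tcomp_cong_left[OF E.Wk_functor[OF *]], rule tfun_eq_sym, rule sl[OF **])
    also note H.hom_Wk[OF *]
    also have "tfun_eq (slice E \<Gamma>) (tcomp (Wk D (fob H \<Gamma>) (far H \<Gamma> A)) (slice_fun E H \<Gamma>))
      (tcomp (Wk D (fob H \<Gamma>) (far H \<Gamma> A)) (slice_fun E K \<Gamma>))"
      by (rule tcomp_cong_right[OF sl[OF *(1)]])
    finally show "tfun_eq (slice E \<Gamma>) (tcomp (slice_fun E K (src E \<Gamma> A)) (Wk E \<Gamma> A))
      (tcomp (Wk D (fob K \<Gamma>) (far K \<Gamma> A)) (slice_fun E K \<Gamma>))"
      using * by simp
    have "fob (Wk E \<Gamma> A) A \<in> Over E (src E \<Gamma> A)"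
      using strict_functor.fob_Ob[OF tfunctor.axioms(1)[OF E.Wk_functor[OF *]]] * by simp
    then show "ftm K (src E \<Gamma> A) (fob (Wk E \<Gamma> A) A) (idtm E \<Gamma> A) = idtm D (fob K \<Gamma>) (far K \<Gamma> A)"
      using * ** H.hom_idtm[OF *] E.idtm_Tm[OF *] by simp
  qed
qed

text \<open>The squares of \<open>H\<close> and \<open>K\<close> are pasted side by side. Slicing
  commutes with composition only up to \<open>tfun_eq\<close>, so \<open>sl\<close> has to be
  inserted at both ends of each chain.\<close>

lemma pre_E_hom_tcomp:
  assumes "pre_E_system C" and "pre_E_hom C D H" and "pre_E_hom D B K"
  shows "pre_E_hom C B (tcomp K H)"
proof -
  interpret C: pre_E_system C by fact
  interpret H: pre_E_hom C D H by fact
  interpret K: pre_E_hom D B K by fact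
  have KH: "tfunctor C B (tcomp K H)"
    by (rule tfunctor_tcomp[OF C.strict_category_axioms H.tfunctor_axioms K.tfunctor_axioms])
  have sl: "tfun_eq (slice C \<Gamma>) (slice_fun C (tcomp K H) \<Gamma>)
    (tcomp (slice_fun D K (fob H \<Gamma>)) (slice_fun C H \<Gamma>))" if "\<Gamma> \<in> Ob C" for \<Gamma>
    by (rule slice_fun_tcomp[OF H.tfunctor_axioms that])
  note slf = tfunctor_slice_fun[OF C.strict_category_axioms H.tfunctor_axioms]
  show ?thesis
  proof (rule pre_E_hom.intro[OF KH], unfold_locales)
    show "fob (tcomp K H) (root C) = root B"
      by (simp add: H.hom_root K.hom_root)
  next
    fix \<Gamma> A x
    assume *: "\<Gamma> \<in> Ob C" "A \<in> Over C \<Gamma>" "x \<in> Tm C \<Gamma> A"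
    then have **: "src C \<Gamma> A \<in> Ob C" by (simp add: C.src_Ob)
    note D = H.fob_Ob[OF *(1)] H.far_Over[OF *(1,2)] H.ftm_Tm[OF *]
    have "tfun_eq (slice C (src C \<Gamma> A)) (tcomp (slice_fun C (tcomp K H) \<Gamma>) (Sub C \<Gamma> A x))
      (tcomp (tcomp (slice_fun D K (fob H \<Gamma>)) (slice_fun C H \<Gamma>)) (Sub C \<Gamma> A x))"
      by (rule tcomp_cong_left[OF C.Sub_functor[OF *] sl[OF *(1)]])
    also have "tfun_eq (slice C (src C \<Gamma> A)) \<dots> (tcomp (slice_fun D K (fob H \<Gamma>))
      (tcomp (Sub D (fob H \<Gamma>) (far H \<Gamma> A) (ftm H \<Gamma> A x)) (slice_fun C H (src C \<Gamma> A))))"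
      unfolding tcomp_assoc by (rule tcomp_cong_right[OF H.hom_Sub[OF *]])
    also have "tfun_eq (slice C (src C \<Gamma> A)) \<dots>
      (tcomp (tcomp (Sub B (fob (tcomp K H) \<Gamma>) (far (tcomp K H) \<Gamma> A) (ftm (tcomp K H) \<Gamma> A x))
        (slice_fun D K (fob H (src C \<Gamma> A)))) (slice_fun C H (src C \<Gamma> A)))"
      unfolding tcomp_assoc[symmetric]
      by (rule tcomp_cong_left[OF slf[OF **]]) (use K.hom_Sub[OF D] * in \<open>simp add: H.src_far\<close>)
    also have "tfun_eq (slice C (src C \<Gamma> A)) \<dots>
      (tcomp (Sub B (fob (tcomp K H) \<Gamma>) (far (tcomp K H) \<Gamma> A) (ftm (tcomp K H) \<Gamma> A x))
        (slice_fun C (tcomp K H) (src C \<Gamma> A)))"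
      unfolding tcomp_assoc by (rule tcomp_cong_right[OF tfun_eq_sym[OF sl[OF **]]])
    finally show "tfun_eq (slice C (src C \<Gamma> A)) (tcomp (slice_fun C (tcomp K H) \<Gamma>) (Sub C \<Gamma> A x))
      (tcomp (Sub B (fob (tcomp K H) \<Gamma>) (far (tcomp K H) \<Gamma> A) (ftm (tcomp K H) \<Gamma> A x))
        (slice_fun C (tcomp K H) (src C \<Gamma> A)))" .
  next
    fix \<Gamma> A
    assume *: "\<Gamma> \<in> Ob C" "A \<in> Over C \<Gamma>"
    then have **: "src C \<Gamma> A \<in> Ob C" by (simp add: C.src_Ob)
    note D = H.fob_Ob[OF *(1)] H.far_Over[OF *]
    have "tfun_eq (slice C \<Gamma>) (tcomp (slice_fun C (tcomp K H) (src C \<Gamma> A)) (Wk C \<Gamma> A))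
      (tcomp (tcomp (slice_fun D K (fob H (src C \<Gamma> A))) (slice_fun C H (src C \<Gamma> A))) (Wk C \<Gamma> A))"
      by (rule tcomp_cong_left[OF C.Wk_functor[OF *] sl[OF **]])
    also have "tfun_eq (slice C \<Gamma>) \<dots> (tcomp (slice_fun D K (fob H (src C \<Gamma> A)))
      (tcomp (Wk D (fob H \<Gamma>) (far H \<Gamma> A)) (slice_fun C H \<Gamma>)))"
      unfolding tcomp_assoc by (rule tcomp_cong_right[OF H.hom_Wk[OF *]])
    also have "tfun_eq (slice C \<Gamma>) \<dots>
      (tcomp (tcomp (Wk B (fob (tcomp K H) \<Gamma>) (far (tcomp K H) \<Gamma> A))
        (slice_fun D K (fob H \<Gamma>))) (slice_fun C H \<Gamma>))"
      unfolding tcomp_assoc[symmetric]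
      by (rule tcomp_cong_left[OF slf[OF *(1)]]) (use K.hom_Wk[OF D] * in \<open>simp add: H.src_far\<close>)
    also have "tfun_eq (slice C \<Gamma>) \<dots>
      (tcomp (Wk B (fob (tcomp K H) \<Gamma>) (far (tcomp K H) \<Gamma> A)) (slice_fun C (tcomp K H) \<Gamma>))"
      unfolding tcomp_assoc by (rule tcomp_cong_right[OF tfun_eq_sym[OF sl[OF *(1)]]])
    finally show "tfun_eq (slice C \<Gamma>) (tcomp (slice_fun C (tcomp K H) (src C \<Gamma> A)) (Wk C \<Gamma> A))
      (tcomp (Wk B (fob (tcomp K H) \<Gamma>) (far (tcomp K H) \<Gamma> A)) (slice_fun C (tcomp K H) \<Gamma>))" .
    have "fob (Wk C \<Gamma> A) A \<in> Over C (src C \<Gamma> A)"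
      using strict_functor.fob_Ob[OF tfunctor.axioms(1)[OF C.Wk_functor[OF *]]] * by simp
    have W: "far H (src C \<Gamma> A) (fob (Wk C \<Gamma> A) A)
      = fob (Wk D (fob H \<Gamma>) (far H \<Gamma> A)) (far H \<Gamma> A)"
      using tfun_eq_fob[OF H.hom_Wk[OF *]] * by simp
    show "ftm (tcomp K H) (src C \<Gamma> A) (fob (Wk C \<Gamma> A) A) (idtm C \<Gamma> A)
      = idtm B (fob (tcomp K H) \<Gamma>) (far (tcomp K H) \<Gamma> A)"
      using K.hom_idtm[OF D] H.hom_idtm[OF *] * by (simp add: W H.src_far)
  qed
qed


text \<open>Together with \<open>pre_E_hom_slice_fun\<close> this makes the slice of a homomorphism
  E/\<Gamma> \<rightarrow> E/\<Delta> again a homomorphism between plain slices of E.\<close>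

lemma pre_E_hom_slice_slice:
  assumes "strict_category E" and "\<Gamma> \<in> Ob E" and "A \<in> Over E \<Gamma>"
    and "strict_category D" and "\<Delta> \<in> Ob D" and "B \<in> Over D \<Delta>"
    and "pre_E_hom (slice (slice E \<Gamma>) A) (slice (slice D \<Delta>) B) F"
  shows "pre_E_hom (slice E (src E \<Gamma> A)) (slice D (src D \<Delta> B)) F"
proof -
  interpret E: strict_category E by fact
  interpret D: strict_category D by fact
  interpret F: pre_E_hom "slice (slice E \<Gamma>) A" "slice (slice D \<Delta>) B" F by fact
  \<comment> \<open>\<open>slice_fun\<close> reads only the field \<open>src\<close>, and in both
    slices this is composition in \<open>E\<close> over \<open>src E \<Gamma> A\<close>; hence the
    equality holds even off the carrier.\<close>
  have eq1: "slice_fun (slice (slice E \<Gamma>) A) = slice_fun (slice E (src E \<Gamma> A))"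
    by (intro ext) (simp add: slice_fun_def)
  have eq2: "tfun_eq (slice (slice (slice E \<Gamma>) A) P) G H
    \<longleftrightarrow> tfun_eq (slice (slice E (src E \<Gamma> A)) P) G H" if "P \<in> Over E (src E \<Gamma> A)" for P G H
    using assms(2,3) that
    by (simp add: tfun_eq_slice_slice E.strict_category_axioms strict_category_slice E.src_Ob E.cmp_Over
      E.src_cmp)
  have tf: "tfunctor (slice E (src E \<Gamma> A)) (slice D (src D \<Delta> B)) F"
    using tfunctor_slice_slice[OF assms(1-6)] F.tfunctor_axioms by blast
  show ?thesis
  proof (rule pre_E_hom.intro[OF tf], unfold_locales)
    show "fob F (root (slice E (src E \<Gamma> A))) = root (slice D (src D \<Delta> B))"
      using F.hom_root by simp
  next
    fix P Q x
    assume "P \<in> Ob (slice E (src E \<Gamma> A))" "Q \<in> Over (slice E (src E \<Gamma> A)) P"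
      "x \<in> Tm (slice E (src E \<Gamma> A)) P Q"
    with F.hom_Sub[of P Q x] F.fob_Ob[of P] assms(2,3,5,6)
    show "tfun_eq (slice (slice E (src E \<Gamma> A)) (src (slice E (src E \<Gamma> A)) P Q))
        (tcomp (slice_fun (slice E (src E \<Gamma> A)) F P) (Sub (slice E (src E \<Gamma> A)) P Q x))
        (tcomp (Sub (slice D (src D \<Delta> B)) (fob F P) (far F P Q) (ftm F P Q x))
          (slice_fun (slice E (src E \<Gamma> A)) F (src (slice E (src E \<Gamma> A)) P Q)))"
      by (simp add: eq1 eq2 E.src_cmp D.src_cmp E.cmp_Over E.src_Ob)
  next
    fix P Q
    assume "P \<in> Ob (slice E (src E \<Gamma> A))" "Q \<in> Over (slice E (src E \<Gamma> A)) P"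
    with F.hom_Wk[of P Q] F.hom_idtm[of P Q] F.fob_Ob[of P] assms(2,3,5,6)
    show "tfun_eq (slice (slice E (src E \<Gamma> A)) P)
        (tcomp (slice_fun (slice E (src E \<Gamma> A)) F (src (slice E (src E \<Gamma> A)) P Q))
          (Wk (slice E (src E \<Gamma> A)) P Q))
        (tcomp (Wk (slice D (src D \<Delta> B)) (fob F P) (far F P Q)) (slice_fun (slice E (src E \<Gamma> A)) F P))"
      and "ftm F (src (slice E (src E \<Gamma> A)) P Q) (fob (Wk (slice E (src E \<Gamma> A)) P Q) Q)
        (idtm (slice E (src E \<Gamma> A)) P Q) = idtm (slice D (src D \<Delta> B)) (fob F P) (far F P Q)"
      by (simp_all add: eq1 eq2 E.src_cmp D.src_cmp E.cmp_Over E.src_Ob)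
  qed
qed

lemma pre_E_system_slice:
  assumes "pre_E_system E" and \<Gamma>: "\<Gamma> \<in> Ob E"
  shows "pre_E_system (slice E \<Gamma>)"
proof -
  interpret pre_E_system E by fact
  note cat = strict_category_axioms
  show ?thesis
  proof (intro pre_E_system.intro pre_E_system_axioms.intro)
    show "strict_category (slice E \<Gamma>)"
      by (rule strict_category_slice[OF cat \<Gamma>])
    \<comment> \<open>An arrow from A to the identity in the slice is some P with id.P = A, so A
      itself is the only one.\<close>
    show "terminal (slice E \<Gamma>) (root (slice E \<Gamma>))"
      using \<Gamma> by (auto simp: terminal_def hom_def idn_Over src_idn cmp_idn_left)
  next
    fix A P x
    assume "A \<in> Ob (slice E \<Gamma>)" "P \<in> Over (slice E \<Gamma>) A" "x \<in> Tm (slice E \<Gamma>) A P"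
    with \<Gamma> have *: "src E \<Gamma> A \<in> Ob E" "P \<in> Over E (src E \<Gamma> A)" "x \<in> Tm E (src E \<Gamma> A) P"
      "A \<in> Over E \<Gamma>" "cmp E \<Gamma> A P \<in> Over E \<Gamma>" "src E \<Gamma> (cmp E \<Gamma> A P) = src E (src E \<Gamma> A) P"
      by (simp_all add: src_Ob cmp_Over src_cmp)
    show "tfunctor (slice (slice E \<Gamma>) (src (slice E \<Gamma>) A P)) (slice (slice E \<Gamma>) A)
        (Sub (slice E \<Gamma>) A P x)"
      using tfunctor_slice_slice[OF cat \<Gamma> *(5) cat \<Gamma> *(4)] Sub_functor[OF *(1-3)] *
      by simp
    show "fob (Sub (slice E \<Gamma>) A P x) (idn (slice E \<Gamma>) (src (slice E \<Gamma>) A P)) = idn (slice E \<Gamma>) A"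
      using Sub_idn[OF *(1-3)] * by simp
  next
    fix A P
    assume "A \<in> Ob (slice E \<Gamma>)" "P \<in> Over (slice E \<Gamma>) A"
    with \<Gamma> have *: "src E \<Gamma> A \<in> Ob E" "P \<in> Over E (src E \<Gamma> A)"
      "A \<in> Over E \<Gamma>" "cmp E \<Gamma> A P \<in> Over E \<Gamma>" "src E \<Gamma> (cmp E \<Gamma> A P) = src E (src E \<Gamma> A) P"
      by (simp_all add: src_Ob cmp_Over src_cmp)
    show "tfunctor (slice (slice E \<Gamma>) A) (slice (slice E \<Gamma>) (src (slice E \<Gamma>) A P)) (Wk (slice E \<Gamma>) A P)"
      using tfunctor_slice_slice[OF cat \<Gamma> *(3) cat \<Gamma> *(4)] Wk_functor[OF *(1,2)] *
      by simp
    show "fob (Wk (slice E \<Gamma>) A P) (idn (slice E \<Gamma>) A) = idn (slice E \<Gamma>) (src (slice E \<Gamma>) A P)"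
      using Wk_idn[OF *(1,2)] * by simp
    show "idtm (slice E \<Gamma>) A P \<in> Tm (slice E \<Gamma>) (src (slice E \<Gamma>) A P) (fob (Wk (slice E \<Gamma>) A P) P)"
      using idtm_Tm[OF *(1,2)] * by simp
  next
    fix A
    assume "A \<in> Ob (slice E \<Gamma>)"
    with \<Gamma> show "tfun_eq (slice (slice E \<Gamma>) A) (Wk (slice E \<Gamma>) A (idn (slice E \<Gamma>) A)) tid"
      by (simp add: tfun_eq_slice_slice[OF cat \<Gamma>] Wk_by_idn src_Ob)
  next
    fix A P Q
    assume "A \<in> Ob (slice E \<Gamma>)" "P \<in> Over (slice E \<Gamma>) A"
      "Q \<in> Over (slice E \<Gamma>) (src (slice E \<Gamma>) A P)"
    with \<Gamma> show "tfun_eq (slice (slice E \<Gamma>) A) (Wk (slice E \<Gamma>) A (cmp (slice E \<Gamma>) A P Q))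
        (tcomp (Wk (slice E \<Gamma>) (src (slice E \<Gamma>) A P) Q) (Wk (slice E \<Gamma>) A P))"
      by (simp add: tfun_eq_slice_slice[OF cat \<Gamma>] Wk_by_cmp src_Ob src_cmp)
  qed
qed

lemma pre_E_hom_slice_fun:
  assumes "pre_E_system E" and "strict_category D" and "pre_E_hom E D H" and "\<Gamma> \<in> Ob E"
  shows "pre_E_hom (slice E \<Gamma>) (slice D (fob H \<Gamma>)) (slice_fun E H \<Gamma>)"
proof -
  interpret E: pre_E_system E by fact
  interpret D: strict_category D by fact
  interpret H: pre_E_hom E D H by fact
  have sl: "tfun_eq (slice E (src E \<Gamma> A)) (slice_fun (slice E \<Gamma>) (slice_fun E H \<Gamma>) A)
    (slice_fun E H (src E \<Gamma> A))" if "A \<in> Over E \<Gamma>" for A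
    using that assms(4) by (auto intro!: tfun_eqI simp: E.src_cmp)
  have tf: "tfunctor (slice E \<Gamma>) (slice D (fob H \<Gamma>)) (slice_fun E H \<Gamma>)"
    by (rule tfunctor_slice_fun[OF E.strict_category_axioms H.tfunctor_axioms assms(4)])
  show ?thesis
  proof (rule pre_E_hom.intro[OF tf], unfold_locales)
    show "fob (slice_fun E H \<Gamma>) (root (slice E \<Gamma>)) = root (slice D (fob H \<Gamma>))"
      using assms(4) by (simp add: H.far_idn)
  next
    fix A P x
    assume A: "A \<in> Ob (slice E \<Gamma>)" "P \<in> Over (slice E \<Gamma>) A" "x \<in> Tm (slice E \<Gamma>) A P"
    let ?A = "src E \<Gamma> A"
    have *: "?A \<in> Ob E" "P \<in> Over E ?A" "x \<in> Tm E ?A P" "A \<in> Over E \<Gamma>"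
      using A assms(4) by (simp_all add: E.src_Ob)
    let ?AP = "src E ?A P"
    have P: "cmp E \<Gamma> A P \<in> Over E \<Gamma>" "src E \<Gamma> (cmp E \<Gamma> A P) = ?AP"
      using * assms(4) by (simp_all add: E.cmp_Over E.src_cmp)
    have "tfun_eq (slice E ?AP)
      (tcomp (slice_fun (slice E \<Gamma>) (slice_fun E H \<Gamma>) A) (Sub E ?A P x))
      (tcomp (slice_fun E H ?A) (Sub E ?A P x))"
      by (rule tcomp_cong_left[OF E.Sub_functor[OF *(1-3)] sl[OF *(4)]])
    also note H.hom_Sub[OF *(1-3)]
    also have "tfun_eq (slice E ?AP)
      (tcomp (Sub D (fob H ?A) (far H ?A P) (ftm H ?A P x)) (slice_fun E H ?AP))
      (tcomp (Sub D (fob H ?A) (far H ?A P) (ftm H ?A P x))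
        (slice_fun (slice E \<Gamma>) (slice_fun E H \<Gamma>) (cmp E \<Gamma> A P)))"
      by (rule tcomp_cong_right) (use sl[OF P(1)] P(2) in \<open>simp add: tfun_eq_sym\<close>)
    finally show "tfun_eq (slice (slice E \<Gamma>) (src (slice E \<Gamma>) A P))
        (tcomp (slice_fun (slice E \<Gamma>) (slice_fun E H \<Gamma>) A) (Sub (slice E \<Gamma>) A P x))
        (tcomp (Sub (slice D (fob H \<Gamma>)) (fob (slice_fun E H \<Gamma>) A) (far (slice_fun E H \<Gamma>) A P)
          (ftm (slice_fun E H \<Gamma>) A P x))
          (slice_fun (slice E \<Gamma>) (slice_fun E H \<Gamma>) (src (slice E \<Gamma>) A P)))"
      using assms(4) *
      by (simp add: tfun_eq_slice_slice[OF E.strict_category_axioms] P H.src_far)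
  next
    fix A P
    assume A: "A \<in> Ob (slice E \<Gamma>)" "P \<in> Over (slice E \<Gamma>) A"
    let ?A = "src E \<Gamma> A"
    have *: "?A \<in> Ob E" "P \<in> Over E ?A" "A \<in> Over E \<Gamma>"
      using A assms(4) by (simp_all add: E.src_Ob)
    let ?AP = "src E ?A P"
    have P: "cmp E \<Gamma> A P \<in> Over E \<Gamma>" "src E \<Gamma> (cmp E \<Gamma> A P) = ?AP"
      using * assms(4) by (simp_all add: E.cmp_Over E.src_cmp)
    have "tfun_eq (slice E ?A)
      (tcomp (slice_fun (slice E \<Gamma>) (slice_fun E H \<Gamma>) (cmp E \<Gamma> A P)) (Wk E ?A P))
      (tcomp (slice_fun E H ?AP) (Wk E ?A P))"
      by (rule tcomp_cong_left[OF E.Wk_functor[OF *(1-2)]]) (use sl[OF P(1)] P(2) in simp)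
    also note H.hom_Wk[OF *(1-2)]
    also have "tfun_eq (slice E ?A)
      (tcomp (Wk D (fob H ?A) (far H ?A P)) (slice_fun E H ?A))
      (tcomp (Wk D (fob H ?A) (far H ?A P)) (slice_fun (slice E \<Gamma>) (slice_fun E H \<Gamma>) A))"
      by (rule tcomp_cong_right) (use sl[OF *(3)] in \<open>simp add: tfun_eq_sym\<close>)
    finally show "tfun_eq (slice (slice E \<Gamma>) A)
        (tcomp (slice_fun (slice E \<Gamma>) (slice_fun E H \<Gamma>) (src (slice E \<Gamma>) A P)) (Wk (slice E \<Gamma>) A P))
        (tcomp (Wk (slice D (fob H \<Gamma>)) (fob (slice_fun E H \<Gamma>) A) (far (slice_fun E H \<Gamma>) A P))
          (slice_fun (slice E \<Gamma>) (slice_fun E H \<Gamma>) A))"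
      using assms(4) *
      by (simp add: tfun_eq_slice_slice[OF E.strict_category_axioms] H.src_far)
    show "ftm (slice_fun E H \<Gamma>) (src (slice E \<Gamma>) A P) (fob (Wk (slice E \<Gamma>) A P) P) (idtm (slice E \<Gamma>) A P)
        = idtm (slice D (fob H \<Gamma>)) (fob (slice_fun E H \<Gamma>) A) (far (slice_fun E H \<Gamma>) A P)"
      using H.hom_idtm[OF *(1,2)] * assms(4) by (simp add: P H.src_far)
  qed
qed

section \<open>Homomorphisms between slices of an E-system\<close>

context E_system
begin

abbreviation feq :: "'o \<Rightarrow> ('a, 'a, 't, 'b, 'c, 'd) tfnct \<Rightarrow> ('a, 'a, 't, 'b, 'c, 'd) tfnct \<Rightarrow> bool" where
  "feq \<Gamma> F G \<equiv> tfun_eq (slice E \<Gamma>) F G"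

abbreviation ehom :: "'o \<Rightarrow> 'o \<Rightarrow> ('a, 'a, 't, 'a, 'a, 't) tfnct \<Rightarrow> bool" where
  "ehom \<Gamma> \<Delta> F \<equiv> pre_E_hom (slice E \<Gamma>) (slice E \<Delta>) F"

abbreviation sl :: "'o \<Rightarrow> ('a, 'a, 't, 'b, 'c, 'd) tfnct \<Rightarrow> 'a \<Rightarrow> ('a, 'a, 't, 'c, 'c, 'd) tfnct" where
  "sl \<Gamma> F A \<equiv> slice_fun (slice E \<Gamma>) F A"

lemmas cat = strict_category_axioms
lemmas cat_simps = src_Ob idn_Over src_idn cmp_Over src_cmp cmp_idn_left cmp_idn_right cmp_assoc

lemma ehom_tfunctor: "ehom \<Gamma> \<Delta> F \<Longrightarrow> tfunctor (slice E \<Gamma>) (slice E \<Delta>) F"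
  by (rule pre_E_hom.axioms(1))

lemma
  assumes F: "tfunctor (slice E \<Gamma>) (slice E \<Delta>) F" and A: "A \<in> Over E \<Gamma>"
  shows tfunctor_fob_Over: "fob F A \<in> Over E \<Delta>"
    and tfunctor_far_Over: "P \<in> Over E (src E \<Gamma> A) \<Longrightarrow> far F A P \<in> Over E (src E \<Delta> (fob F A))"
    and tfunctor_cmp: "P \<in> Over E (src E \<Gamma> A) \<Longrightarrow> cmp E \<Delta> (fob F A) (far F A P) = fob F (cmp E \<Gamma> A P)"
    and tfunctor_ftm_Tm: "\<lbrakk>P \<in> Over E (src E \<Gamma> A); x \<in> Tm E (src E \<Gamma> A) P\<rbrakk>
      \<Longrightarrow> ftm F A P x \<in> Tm E (src E \<Delta> (fob F A)) (far F A P)"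
proof -
  interpret F: tfunctor "slice E \<Gamma>" "slice E \<Delta>" F by fact
  show "fob F A \<in> Over E \<Delta>"
    using F.fob_Ob[of A] A by simp
  show "P \<in> Over E (src E \<Gamma> A) \<Longrightarrow> far F A P \<in> Over E (src E \<Delta> (fob F A))"
    using F.far_Over[of A P] A by simp
  show "P \<in> Over E (src E \<Gamma> A) \<Longrightarrow> cmp E \<Delta> (fob F A) (far F A P) = fob F (cmp E \<Gamma> A P)"
    using F.src_far[of A P] A by simp
  show "\<lbrakk>P \<in> Over E (src E \<Gamma> A); x \<in> Tm E (src E \<Gamma> A) P\<rbrakk>
      \<Longrightarrow> ftm F A P x \<in> Tm E (src E \<Delta> (fob F A)) (far F A P)"
    using F.ftm_Tm[of A P] A by simp
qed

lemma ehom_idn: "ehom \<Gamma> \<Delta> F \<Longrightarrow> fob F (idn E \<Gamma>) = idn E \<Delta>"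
  using pre_E_hom.hom_root by fastforce

text \<open>An element P of F/\<Gamma> is an object of the slice and also the arrow from P to the
  terminal object. Since F preserves that terminal object, applying F to the equation id.P = P shows
  that its two actions on P agree.\<close>

lemma ehom_far_idn:
  assumes F: "ehom \<Gamma> \<Delta> F" and "\<Gamma> \<in> Ob E" "\<Delta> \<in> Ob E" "P \<in> Over E \<Gamma>"
  shows "far F (idn E \<Gamma>) P = fob F P"
proof -
  note tf = tfunctor_far_Over[OF ehom_tfunctor[OF F], of "idn E \<Gamma>" P]
    tfunctor_cmp[OF ehom_tfunctor[OF F], of "idn E \<Gamma>" P]
  show ?thesis
    using tf assms(2-) by (simp add: cat_simps ehom_idn[OF F])
qed

lemma ehom_ftm_Tm:
  assumes F: "ehom \<Gamma> \<Delta> F" and "\<Gamma> \<in> Ob E" "\<Delta> \<in> Ob E" "P \<in> Over E \<Gamma>" "x \<in> Tm E \<Gamma> P"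
  shows "ftm F (idn E \<Gamma>) P x \<in> Tm E \<Delta> (fob F P)"
  using tfunctor_ftm_Tm[OF ehom_tfunctor[OF F], of "idn E \<Gamma>" P x] assms(2-)
  by (simp add: cat_simps ehom_idn[OF F] ehom_far_idn[OF F])

lemma ehom_tcomp:
  assumes "\<Gamma> \<in> Ob E" "ehom \<Gamma> \<Delta> F" "ehom \<Delta> \<Theta> G"
  shows "ehom \<Gamma> \<Theta> (tcomp G F)"
  by (rule pre_E_hom_tcomp[OF pre_E_system_slice[OF pre_E_system_axioms assms(1)] assms(2,3)])

lemma ehom_sl:
  assumes "\<Gamma> \<in> Ob E" "\<Delta> \<in> Ob E" "ehom \<Gamma> \<Delta> F" "A \<in> Over E \<Gamma>"
  shows "ehom (src E \<Gamma> A) (src E \<Delta> (fob F A)) (sl \<Gamma> F A)"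
proof (rule pre_E_hom_slice_slice[OF cat assms(1,4) cat assms(2)])
  show "fob F A \<in> Over E \<Delta>"
    using tfunctor_fob_Over[OF ehom_tfunctor] assms by blast
  show "pre_E_hom (slice (slice E \<Gamma>) A) (slice (slice E \<Delta>) (fob F A)) (sl \<Gamma> F A)"
    using assms
    by (intro pre_E_hom_slice_fun pre_E_system_slice pre_E_system_axioms strict_category_slice cat) auto
qed

lemma sl_cong:
  assumes "\<Gamma> \<in> Ob E" "A \<in> Over E \<Gamma>" "feq \<Gamma> F G"
  shows "feq (src E \<Gamma> A) (sl \<Gamma> F A) (sl \<Gamma> G A)"
  using slice_fun_cong[OF strict_category_slice[OF cat assms(1)] assms(3)] assms(1,2)
  by (simp add: tfun_eq_slice_slice[OF cat])

lemma sl_tcomp: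
  assumes "\<Gamma> \<in> Ob E" "A \<in> Over E \<Gamma>" "tfunctor (slice E \<Gamma>) (slice E \<Delta>) F"
  shows "feq (src E \<Gamma> A) (sl \<Gamma> (tcomp G F) A) (tcomp (sl \<Delta> G (fob F A)) (sl \<Gamma> F A))"
  using slice_fun_tcomp[OF assms(3)] assms(1,2) by (simp add: tfun_eq_slice_slice[OF cat])

lemma sl_idn:
  assumes "\<Gamma> \<in> Ob E" "\<Delta> \<in> Ob E" "ehom \<Gamma> \<Delta> F"
  shows "feq \<Gamma> (sl \<Gamma> F (idn E \<Gamma>)) F"
  using assms by (auto intro!: tfun_eqI simp: ehom_far_idn cat_simps)

lemma sl_sl:
  assumes "\<Gamma> \<in> Ob E" "A \<in> Over E \<Gamma>" "P \<in> Over E (src E \<Gamma> A)"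
  shows "feq (src E (src E \<Gamma> A) P) (sl (src E \<Gamma> A) (sl \<Gamma> F A) P) (sl \<Gamma> F (cmp E \<Gamma> A P))"
  using assms by (auto intro!: tfun_eqI simp: cat_simps)

text \<open>The homomorphism axioms for slices speak of an arrow P over an object A. Taking A to be
  the identity, where \<open>sl_idn\<close> says that slicing changes nothing, gives the form for P
  in F/\<Gamma> itself; the lemmas for \<open>Wk\<close> and \<open>idtm\<close> follow the same
  pattern.\<close>

lemma ehom_Sub:
  assumes F: "ehom \<Gamma> \<Delta> F" and \<Gamma>: "\<Gamma> \<in> Ob E" and \<Delta>: "\<Delta> \<in> Ob E" and P: "P \<in> Over E \<Gamma>"
    and x: "x \<in> Tm E \<Gamma> P"
  shows "feq (src E \<Gamma> P) (tcomp F (Sub E \<Gamma> P x))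
    (tcomp (Sub E \<Delta> (fob F P) (ftm F (idn E \<Gamma>) P x)) (sl \<Gamma> F P))"
proof -
  interpret F: pre_E_hom "slice E \<Gamma>" "slice E \<Delta>" F by fact
  have "feq (src E \<Gamma> P) (tcomp F (Sub E \<Gamma> P x)) (tcomp (sl \<Gamma> F (idn E \<Gamma>)) (Sub E \<Gamma> P x))"
    by (rule tcomp_cong_left[OF Sub_functor[OF \<Gamma> P x] tfun_eq_sym[OF sl_idn[OF \<Gamma> \<Delta> F]]])
  also have "feq (src E \<Gamma> P) \<dots>
    (tcomp (Sub E \<Delta> (fob F P) (ftm F (idn E \<Gamma>) P x)) (sl \<Gamma> F P))"
    using F.hom_Sub[of "idn E \<Gamma>" P x] \<Gamma> \<Delta> P x
    by (simp add: cat_simps tfun_eq_slice_slice[OF cat] ehom_far_idn[OF F] ehom_idn[OF F])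
  finally show ?thesis .
qed

lemma ehom_Wk:
  assumes F: "ehom \<Gamma> \<Delta> F" and \<Gamma>: "\<Gamma> \<in> Ob E" and \<Delta>: "\<Delta> \<in> Ob E" and P: "P \<in> Over E \<Gamma>"
  shows "feq \<Gamma> (tcomp (sl \<Gamma> F P) (Wk E \<Gamma> P)) (tcomp (Wk E \<Delta> (fob F P)) F)"
proof -
  interpret F: pre_E_hom "slice E \<Gamma>" "slice E \<Delta>" F by fact
  have "feq \<Gamma> (tcomp (sl \<Gamma> F P) (Wk E \<Gamma> P)) (tcomp (Wk E \<Delta> (fob F P)) (sl \<Gamma> F (idn E \<Gamma>)))"
    using F.hom_Wk[of "idn E \<Gamma>" P] \<Gamma> \<Delta> P
    by (simp add: cat_simps tfun_eq_slice_slice[OF cat] ehom_far_idn[OF F] ehom_idn[OF F])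
  also have "feq \<Gamma> \<dots> (tcomp (Wk E \<Delta> (fob F P)) F)"
    by (rule tcomp_cong_right[OF sl_idn[OF \<Gamma> \<Delta> F]])
  finally show ?thesis .
qed

lemma ehom_idtm:
  assumes F: "ehom \<Gamma> \<Delta> F" and \<Gamma>: "\<Gamma> \<in> Ob E" and \<Delta>: "\<Delta> \<in> Ob E" and P: "P \<in> Over E \<Gamma>"
  shows "ftm F P (fob (Wk E \<Gamma> P) P) (idtm E \<Gamma> P) = idtm E \<Delta> (fob F P)"
proof -
  interpret F: pre_E_hom "slice E \<Gamma>" "slice E \<Delta>" F by fact
  show ?thesis
    using F.hom_idtm[of "idn E \<Gamma>" P] \<Gamma> \<Delta> P
    by (simp add: cat_simps tfun_eq_slice_slice[OF cat] ehom_far_idn[OF F] ehom_idn[OF F])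
qed

lemma Wk_fob_Over: "\<lbrakk>\<Gamma> \<in> Ob E; A \<in> Over E \<Gamma>; B \<in> Over E \<Gamma>\<rbrakk> \<Longrightarrow> fob (Wk E \<Gamma> A) B \<in> Over E (src E \<Gamma> A)"
  using tfunctor_fob_Over[OF Wk_functor] by blast

text \<open>The uniqueness half. By \<open>Sub_by_idtm\<close>, U equals U S_i (W_R/R) with i the
  generic term of R. Moving U past S_i gives S_{U(i)} (U/W_R(R)) (W_R/R), and the last two factors
  are the slice of U W_R = K over R.\<close>

lemma ehom_generic:
  assumes U: "ehom (src E \<Gamma> R) \<Delta> U" and \<Gamma>: "\<Gamma> \<in> Ob E" and \<Delta>: "\<Delta> \<in> Ob E" and R: "R \<in> Over E \<Gamma>"
    and K: "feq \<Gamma> (tcomp U (Wk E \<Gamma> R)) K"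
  shows "feq (src E \<Gamma> R) U (tcomp (Sub E \<Delta> (fob K R)
      (ftm U (idn E (src E \<Gamma> R)) (fob (Wk E \<Gamma> R) R) (idtm E \<Gamma> R))) (sl \<Gamma> K R))"
proof -
  let ?R = "src E \<Gamma> R" and ?W = "fob (Wk E \<Gamma> R) R" and ?i = "idtm E \<Gamma> R"
  have WR: "?W \<in> Over E ?R" "?R \<in> Ob E"
    using \<Gamma> R by (auto simp: Wk_fob_Over src_Ob)
  have i: "?i \<in> Tm E ?R ?W" by (rule idtm_Tm[OF \<Gamma> R])
  have W: "ehom \<Gamma> ?R (Wk E \<Gamma> R)" by (rule Wk_hom[OF \<Gamma> R])
  have KR: "fob K R = fob U ?W"
    using tfun_eq_fob[OF K, of R] R by simp
  note slW = ehom_tfunctor[OF ehom_sl[OF \<Gamma> WR(2) W R]]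
  have "feq ?R U (tcomp U (tcomp (Sub E ?R ?W ?i) (sl \<Gamma> (Wk E \<Gamma> R) R)))"
    using tcomp_cong_right[OF tfun_eq_sym[OF Sub_by_idtm[OF \<Gamma> R]], of U] by simp
  also have "feq ?R \<dots> (tcomp (Sub E \<Delta> (fob U ?W) (ftm U (idn E ?R) ?W ?i))
      (tcomp (sl ?R U ?W) (sl \<Gamma> (Wk E \<Gamma> R) R)))"
    unfolding tcomp_assoc[symmetric]
    by (rule tcomp_cong_left[OF slW ehom_Sub[OF U WR(2) \<Delta> WR(1) i]])
  also have "feq ?R \<dots> (tcomp (Sub E \<Delta> (fob U ?W) (ftm U (idn E ?R) ?W ?i)) (sl \<Gamma> K R))"
    using \<Gamma> R
    by (intro tcomp_cong_right tfun_eq_trans[OF tfun_eq_sym[OF sl_tcomp[OF \<Gamma> R ehom_tfunctor[OF W]]]]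
        sl_cong K)
  finally show ?thesis
    by (simp add: KR)
qed

text \<open>The existence half. W_R becomes W_{K(R)} when moved past K/R and is then cancelled by
  S_v through \<open>Sub_Wk\<close>. The generic term of R goes to that of K(R), which S_v sends to
  v by \<open>Sub_idtm\<close>.\<close>

lemma
  assumes K: "ehom \<Gamma> \<Delta> K" and \<Gamma>: "\<Gamma> \<in> Ob E" and \<Delta>: "\<Delta> \<in> Ob E" and R: "R \<in> Over E \<Gamma>"
    and v: "v \<in> Tm E \<Delta> (fob K R)"
  defines "U \<equiv> tcomp (Sub E \<Delta> (fob K R) v) (sl \<Gamma> K R)"
  shows ehom_ext: "ehom (src E \<Gamma> R) \<Delta> U"
    and ext_Wk: "feq \<Gamma> (tcomp U (Wk E \<Gamma> R)) K"
    and ext_idtm: "ftm U (idn E (src E \<Gamma> R)) (fob (Wk E \<Gamma> R) R) (idtm E \<Gamma> R) = v"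
proof -
  let ?R = "src E \<Gamma> R" and ?KR = "fob K R"
  have KR: "?KR \<in> Over E \<Delta>"
    using tfunctor_fob_Over[OF ehom_tfunctor[OF K] R] .
  have ob: "?R \<in> Ob E" "src E \<Delta> ?KR \<in> Ob E"
    using \<Gamma> \<Delta> R KR by (auto simp: src_Ob)
  have slK: "ehom ?R (src E \<Delta> ?KR) (sl \<Gamma> K R)"
    by (rule ehom_sl[OF \<Gamma> \<Delta> K R])
  show "ehom ?R \<Delta> U"
    unfolding U_def by (rule ehom_tcomp[OF ob(1) slK Sub_hom[OF \<Delta> KR v]])
  have "feq \<Gamma> (tcomp U (Wk E \<Gamma> R)) (tcomp (Sub E \<Delta> ?KR v) (tcomp (Wk E \<Delta> ?KR) K))"
    unfolding U_def tcomp_assoc by (rule tcomp_cong_right[OF ehom_Wk[OF K \<Gamma> \<Delta> R]])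
  also have "feq \<Gamma> \<dots> (tcomp tid K)"
    unfolding tcomp_assoc[symmetric]
    by (rule tcomp_cong_left[OF ehom_tfunctor[OF K] Sub_Wk[OF \<Delta> KR v]])
  finally show "feq \<Gamma> (tcomp U (Wk E \<Gamma> R)) K"
    by simp
  have "far (sl \<Gamma> K R) (idn E ?R) (fob (Wk E \<Gamma> R) R) = fob (Wk E \<Delta> ?KR) ?KR"
    using ehom_far_idn[OF slK ob Wk_fob_Over[OF \<Gamma> R R]] tfun_eq_fob[OF ehom_Wk[OF K \<Gamma> \<Delta> R], of R] R
    by simp
  then show "ftm U (idn E ?R) (fob (Wk E \<Gamma> R) R) (idtm E \<Gamma> R) = v"
    using ehom_idn[OF slK] ehom_idtm[OF K \<Gamma> \<Delta> R] Sub_idtm[OF \<Delta> KR v] R \<Gamma>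
    by (simp add: U_def cat_simps)
qed

text \<open>The main tool for equating functors: by \<open>ehom_generic\<close> both have the form
  S_v (K/R) with the same K and v.\<close>

lemma ehom_eqI:
  assumes U: "ehom (src E \<Gamma> R) \<Delta> U" "ehom (src E \<Gamma> R) \<Delta> V"
    and \<Gamma>: "\<Gamma> \<in> Ob E" and \<Delta>: "\<Delta> \<in> Ob E" and R: "R \<in> Over E \<Gamma>"
    and Wk: "feq \<Gamma> (tcomp U (Wk E \<Gamma> R)) (tcomp V (Wk E \<Gamma> R))"
    and idtm: "ftm U (idn E (src E \<Gamma> R)) (fob (Wk E \<Gamma> R) R) (idtm E \<Gamma> R)
      = ftm V (idn E (src E \<Gamma> R)) (fob (Wk E \<Gamma> R) R) (idtm E \<Gamma> R)"
  shows "feq (src E \<Gamma> R) U V"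
  using ehom_generic[OF U(1) \<Gamma> \<Delta> R Wk] ehom_generic[OF U(2) \<Gamma> \<Delta> R tfun_eq_refl]
  by (simp add: idtm tfun_eq_def)

end

section \<open>Context morphisms of an E-system\<close>

text \<open>
  \<open>ctx \<Gamma> A B F\<close> says that \<open>F : E/B \<rightarrow> E/A\<close> lies over \<open>E/\<Gamma>\<close>, that is \<open>F \<circ> W\<^sub>B = W\<^sub>A\<close>. These \<open>F\<close> are
  in bijection with \<open>thom(A, B)\<close> by \<open>F \<mapsto> F(idtm\<^sub>B)\<close>, written \<open>code \<Gamma> B F\<close>, with inverse \<open>f \<mapsto> f\<^sup>*\<close>.
\<close>

context E_system
begin

definition ctx :: "'o \<Rightarrow> 'a \<Rightarrow> 'a \<Rightarrow> ('a, 'a, 't, 'a, 'a, 't) tfnct \<Rightarrow> bool" where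
  "ctx \<Gamma> A B F \<longleftrightarrow> ehom (src E \<Gamma> B) (src E \<Gamma> A) F \<and> feq \<Gamma> (tcomp F (Wk E \<Gamma> B)) (Wk E \<Gamma> A)"

definition code :: "'o \<Rightarrow> 'a \<Rightarrow> ('a, 'a, 't, 'b, 'c, 'd) tfnct \<Rightarrow> 'd" where
  "code \<Gamma> B F = ftm F (idn E (src E \<Gamma> B)) (fob (Wk E \<Gamma> B) B) (idtm E \<Gamma> B)"

lemma ctx_ehom: "ctx \<Gamma> A B F \<Longrightarrow> ehom (src E \<Gamma> B) (src E \<Gamma> A) F"
  and ctx_Wk_eq: "ctx \<Gamma> A B F \<Longrightarrow> feq \<Gamma> (tcomp F (Wk E \<Gamma> B)) (Wk E \<Gamma> A)"
  by (simp_all add: ctx_def)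

lemma code_cong:
  assumes "\<Gamma> \<in> Ob E" "B \<in> Over E \<Gamma>" "feq (src E \<Gamma> B) F G"
  shows "code \<Gamma> B F = code \<Gamma> B G"
  using tfun_eq_ftm[OF assms(3), of "idn E (src E \<Gamma> B)" "fob (Wk E \<Gamma> B) B" "idtm E \<Gamma> B"]
    assms(1,2) idtm_Tm[of \<Gamma> B] Wk_fob_Over[of \<Gamma> B B]
  by (simp add: code_def cat_simps)

text \<open>The functor f^* is the extension of W_A along the term f of W_A(B), so both facts are
  the existence half of the correspondence for K = W_A and R = B.\<close>

lemma
  assumes "\<Gamma> \<in> Ob E" "A \<in> Over E \<Gamma>" "B \<in> Over E \<Gamma>" "f \<in> thom E \<Gamma> A B"
  shows ctx_tstar: "ctx \<Gamma> A B (tstar E \<Gamma> A B f)"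
    and code_tstar: "code \<Gamma> B (tstar E \<Gamma> A B f) = f"
  using ehom_ext[OF Wk_hom[OF assms(1,2)] assms(1) _ assms(3), of f]
    ext_Wk[OF Wk_hom[OF assms(1,2)] assms(1) _ assms(3), of f]
    ext_idtm[OF Wk_hom[OF assms(1,2)] assms(1) _ assms(3), of f] assms
  by (simp_all add: ctx_def code_def tstar_def thom_def src_Ob)

text \<open>The uniqueness half of the correspondence for K = W_A and R = B.\<close>

lemma
  assumes "\<Gamma> \<in> Ob E" "A \<in> Over E \<Gamma>" "B \<in> Over E \<Gamma>" "ctx \<Gamma> A B F"
  shows code_thom: "code \<Gamma> B F \<in> thom E \<Gamma> A B"
    and tstar_code: "feq (src E \<Gamma> B) (tstar E \<Gamma> A B (code \<Gamma> B F)) F"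
proof -
  have "fob F (fob (Wk E \<Gamma> B) B) = fob (Wk E \<Gamma> A) B"
    using tfun_eq_fob[OF ctx_Wk_eq[OF assms(4)], of B] assms(3) by simp
  then show "code \<Gamma> B F \<in> thom E \<Gamma> A B"
    using ehom_ftm_Tm[OF ctx_ehom[OF assms(4)], of "fob (Wk E \<Gamma> B) B" "idtm E \<Gamma> B"] assms
    by (simp add: code_def thom_def src_Ob Wk_fob_Over idtm_Tm)
  show "feq (src E \<Gamma> B) (tstar E \<Gamma> A B (code \<Gamma> B F)) F"
    using ehom_generic[OF ctx_ehom[OF assms(4)] assms(1) _ assms(3) ctx_Wk_eq[OF assms(4)]] assms(1,2)
    by (simp add: tstar_def code_def src_Ob tfun_eq_sym)
qed

lemma ctx_tid: "\<lbrakk>\<Gamma> \<in> Ob E; A \<in> Over E \<Gamma>\<rbrakk> \<Longrightarrow> ctx \<Gamma> A A tid"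
  by (auto simp: ctx_def intro!: pre_E_hom.intro tfunctor.intro strict_functor.intro
      tfunctor_axioms.intro pre_E_hom_axioms.intro tfun_eqI)

lemma code_tid: "code \<Gamma> A tid = idtm E \<Gamma> A"
  by (simp add: code_def)

lemma ctx_tcomp:
  assumes "\<Gamma> \<in> Ob E" "C \<in> Over E \<Gamma>" "ctx \<Gamma> A B F" "ctx \<Gamma> B C G"
  shows "ctx \<Gamma> A C (tcomp F G)"
proof -
  have "feq \<Gamma> (tcomp F (tcomp G (Wk E \<Gamma> C))) (Wk E \<Gamma> A)"
    using tcomp_cong_right[OF ctx_Wk_eq[OF assms(4)], of F] ctx_Wk_eq[OF assms(3)]
    by (rule tfun_eq_trans)
  then show ?thesis
    using ehom_tcomp[OF _ ctx_ehom[OF assms(4)] ctx_ehom[OF assms(3)]] assms(1,2)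
    by (simp add: ctx_def tcomp_assoc src_Ob)
qed

text \<open>With F = f^*, the value f^*(g) that defines the composite g.f is the code of f^* g^*. So
  composition of terms is composition of functors in the opposite order.\<close>

lemma code_tcomp_tstar:
  assumes "\<Gamma> \<in> Ob E" "B \<in> Over E \<Gamma>" "C \<in> Over E \<Gamma>" "g \<in> thom E \<Gamma> B C"
  shows "code \<Gamma> C (tcomp F (tstar E \<Gamma> B C g)) = ftm F (idn E (src E \<Gamma> B)) (fob (Wk E \<Gamma> B) C) g"
proof -
  note G = ctx_tstar[OF assms]
  have "far (tstar E \<Gamma> B C g) (idn E (src E \<Gamma> C)) (fob (Wk E \<Gamma> C) C) = fob (Wk E \<Gamma> B) C"
    using ehom_far_idn[OF ctx_ehom[OF G], of "fob (Wk E \<Gamma> C) C"] tfun_eq_fob[OF ctx_Wk_eq[OF G], of C]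
      assms(1-3) by (simp add: Wk_fob_Over src_Ob)
  then show ?thesis
    using code_tstar[OF assms] ehom_idn[OF ctx_ehom[OF G]] by (simp add: code_def)
qed

text \<open>F/R carries the generic term of R to that of F(R). Precomposing with F/R thus moves the
  base without changing the code; this is used for \<pi>_2 and for uniqueness in the
  pullback.\<close>

lemma code_tcomp_sl:
  assumes F: "ehom \<Gamma> \<Delta> F" and \<Gamma>: "\<Gamma> \<in> Ob E" and \<Delta>: "\<Delta> \<in> Ob E" and R: "R \<in> Over E \<Gamma>"
  shows "code \<Gamma> R (tcomp U (sl \<Gamma> F R)) = code \<Delta> (fob F R) U"
proof -
  let ?R = "src E \<Gamma> R"
  note slF = ehom_sl[OF \<Gamma> \<Delta> F R]
  have "fob F R \<in> Over E \<Delta>"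
    by (rule tfunctor_fob_Over[OF ehom_tfunctor[OF F] R])
  then have "far (sl \<Gamma> F R) (idn E ?R) (fob (Wk E \<Gamma> R) R) = fob (Wk E \<Delta> (fob F R)) (fob F R)"
    using ehom_far_idn[OF slF, of "fob (Wk E \<Gamma> R) R"]
      tfun_eq_fob[OF ehom_Wk[OF F \<Gamma> \<Delta> R], of R] \<Gamma> \<Delta> R
    by (simp add: src_Ob Wk_fob_Over)
  then show ?thesis
    using ehom_idn[OF slF] ehom_idtm[OF F \<Gamma> \<Delta> R] cmp_idn_right[OF \<Gamma> R] by (simp add: code_def)
qed

lemma ctx_Wk:
  assumes "\<Gamma> \<in> Ob E" "A \<in> Over E \<Gamma>" "Q \<in> Over E (src E \<Gamma> A)"
  shows "ctx \<Gamma> (cmp E \<Gamma> A Q) A (Wk E (src E \<Gamma> A) Q)"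
  using Wk_by_cmp[OF assms] Wk_hom[of "src E \<Gamma> A" Q] assms
  by (simp add: ctx_def tfun_eq_sym cat_simps)

lemma ctx_fob_Over: "\<lbrakk>ctx \<Gamma> A B F; R \<in> Over E (src E \<Gamma> B)\<rbrakk> \<Longrightarrow> fob F R \<in> Over E (src E \<Gamma> A)"
  using tfunctor_fob_Over[OF ehom_tfunctor[OF ctx_ehom]] by blast

text \<open>W_{B.R} factors as W_R W_B. Moving F/R past W_R leaves W_{F(R)} F W_B, and F W_B = W_A
  since F lies over \<Gamma>.\<close>

lemma ctx_sl:
  assumes "\<Gamma> \<in> Ob E" "A \<in> Over E \<Gamma>" "B \<in> Over E \<Gamma>" "ctx \<Gamma> A B F" "R \<in> Over E (src E \<Gamma> B)"
  shows "ctx \<Gamma> (cmp E \<Gamma> A (fob F R)) (cmp E \<Gamma> B R) (sl (src E \<Gamma> B) F R)"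
proof -
  let ?A = "src E \<Gamma> A" and ?B = "src E \<Gamma> B" and ?FR = "fob F R"
  have ob: "?A \<in> Ob E" "?B \<in> Ob E" "?FR \<in> Over E ?A"
    using assms by (auto simp: src_Ob ctx_fob_Over)
  have "feq \<Gamma> (tcomp (sl ?B F R) (Wk E \<Gamma> (cmp E \<Gamma> B R))) (tcomp (sl ?B F R) (tcomp (Wk E ?B R) (Wk E \<Gamma> B)))"
    by (rule tcomp_cong_right[OF Wk_by_cmp[OF assms(1,3,5)]])
  also have "feq \<Gamma> \<dots> (tcomp (tcomp (Wk E ?A ?FR) F) (Wk E \<Gamma> B))"
    unfolding tcomp_assoc[symmetric]
    by (rule tcomp_cong_left[OF Wk_functor[OF assms(1,3)]
        ehom_Wk[OF ctx_ehom[OF assms(4)] ob(2,1) assms(5)]])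
  also have "feq \<Gamma> \<dots> (tcomp (Wk E ?A ?FR) (Wk E \<Gamma> A))"
    unfolding tcomp_assoc by (rule tcomp_cong_right[OF ctx_Wk_eq[OF assms(4)]])
  also have "feq \<Gamma> \<dots> (Wk E \<Gamma> (cmp E \<Gamma> A ?FR))"
    by (rule tfun_eq_sym[OF Wk_by_cmp[OF assms(1,2) ob(3)]])
  finally show ?thesis
    using ehom_sl[OF ob(2,1) ctx_ehom[OF assms(4)] assms(5)] assms ob
    by (simp add: ctx_def cat_simps)
qed

text \<open>The pair x.u is the value at the generic term of A.P of the functor S_u (S_x/P), which
  substitutes x and then u.\<close>

lemma tpair_code:
  assumes "\<Gamma> \<in> Ob E" "A \<in> Over E \<Gamma>" "P \<in> Over E (src E \<Gamma> A)" "x \<in> Tm E \<Gamma> A"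
  shows "tpair E \<Gamma> A P x u = code \<Gamma> (cmp E \<Gamma> A P)
    (tcomp (Sub E \<Gamma> (fob (Sub E \<Gamma> A x) P) u) (sl (src E \<Gamma> A) (Sub E \<Gamma> A x) P))"
proof -
  interpret S: tfunctor "slice E (src E \<Gamma> A)" "slice E \<Gamma>" "Sub E \<Gamma> A x"
    by (rule Sub_functor[OF assms(1,2,4)])
  show ?thesis
    using S.far_idn[of P] assms by (simp add: tpair_def code_def Let_def cat_simps)
qed

text \<open>Identifies the explicit formula for \<pi>_2(f, R) with the arrow whose functor is f^*/R.
  The pair is the code of a functor V into the slice over \<Gamma>.A.f^*R. Precomposed with a slice
  of the weakening W by A.f^*R, V becomes f^*/R, and such a precomposition preserves codes.\<close>

lemma tpair_pr2:
  assumes "\<Gamma> \<in> Ob E" "A \<in> Over E \<Gamma>" "B \<in> Over E \<Gamma>" "f \<in> thom E \<Gamma> A B" "R \<in> Over E (src E \<Gamma> B)"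
  defines "fR \<equiv> fob (tstar E \<Gamma> A B f) R" and "WAB \<equiv> fob (Wk E \<Gamma> A) B"
  defines "AfR \<equiv> cmp E \<Gamma> A fR"
  shows "tpair E (src E \<Gamma> AfR) (fob (Wk E (src E \<Gamma> A) fR) WAB) (far (Wk E \<Gamma> AfR) B R)
      (ftm (Wk E (src E \<Gamma> A) fR) (idn E (src E \<Gamma> A)) WAB f) (idtm E (src E \<Gamma> A) fR)
    = code \<Gamma> (cmp E \<Gamma> B R) (sl (src E \<Gamma> B) (tstar E \<Gamma> A B f) R)"
proof -
  note \<Gamma> = assms(1)
  define \<Gamma>A where "\<Gamma>A = src E \<Gamma> A"
  define \<Gamma>B where "\<Gamma>B = src E \<Gamma> B"
  define \<Gamma>' where "\<Gamma>' = src E \<Gamma>A fR"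
  define F where "F = tstar E \<Gamma> A B f"
  define B' where "B' = fob (Wk E \<Gamma>A fR) WAB"
  define R' where "R' = far (Wk E \<Gamma> AfR) B R"
  define x where "x = ftm (Wk E \<Gamma>A fR) (idn E \<Gamma>A) WAB f"
  define u where "u = idtm E \<Gamma>A fR"
  let ?BR = "cmp E \<Gamma> B R" and ?W = "Wk E \<Gamma> AfR"
  note F = ctx_tstar[OF assms(1-4), folded F_def]
  have fRF: "fR = fob F R" by (simp add: F_def fR_def)
  have fR: "fR \<in> Over E \<Gamma>A"
    using ctx_fob_Over[OF F assms(5)] by (simp add: fRF \<Gamma>A_def)
  have AfR: "AfR \<in> Over E \<Gamma>" "src E \<Gamma> AfR = \<Gamma>'"
    using assms(1,2) fR by (simp_all add: AfR_def \<Gamma>A_def \<Gamma>'_def cat_simps)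
  have ob: "\<Gamma>A \<in> Ob E" "\<Gamma>B \<in> Ob E" "\<Gamma>' \<in> Ob E"
    using assms fR by (auto simp: \<Gamma>A_def \<Gamma>B_def \<Gamma>'_def cat_simps)
  have R: "R \<in> Over E \<Gamma>B" using assms(5) by (simp add: \<Gamma>B_def)
  have WAB: "WAB \<in> Over E \<Gamma>A" using assms(1-3) by (simp add: WAB_def \<Gamma>A_def Wk_fob_Over)
  have BR: "?BR \<in> Over E \<Gamma>" "src E \<Gamma> ?BR = src E \<Gamma>B R"
    using assms(1-5) by (simp_all add: \<Gamma>B_def cat_simps)
  have f: "f \<in> Tm E \<Gamma>A WAB" using assms(4) by (simp add: thom_def \<Gamma>A_def WAB_def)
  have WfR: "ehom \<Gamma>A \<Gamma>' (Wk E \<Gamma>A fR)"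
    using Wk_hom[OF ob(1) fR] by (simp add: \<Gamma>'_def)
  have W: "ehom \<Gamma> \<Gamma>' ?W"
    using Wk_hom[OF assms(1) AfR(1)] by (simp add: AfR(2))
  have Wcmp: "feq \<Gamma> ?W (tcomp (Wk E \<Gamma>A fR) (Wk E \<Gamma> A))"
    using Wk_by_cmp[OF assms(1,2)] fR by (simp add: AfR_def \<Gamma>A_def)
  have B': "B' \<in> Over E \<Gamma>'" "B' = fob ?W B"
    using Wk_fob_Over[OF ob(1) fR WAB] tfun_eq_fob[OF Wcmp, of B] assms(3)
    by (simp_all add: B'_def \<Gamma>'_def WAB_def)
  have x: "x \<in> Tm E \<Gamma>' B'"
    using ehom_ftm_Tm[OF WfR ob(1,3) WAB f] by (simp add: x_def B'_def)
  have slW: "ehom \<Gamma>B (src E \<Gamma>' B') (sl \<Gamma> ?W B)"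
    using ehom_sl[OF assms(1) ob(3) W assms(3)] by (simp add: B'(2) \<Gamma>B_def)
  have R': "R' \<in> Over E (src E \<Gamma>' B')"
    using tfunctor_fob_Over[OF ehom_tfunctor[OF slW] R] R assms(1,3)
    by (simp add: R'_def)
  \<comment> \<open>W factors as W_{f^*R} W_A, and W_{f^*R} is a homomorphism, so it moves past S_f
    and turns f into x = W_{f^*R}(f).\<close>
  have WfR_F: "feq \<Gamma>B (tcomp (Sub E \<Gamma>' B' x) (sl \<Gamma> ?W B)) (tcomp (Wk E \<Gamma>A fR) F)"
  proof -
    have "feq \<Gamma>B (tcomp (Sub E \<Gamma>' B' x) (sl \<Gamma> ?W B))
      (tcomp (Sub E \<Gamma>' B' x) (tcomp (sl \<Gamma>A (Wk E \<Gamma>A fR) WAB) (sl \<Gamma> (Wk E \<Gamma> A) B)))"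
      unfolding \<Gamma>B_def WAB_def \<Gamma>A_def
      by (intro tcomp_cong_right
          tfun_eq_trans[OF _ sl_tcomp[OF assms(1,3) ehom_tfunctor[OF Wk_hom[OF assms(1,2)]]]]
          sl_cong[OF assms(1,3)] Wcmp[unfolded \<Gamma>A_def])
    also have "feq \<Gamma>B \<dots> (tcomp (tcomp (Wk E \<Gamma>A fR) (Sub E \<Gamma>A WAB f)) (sl \<Gamma> (Wk E \<Gamma> A) B))"
      unfolding tcomp_assoc[symmetric]
    proof (rule tcomp_cong_left)
      show "tfunctor (slice E \<Gamma>B) (slice E (src E \<Gamma>A WAB)) (sl \<Gamma> (Wk E \<Gamma> A) B)"
        using ehom_tfunctor[OF ehom_sl[OF assms(1) _ Wk_hom[OF assms(1,2)] assms(3)]] ob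
        by (simp add: \<Gamma>A_def \<Gamma>B_def WAB_def)
      show "feq (src E \<Gamma>A WAB) (tcomp (Sub E \<Gamma>' B' x) (sl \<Gamma>A (Wk E \<Gamma>A fR) WAB))
          (tcomp (Wk E \<Gamma>A fR) (Sub E \<Gamma>A WAB f))"
        using ehom_Sub[OF WfR ob(1,3) WAB f] by (simp add: x_def B'_def tfun_eq_sym)
    qed
    finally show ?thesis
      by (simp add: F_def tstar_def tcomp_assoc \<Gamma>A_def WAB_def)
  qed
  \<comment> \<open>The previous square, evaluated at R, shows that u, the generic term of f^*R, has
    the type required of the second component of the pair.\<close>
  have SxR': "fob (Sub E \<Gamma>' B' x) R' = fob (Wk E \<Gamma>A fR) fR"
    using tfun_eq_fob[OF WfR_F, of R] R assms(1,3) by (simp add: R'_def fRF)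
  have u: "u \<in> Tm E \<Gamma>' (fob (Sub E \<Gamma>' B' x) R')"
    using idtm_Tm[OF ob(1) fR, folded \<Gamma>'_def] by (simp add: SxR' u_def)
  let ?V = "tcomp (Sub E \<Gamma>' (fob (Sub E \<Gamma>' B' x) R') u) (sl (src E \<Gamma>' B') (Sub E \<Gamma>' B' x) R')"
  have slR: "feq (src E \<Gamma>B R) (sl \<Gamma>B (sl \<Gamma> ?W B) R) (sl \<Gamma> ?W ?BR)"
    using sl_sl[OF assms(1,3,5)] by (simp add: \<Gamma>B_def)
  \<comment> \<open>Slicing that square over R turns the composite into S_u (W_{f^*R}/f^*R) (f^*/R).
    As u is generic, the first two factors cancel by \<open>Sub_by_idtm\<close>.\<close>
  have V: "feq (src E \<Gamma>B R) (tcomp ?V (sl \<Gamma> ?W ?BR)) (sl \<Gamma>B F R)"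
  proof -
    have "feq (src E \<Gamma>B R) (tcomp ?V (sl \<Gamma> ?W ?BR)) (tcomp ?V (sl \<Gamma>B (sl \<Gamma> ?W B) R))"
      by (rule tcomp_cong_right[OF tfun_eq_sym[OF slR]])
    also have "feq (src E \<Gamma>B R) \<dots> (tcomp (Sub E \<Gamma>' (fob (Wk E \<Gamma>A fR) fR) u)
        (sl \<Gamma>B (tcomp (Sub E \<Gamma>' B' x) (sl \<Gamma> ?W B)) R))"
      using sl_tcomp[OF ob(2) R ehom_tfunctor[OF slW], of "Sub E \<Gamma>' B' x"] assms(1,3)
      unfolding tcomp_assoc SxR' by (intro tcomp_cong_right) (simp add: tfun_eq_sym R'_def)
    also have "feq (src E \<Gamma>B R) \<dots> (tcomp (Sub E \<Gamma>' (fob (Wk E \<Gamma>A fR) fR) u)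
        (tcomp (sl \<Gamma>A (Wk E \<Gamma>A fR) fR) (sl \<Gamma>B F R)))"
      using tfun_eq_trans[OF sl_cong[OF ob(2) R WfR_F]
          sl_tcomp[OF ob(2) R, of \<Gamma>A F "Wk E \<Gamma>A fR"]] ctx_ehom[OF F]
      by (intro tcomp_cong_right) (simp add: fRF \<Gamma>A_def \<Gamma>B_def ehom_tfunctor)
    also have "feq (src E \<Gamma>B R) \<dots> (tcomp tid (sl \<Gamma>B F R))"
      unfolding tcomp_assoc[symmetric]
    proof (rule tcomp_cong_left)
      show "tfunctor (slice E (src E \<Gamma>B R)) (slice E (src E \<Gamma>A fR)) (sl \<Gamma>B F R)"
        using ehom_tfunctor[OF ehom_sl[OF ob(2,1) _ R]] ctx_ehom[OF F]
        by (simp add: fRF \<Gamma>A_def \<Gamma>B_def)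
      show "feq (src E \<Gamma>A fR) (tcomp (Sub E \<Gamma>' (fob (Wk E \<Gamma>A fR) fR) u)
          (sl \<Gamma>A (Wk E \<Gamma>A fR) fR)) tid"
        using Sub_by_idtm[OF ob(1) fR] by (simp add: u_def \<Gamma>'_def)
    qed
    finally show ?thesis by simp
  qed
  have W_BR: "fob ?W ?BR = cmp E \<Gamma>' B' R'"
    using tfunctor_cmp[OF ehom_tfunctor[OF W] assms(3,5)] by (simp add: B'(2) R'_def)
  \<comment> \<open>W carries B.R to B'.R', so \<open>code_tcomp_sl\<close> moves the code of V from
    \<Gamma>' to \<Gamma>.\<close>
  have "code \<Gamma> ?BR (tcomp ?V (sl \<Gamma> ?W ?BR)) = code \<Gamma>' (cmp E \<Gamma>' B' R') ?V"
    using code_tcomp_sl[OF W assms(1) ob(3) BR(1)] by (simp add: W_BR)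
  moreover have "code \<Gamma> ?BR (tcomp ?V (sl \<Gamma> ?W ?BR)) = code \<Gamma> ?BR (sl \<Gamma>B F R)"
    by (rule code_cong[OF assms(1) BR(1)]) (use V in \<open>simp add: BR(2)\<close>)
  ultimately show ?thesis
    using tpair_code[OF ob(3) B'(1) R' x, of u]
    by (simp add: \<Gamma>A_def[symmetric] \<Gamma>B_def[symmetric] AfR(2) B'_def R'_def x_def u_def F_def)
qed

end

section \<open>The CE-system of an E-system\<close>

lemma untag_tag [simp]: "untag (tag p) = p"
  by (simp add: untag_def inv_f_f inj_tag)

lemma tag_eq_iff [simp]: "tag p = tag q \<longleftrightarrow> p = q"
  by (simp add: inj_eq inj_tag)

text \<open>So far objects, arrows and terms could have three different types. \<open>E2C\<close>
  encodes pairs by \<open>tag\<close>, so from here on all three share one infinite type.\<close>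

locale small_E_system = E_system E for E :: "('u::infinite, 'u, 'u) esys"
begin

text \<open>
  \<open>sem \<Gamma> B h\<close> is \<open>h\<^sup>*\<close> for an arrow \<open>h : A \<rightarrow> B\<close>; conversely \<open>arr \<Gamma> A B F\<close> is the arrow
  \<open>h : A \<rightarrow> B\<close> with \<open>h\<^sup>* = F\<close>.
\<close>

definition sem :: "'u \<Rightarrow> 'u \<Rightarrow> 'u \<Rightarrow> ('u, 'u, 'u, 'u, 'u, 'u) tfnct" where
  "sem \<Gamma> B h = tstar E \<Gamma> (fst (untag h)) B (snd (untag h))"

definition arr :: "'u \<Rightarrow> 'u \<Rightarrow> 'u \<Rightarrow> ('u, 'u, 'u, 'b, 'c, 'u) tfnct \<Rightarrow> 'u" where
  "arr \<Gamma> A B F = tag (A, code \<Gamma> B F)"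

lemma Ob_E2C [simp]: "Ob (E2C E \<Gamma>) = Over E \<Gamma>"
  by (simp add: E2C_def)

lemma hom_E2C_iff: "h \<in> hom (E2C E \<Gamma>) A B \<longleftrightarrow> A \<in> Over E \<Gamma> \<and> (\<exists>f \<in> thom E \<Gamma> A B. h = tag (A, f))"
  by (auto simp: hom_def E2C_def)

lemma Over_E2C_iff: "h \<in> Over (E2C E \<Gamma>) B \<longleftrightarrow> (\<exists>A. h \<in> hom (E2C E \<Gamma>) A B)"
  by (auto simp: hom_def)

lemma src_E2C: "h \<in> hom (E2C E \<Gamma>) A B \<Longrightarrow> src (E2C E \<Gamma>) B h = A"
  by (auto simp: hom_def)

lemma hom_E2C_Over: "h \<in> hom (E2C E \<Gamma>) A B \<Longrightarrow> A \<in> Over E \<Gamma>"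
  by (simp add: hom_E2C_iff)

lemma idn_E2C: "idn (E2C E \<Gamma>) A = arr \<Gamma> A A tid"
  by (simp add: E2C_def arr_def code_tid)

context
  fixes \<Gamma> :: 'u
  assumes \<Gamma>: "\<Gamma> \<in> Ob E"
begin

lemma ctx_sem: "\<lbrakk>h \<in> hom (E2C E \<Gamma>) A B; B \<in> Over E \<Gamma>\<rbrakk> \<Longrightarrow> ctx \<Gamma> A B (sem \<Gamma> B h)"
  by (auto simp: hom_E2C_iff sem_def intro: ctx_tstar[OF \<Gamma>])

lemma arr_sem: "\<lbrakk>h \<in> hom (E2C E \<Gamma>) A B; B \<in> Over E \<Gamma>\<rbrakk> \<Longrightarrow> arr \<Gamma> A B (sem \<Gamma> B h) = h"
  by (auto simp: hom_E2C_iff sem_def arr_def code_tstar[OF \<Gamma>])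

lemma
  assumes "A \<in> Over E \<Gamma>" "B \<in> Over E \<Gamma>" "ctx \<Gamma> A B F"
  shows arr_hom: "arr \<Gamma> A B F \<in> hom (E2C E \<Gamma>) A B"
    and sem_arr: "feq (src E \<Gamma> B) (sem \<Gamma> B (arr \<Gamma> A B F)) F"
  using code_thom[OF \<Gamma> assms] tstar_code[OF \<Gamma> assms] assms(1)
  by (auto simp: hom_E2C_iff arr_def sem_def)

lemma arr_cong: "\<lbrakk>B \<in> Over E \<Gamma>; feq (src E \<Gamma> B) F G\<rbrakk> \<Longrightarrow> arr \<Gamma> A B F = arr \<Gamma> A B G"
  by (simp add: arr_def code_cong[OF \<Gamma>])

text \<open>Since \<open>arr\<close> undoes \<open>sem\<close>, an arrow is determined by its
  functor. Equations between parallel arrows of the second category are reduced by this rule to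
  \<open>feq\<close>.\<close>

lemma hom_E2C_eqI:
  assumes "h \<in> hom (E2C E \<Gamma>) A B" "k \<in> hom (E2C E \<Gamma>) A B" "B \<in> Over E \<Gamma>"
    and "feq (src E \<Gamma> B) (sem \<Gamma> B h) (sem \<Gamma> B k)"
  shows "h = k"
  using arr_sem[OF assms(1,3)] arr_sem[OF assms(2,3)] arr_cong[OF assms(3,4)] by metis

text \<open>\<open>sem\<close> is contravariant: by \<open>code_tcomp_tstar\<close> the composite of
  terms is the code of the composite of their functors taken in reverse order.\<close>

lemma
  assumes "h \<in> hom (E2C E \<Gamma>) B C" "k \<in> hom (E2C E \<Gamma>) A B" "C \<in> Over E \<Gamma>"
  shows cmp_hom: "cmp (E2C E \<Gamma>) C h k \<in> hom (E2C E \<Gamma>) A C"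
    and sem_cmp: "feq (src E \<Gamma> C) (sem \<Gamma> C (cmp (E2C E \<Gamma>) C h k)) (tcomp (sem \<Gamma> B k) (sem \<Gamma> C h))"
    and cmp_E2C: "cmp (E2C E \<Gamma>) C h k = arr \<Gamma> A C (tcomp (sem \<Gamma> B k) (sem \<Gamma> C h))"
proof -
  have AB: "A \<in> Over E \<Gamma>" "B \<in> Over E \<Gamma>"
    using assms hom_E2C_Over by auto
  obtain f where f: "f \<in> thom E \<Gamma> A B" "k = tag (A, f)"
    using assms(2) by (auto simp: hom_E2C_iff)
  obtain g where g: "g \<in> thom E \<Gamma> B C" "h = tag (B, g)"
    using assms(1) by (auto simp: hom_E2C_iff)
  show eq: "cmp (E2C E \<Gamma>) C h k = arr \<Gamma> A C (tcomp (sem \<Gamma> B k) (sem \<Gamma> C h))"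
    using code_tcomp_tstar[OF \<Gamma> AB(2) assms(3) g(1), of "tstar E \<Gamma> A B f"]
    by (simp add: E2C_def tcmp_def arr_def sem_def f(2) g(2))
  have ctx: "ctx \<Gamma> A C (tcomp (sem \<Gamma> B k) (sem \<Gamma> C h))"
    by (rule ctx_tcomp[OF \<Gamma> assms(3) ctx_sem[OF assms(2) AB(2)] ctx_sem[OF assms(1,3)]])
  show "cmp (E2C E \<Gamma>) C h k \<in> hom (E2C E \<Gamma>) A C"
    and "feq (src E \<Gamma> C) (sem \<Gamma> C (cmp (E2C E \<Gamma>) C h k)) (tcomp (sem \<Gamma> B k) (sem \<Gamma> C h))"
    unfolding eq using arr_hom[OF AB(1) assms(3) ctx] sem_arr[OF AB(1) assms(3) ctx] by auto
qed

lemma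
  assumes "A \<in> Over E \<Gamma>"
  shows idn_hom: "idn (E2C E \<Gamma>) A \<in> hom (E2C E \<Gamma>) A A"
    and sem_idn: "feq (src E \<Gamma> A) (sem \<Gamma> A (idn (E2C E \<Gamma>) A)) tid"
  unfolding idn_E2C
  using arr_hom[OF assms assms ctx_tid[OF \<Gamma> assms]] sem_arr[OF assms assms ctx_tid[OF \<Gamma> assms]]
  by auto

lemma sem_tfunctor: "\<lbrakk>h \<in> hom (E2C E \<Gamma>) A B; B \<in> Over E \<Gamma>\<rbrakk>
    \<Longrightarrow> tfunctor (slice E (src E \<Gamma> B)) (slice E (src E \<Gamma> A)) (sem \<Gamma> B h)"
  by (rule ehom_tfunctor[OF ctx_ehom[OF ctx_sem]])

text \<open>The category laws are those of functor composition, reflected along \<open>sem\<close>,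
  which is faithful and reverses composition.\<close>

lemma strict_category_E2C: "strict_category (E2C E \<Gamma>)"
proof
  fix B h
  assume "B \<in> Ob (E2C E \<Gamma>)" and h: "h \<in> Over (E2C E \<Gamma>) B"
  then have B: "B \<in> Over E \<Gamma>" by simp
  from h obtain A where hA: "h \<in> hom (E2C E \<Gamma>) A B" by (auto simp: Over_E2C_iff)
  have A: "A \<in> Over E \<Gamma>" by (rule hom_E2C_Over[OF hA])
  show "src (E2C E \<Gamma>) B h \<in> Ob (E2C E \<Gamma>)"
    by (simp add: src_E2C[OF hA] A)
  show "cmp (E2C E \<Gamma>) B (idn (E2C E \<Gamma>) B) h = h"
  proof (rule hom_E2C_eqI[OF cmp_hom[OF idn_hom[OF B] hA B] hA B])
    show "feq (src E \<Gamma> B) (sem \<Gamma> B (cmp (E2C E \<Gamma>) B (idn (E2C E \<Gamma>) B) h)) (sem \<Gamma> B h)"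
      using tfun_eq_trans[OF sem_cmp[OF idn_hom[OF B] hA B] tcomp_cong_right[OF sem_idn[OF B]]]
      by simp
  qed
  show "cmp (E2C E \<Gamma>) B h (idn (E2C E \<Gamma>) (src (E2C E \<Gamma>) B h)) = h"
    unfolding src_E2C[OF hA]
  proof (rule hom_E2C_eqI[OF cmp_hom[OF hA idn_hom[OF A] B] hA B])
    show "feq (src E \<Gamma> B) (sem \<Gamma> B (cmp (E2C E \<Gamma>) B h (idn (E2C E \<Gamma>) A))) (sem \<Gamma> B h)"
      using tfun_eq_trans[OF sem_cmp[OF hA idn_hom[OF A] B]
          tcomp_cong_left[OF sem_tfunctor[OF hA B] sem_idn[OF A]]]
      by simp
  qed
  fix k
  assume k: "k \<in> Over (E2C E \<Gamma>) (src (E2C E \<Gamma>) B h)"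
  then obtain X where kX: "k \<in> hom (E2C E \<Gamma>) X A" by (auto simp: Over_E2C_iff src_E2C[OF hA])
  note hk = cmp_hom[OF hA kX B]
  show "cmp (E2C E \<Gamma>) B h k \<in> Over (E2C E \<Gamma>) B"
    using hk by (auto simp: Over_E2C_iff)
  show "src (E2C E \<Gamma>) B (cmp (E2C E \<Gamma>) B h k) = src (E2C E \<Gamma>) (src (E2C E \<Gamma>) B h) k"
    by (simp add: src_E2C[OF hk] src_E2C[OF hA] src_E2C[OF kX])
  fix l
  assume l: "l \<in> Over (E2C E \<Gamma>) (src (E2C E \<Gamma>) (src (E2C E \<Gamma>) B h) k)"
  then obtain Y where lY: "l \<in> hom (E2C E \<Gamma>) Y X"
    by (auto simp: Over_E2C_iff src_E2C[OF hA] src_E2C[OF kX])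
  note kl = cmp_hom[OF kX lY A]
  have X: "X \<in> Over E \<Gamma>" by (rule hom_E2C_Over[OF kX])
  show "cmp (E2C E \<Gamma>) B (cmp (E2C E \<Gamma>) B h k) l
      = cmp (E2C E \<Gamma>) B h (cmp (E2C E \<Gamma>) (src (E2C E \<Gamma>) B h) k l)"
    unfolding src_E2C[OF hA]
  proof (rule hom_E2C_eqI[OF cmp_hom[OF hk lY B] cmp_hom[OF hA kl B] B])
    have "feq (src E \<Gamma> B) (sem \<Gamma> B (cmp (E2C E \<Gamma>) B (cmp (E2C E \<Gamma>) B h k) l))
      (tcomp (sem \<Gamma> X l) (tcomp (sem \<Gamma> A k) (sem \<Gamma> B h)))"
      by (rule tfun_eq_trans[OF sem_cmp[OF hk lY B] tcomp_cong_right[OF sem_cmp[OF hA kX B]]])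
    also have "feq (src E \<Gamma> B) \<dots> (tcomp (sem \<Gamma> A (cmp (E2C E \<Gamma>) A k l)) (sem \<Gamma> B h))"
      unfolding tcomp_assoc[symmetric]
      by (rule tcomp_cong_left[OF sem_tfunctor[OF hA B] tfun_eq_sym[OF sem_cmp[OF kX lY A]]])
    also have "feq (src E \<Gamma> B) \<dots> (sem \<Gamma> B (cmp (E2C E \<Gamma>) B h (cmp (E2C E \<Gamma>) A k l)))"
      by (rule tfun_eq_sym[OF sem_cmp[OF hA kl B]])
    finally show "feq (src E \<Gamma> B) (sem \<Gamma> B (cmp (E2C E \<Gamma>) B (cmp (E2C E \<Gamma>) B h k) l))
      (sem \<Gamma> B (cmp (E2C E \<Gamma>) B h (cmp (E2C E \<Gamma>) A k l)))" .
  qed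
next
  fix A
  assume "A \<in> Ob (E2C E \<Gamma>)"
  then have A: "A \<in> Over E \<Gamma>" by simp
  note i = idn_hom[OF A]
  show "idn (E2C E \<Gamma>) A \<in> Over (E2C E \<Gamma>) A" using i by (auto simp: Over_E2C_iff)
  show "src (E2C E \<Gamma>) A (idn (E2C E \<Gamma>) A) = A" by (rule src_E2C[OF i])
qed

end

section \<open>Inclusions, projections and chosen pullbacks over the root\<close>

abbreviation r :: 'u where "r \<equiv> root E"
abbreviation CE :: "('u, 'u, 'u) cesys" where "CE \<equiv> E2CE_ob E"

lemma root_Ob: "r \<in> Ob E"
  using terminal_root by (simp add: terminal_def)

lemma CE_simps [simp]:
  "Fam CE = slice_cat E r" "Con CE = E2C E r" "one CE = idn E r"
  by (simp_all add: E2CE_ob_def Let_def)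

lemma Inc_CE: "Inc CE A Q = arr r (cmp E r A Q) A (Wk E (src E r A) Q)"
  by (simp add: E2CE_ob_def Let_def arr_def code_def)

lemma pb_CE: "pb CE B h R = fob (sem r B h) R"
  by (simp add: E2CE_ob_def Let_def sem_def case_prod_unfold)

lemma pr2_CE:
  assumes "h \<in> hom (E2C E r) A B" "B \<in> Over E r" "R \<in> Over E (src E r B)"
  shows "pr2 CE B h R = arr r (cmp E r A (fob (sem r B h) R)) (cmp E r B R) (sl (src E r B) (sem r B h) R)"
proof -
  obtain f where "f \<in> thom E r A B" "h = tag (A, f)" "A \<in> Over E r"
    using assms(1) by (auto simp: hom_E2C_iff)
  then show ?thesis
    using tpair_pr2[OF root_Ob _ assms(2) _ assms(3), of A f]
    by (simp add: E2CE_ob_def Let_def sem_def arr_def)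
qed

lemma
  assumes "A \<in> Over E r" "Q \<in> Over E (src E r A)"
  shows Inc_hom: "Inc CE A Q \<in> hom (E2C E r) (cmp E r A Q) A"
    and sem_Inc: "feq (src E r A) (sem r A (Inc CE A Q)) (Wk E (src E r A) Q)"
  using arr_hom[OF root_Ob _ assms(1) ctx_Wk[OF root_Ob assms]]
    sem_arr[OF root_Ob _ assms(1) ctx_Wk[OF root_Ob assms]] assms root_Ob
  by (simp_all add: Inc_CE cmp_Over)

lemma pb_Over_CE: "\<lbrakk>h \<in> hom (E2C E r) A B; B \<in> Over E r; R \<in> Over E (src E r B)\<rbrakk>
    \<Longrightarrow> fob (sem r B h) R \<in> Over E (src E r A)"
  by (rule ctx_fob_Over[OF ctx_sem[OF root_Ob]])

lemma
  assumes h: "h \<in> hom (E2C E r) A B" and B: "B \<in> Over E r" and R: "R \<in> Over E (src E r B)"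
  shows pr2_hom_CE: "pr2 CE B h R \<in> hom (E2C E r) (cmp E r A (pb CE B h R)) (cmp E r B R)"
    and sem_pr2: "feq (src E (src E r B) R) (sem r (cmp E r B R) (pr2 CE B h R)) (sl (src E r B) (sem r B h) R)"
proof -
  have A: "A \<in> Over E r" by (rule hom_E2C_Over[OF h])
  note * = ctx_sl[OF root_Ob A B ctx_sem[OF root_Ob h B] R]
  have ob: "cmp E r A (fob (sem r B h) R) \<in> Over E r" "cmp E r B R \<in> Over E r"
    using pb_Over_CE[OF h B R] A B R root_Ob by (auto simp: cmp_Over)
  show "pr2 CE B h R \<in> hom (E2C E r) (cmp E r A (pb CE B h R)) (cmp E r B R)"
    and "feq (src E (src E r B) R) (sem r (cmp E r B R) (pr2 CE B h R)) (sl (src E r B) (sem r B h) R)"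
    using arr_hom[OF root_Ob ob *] sem_arr[OF root_Ob ob *] root_Ob B R
    by (simp_all add: pr2_CE[OF h B R] pb_CE src_cmp)
qed

text \<open>Under \<open>sem\<close> the square reads (h^*/R) W_R = W_{h^*R} h^*, which is the
  compatibility of the homomorphism h^* with weakening.\<close>

lemma cmp_Inc_pr2:
  assumes h: "h \<in> hom (E2C E r) A B" and B: "B \<in> Over E r" and R: "R \<in> Over E (src E r B)"
  shows "cmp (E2C E r) B (Inc CE B R) (pr2 CE B h R) = cmp (E2C E r) B h (Inc CE A (pb CE B h R))"
proof -
  have A: "A \<in> Over E r" by (rule hom_E2C_Over[OF h])
  have ob: "src E r A \<in> Ob E" "src E r B \<in> Ob E" using A B root_Ob by (auto simp: src_Ob)
  note F = ctx_ehom[OF ctx_sem[OF root_Ob h B]]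
  have fR: "pb CE B h R \<in> Over E (src E r A)" using pb_Over_CE[OF h B R] by (simp add: pb_CE)
  note * = Inc_hom[OF B R] pr2_hom_CE[OF h B R] and ** = Inc_hom[OF A fR]
  show ?thesis
  proof (rule hom_E2C_eqI[OF root_Ob cmp_hom[OF root_Ob * B] cmp_hom[OF root_Ob h ** B] B])
    let ?BR = "cmp E r B R"
    have "feq (src E r B) (sem r B (cmp (E2C E r) B (Inc CE B R) (pr2 CE B h R)))
        (tcomp (sem r ?BR (pr2 CE B h R)) (sem r B (Inc CE B R)))"
      by (rule sem_cmp[OF root_Ob * B])
    also have "feq (src E r B) \<dots> (tcomp (sem r ?BR (pr2 CE B h R)) (Wk E (src E r B) R))"
      by (rule tcomp_cong_right[OF sem_Inc[OF B R]])
    also have "feq (src E r B) \<dots> (tcomp (sl (src E r B) (sem r B h) R) (Wk E (src E r B) R))"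
      by (rule tcomp_cong_left[OF Wk_functor[OF ob(2) R] sem_pr2[OF h B R]])
    also have "feq (src E r B) \<dots> (tcomp (Wk E (src E r A) (pb CE B h R)) (sem r B h))"
      unfolding pb_CE by (rule ehom_Wk[OF F ob(2,1) R])
    also have "feq (src E r B) \<dots> (tcomp (sem r A (Inc CE A (pb CE B h R))) (sem r B h))"
      by (rule tcomp_cong_left[OF ehom_tfunctor[OF F] tfun_eq_sym[OF sem_Inc[OF A fR]]])
    also have "feq (src E r B) \<dots> (sem r B (cmp (E2C E r) B h (Inc CE A (pb CE B h R))))"
      by (rule tfun_eq_sym[OF sem_cmp[OF root_Ob h ** B]])
    finally show "feq (src E r B) (sem r B (cmp (E2C E r) B (Inc CE B R) (pr2 CE B h R)))
      (sem r B (cmp (E2C E r) B h (Inc CE A (pb CE B h R))))" .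
  qed
qed

lemma sem_cmp_Inc:
  assumes A: "A \<in> Over E r" and Q: "Q \<in> Over E (src E r A)" and u: "u \<in> hom (E2C E r) X (cmp E r A Q)"
  shows "feq (src E r A) (sem r A (cmp (E2C E r) A (Inc CE A Q) u))
    (tcomp (sem r (cmp E r A Q) u) (Wk E (src E r A) Q))"
  by (rule tfun_eq_trans[OF sem_cmp[OF root_Ob Inc_hom[OF A Q] u A] tcomp_cong_right[OF sem_Inc[OF A Q]]])

lemma pb_pullback_CE:
  assumes h: "h \<in> hom (E2C E r) A B" and B: "B \<in> Over E r" and R: "R \<in> Over E (src E r B)"
  shows "pullback (E2C E r) B (Inc CE B R) h (pr2 CE B h R) (Inc CE A (pb CE B h R))"
proof -
  have A: "A \<in> Over E r" by (rule hom_E2C_Over[OF h])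
  let ?A = "src E r A" and ?B = "src E r B" and ?BR = "cmp E r B R" and ?H = "sem r B h"
  let ?fR = "fob ?H R"
  let ?AfR = "cmp E r A ?fR"
  have ob: "?A \<in> Ob E" "?B \<in> Ob E" using A B root_Ob by (auto simp: src_Ob)
  note F = ctx_ehom[OF ctx_sem[OF root_Ob h B]]
  have fR: "?fR \<in> Over E ?A" by (rule pb_Over_CE[OF h B R])
  have BR: "?BR \<in> Over E r" "src E r ?BR = src E ?B R" "?AfR \<in> Over E r" "src E r ?AfR = src E ?A ?fR"
    using A B R fR root_Ob by (auto simp: cmp_Over src_cmp)
  note IncB = Inc_hom[OF B R] and pr = pr2_hom_CE[OF h B R, unfolded pb_CE] and IncA = Inc_hom[OF A fR]
  have slH: "ehom (src E ?B R) (src E ?A ?fR) (sl ?B ?H R)"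
    by (rule ehom_sl[OF ob(2,1) F R])
  have sempr: "feq (src E ?B R) (sem r ?BR (cmp (E2C E r) ?BR (pr2 CE B h R) u))
    (tcomp (sem r ?AfR u) (sl ?B ?H R))"
    if "u \<in> hom (E2C E r) X ?AfR" for u X
    using tfun_eq_trans[OF sem_cmp[OF root_Ob pr that BR(1)]]
      tcomp_cong_right[OF sem_pr2[OF h B R], of "sem r ?AfR u"] by (simp add: BR(2))
  have "\<exists>!u. u \<in> hom (E2C E r) X ?AfR \<and> cmp (E2C E r) ?BR (pr2 CE B h R) u = k
      \<and> cmp (E2C E r) A (Inc CE A ?fR) u = l"
    if X: "X \<in> Over E r" and k: "k \<in> hom (E2C E r) X ?BR" and l: "l \<in> hom (E2C E r) X A"
      and kl: "cmp (E2C E r) B (Inc CE B R) k = cmp (E2C E r) B h l" for X k l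
  proof (rule ex_ex1I)
    let ?X = "src E r X" and ?K = "sem r ?BR k" and ?L = "sem r A l"
    have obX: "?X \<in> Ob E" using X root_Ob by (auto simp: src_Ob)
    have K: "ehom (src E ?B R) ?X ?K"
      using ctx_ehom[OF ctx_sem[OF root_Ob k BR(1)]] by (simp add: BR(2))
    note L = ctx_ehom[OF ctx_sem[OF root_Ob l A]]
    have KL: "feq ?B (tcomp ?K (Wk E ?B R)) (tcomp ?L ?H)"
      using tfun_eq_trans[OF tfun_eq_sym[OF sem_cmp_Inc[OF B R k]]] sem_cmp[OF root_Ob h l B] kl by simp
    \<comment> \<open>The functor of k is determined by its composite with W_R, which
      \<open>KL\<close> fixes, and by its value v at the generic term of R. Evaluating
      \<open>KL\<close> at R shows that v is a term of l^*(h^*R).\<close>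
    define v where "v = code ?B R ?K"
    have v: "v \<in> Tm E ?X (fob ?L ?fR)"
      using ehom_ftm_Tm[OF K _ obX Wk_fob_Over[OF ob(2) R R] idtm_Tm[OF ob(2) R]]
        tfun_eq_fob[OF KL, of R] R ob by (simp add: v_def code_def src_Ob)
    \<comment> \<open>The functor of a mediating arrow must restrict along W_{h^*R} to that of l, by
      the condition on the leg l, and send the generic term of h^*R to v, by the condition on the
      leg k. This extension is the only candidate.\<close>
    define U where "U = tcomp (Sub E ?X (fob ?L ?fR) v) (sl ?A ?L ?fR)"
    have U: "ehom (src E ?A ?fR) ?X U"
      unfolding U_def by (rule ehom_ext[OF L ob(1) obX fR v])
    have UW: "feq ?A (tcomp U (Wk E ?A ?fR)) ?L"
      unfolding U_def by (rule ext_Wk[OF L ob(1) obX fR v])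
    have Uv: "code ?A ?fR U = v"
      unfolding U_def code_def by (rule ext_idtm[OF L ob(1) obX fR v])
    have "feq r (tcomp U (Wk E r ?AfR)) (tcomp U (tcomp (Wk E ?A ?fR) (Wk E r A)))"
      by (rule tcomp_cong_right[OF Wk_by_cmp[OF root_Ob A fR]])
    also have "feq r \<dots> (tcomp ?L (Wk E r A))"
      unfolding tcomp_assoc[symmetric] by (rule tcomp_cong_left[OF Wk_functor[OF root_Ob A] UW])
    also have "feq r \<dots> (Wk E r X)"
      by (rule ctx_Wk_eq[OF ctx_sem[OF root_Ob l A]])
    finally have ctxU: "ctx r X ?AfR U"
      using U by (simp add: ctx_def BR(4))
    define u where "u = arr r X ?AfR U"
    have u: "u \<in> hom (E2C E r) X ?AfR" and semu: "feq (src E ?A ?fR) (sem r ?AfR u) U"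
      using arr_hom[OF root_Ob X BR(3) ctxU] sem_arr[OF root_Ob X BR(3) ctxU] BR(4) by (auto simp: u_def)
    have "cmp (E2C E r) A (Inc CE A ?fR) u = l"
    proof (rule hom_E2C_eqI[OF root_Ob cmp_hom[OF root_Ob IncA u A] l A])
      show "feq ?A (sem r A (cmp (E2C E r) A (Inc CE A ?fR) u)) ?L"
        by (rule tfun_eq_trans[OF sem_cmp_Inc[OF A fR u]
              tfun_eq_trans[OF tcomp_cong_left[OF Wk_functor[OF ob(1) fR] semu] UW]])
    qed
    moreover have "cmp (E2C E r) ?BR (pr2 CE B h R) u = k"
    proof (rule hom_E2C_eqI[OF root_Ob cmp_hom[OF root_Ob pr u BR(1)] k BR(1)])
      \<comment> \<open>By \<open>ehom_eqI\<close> over R: both sides restrict along W_R to the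
        functor of h followed by that of l, and both send the generic term of R to v.\<close>
      have "feq (src E ?B R) (tcomp U (sl ?B ?H R)) ?K"
      proof (rule ehom_eqI[OF ehom_tcomp[OF _ slH U] K ob(2) obX R])
        show "src E ?B R \<in> Ob E" using ob R by (simp add: src_Ob)
        have "feq ?B (tcomp (tcomp U (sl ?B ?H R)) (Wk E ?B R)) (tcomp U (tcomp (Wk E ?A ?fR) ?H))"
          unfolding tcomp_assoc by (rule tcomp_cong_right[OF ehom_Wk[OF F ob(2,1) R]])
        also have "feq ?B \<dots> (tcomp ?L ?H)"
          unfolding tcomp_assoc[symmetric] by (rule tcomp_cong_left[OF ehom_tfunctor[OF F] UW])
        also note tfun_eq_sym[OF KL]
        finally show "feq ?B (tcomp (tcomp U (sl ?B ?H R)) (Wk E ?B R)) (tcomp ?K (Wk E ?B R))" .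
        show "ftm (tcomp U (sl ?B ?H R)) (idn E (src E ?B R)) (fob (Wk E ?B R) R) (idtm E ?B R)
          = ftm ?K (idn E (src E ?B R)) (fob (Wk E ?B R) R) (idtm E ?B R)"
          using code_tcomp_sl[OF F ob(2,1) R, of U] Uv unfolding v_def code_def by simp
      qed
      then have "feq (src E ?B R) (tcomp (sem r ?AfR u) (sl ?B ?H R)) ?K"
        using tcomp_cong_left[OF ehom_tfunctor[OF slH] semu] by (rule tfun_eq_trans[rotated])
      then show "feq (src E r ?BR) (sem r ?BR (cmp (E2C E r) ?BR (pr2 CE B h R) u)) ?K"
        using tfun_eq_trans[OF sempr[OF u]] by (simp add: BR(2))
    qed
    ultimately show "\<exists>u. u \<in> hom (E2C E r) X ?AfR \<and> cmp (E2C E r) ?BR (pr2 CE B h R) u = k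
      \<and> cmp (E2C E r) A (Inc CE A ?fR) u = l"
      using u by blast
    fix u u'
    assume "u \<in> hom (E2C E r) X ?AfR \<and> cmp (E2C E r) ?BR (pr2 CE B h R) u = k
        \<and> cmp (E2C E r) A (Inc CE A ?fR) u = l"
      and "u' \<in> hom (E2C E r) X ?AfR \<and> cmp (E2C E r) ?BR (pr2 CE B h R) u' = k
        \<and> cmp (E2C E r) A (Inc CE A ?fR) u' = l"
    then have u: "u \<in> hom (E2C E r) X ?AfR" "cmp (E2C E r) ?BR (pr2 CE B h R) u = k"
        "cmp (E2C E r) A (Inc CE A ?fR) u = l"
      and u': "u' \<in> hom (E2C E r) X ?AfR" "cmp (E2C E r) ?BR (pr2 CE B h R) u' = k"
        "cmp (E2C E r) A (Inc CE A ?fR) u' = l"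
      by auto
    show "u = u'"
    proof (rule hom_E2C_eqI[OF root_Ob u(1) u'(1) BR(3)])
      have UU: "ehom (src E ?A ?fR) ?X (sem r ?AfR u)" "ehom (src E ?A ?fR) ?X (sem r ?AfR u')"
        using ctx_ehom[OF ctx_sem[OF root_Ob u(1) BR(3)]] ctx_ehom[OF ctx_sem[OF root_Ob u'(1) BR(3)]]
        by (simp_all add: BR(4))
      show "feq (src E r ?AfR) (sem r ?AfR u) (sem r ?AfR u')"
        unfolding BR(4)
      proof (rule ehom_eqI[OF UU ob(1) obX fR])
        show "feq ?A (tcomp (sem r ?AfR u) (Wk E ?A ?fR)) (tcomp (sem r ?AfR u') (Wk E ?A ?fR))"
          using tfun_eq_trans[OF tfun_eq_sym[OF sem_cmp_Inc[OF A fR u(1)]]] sem_cmp_Inc[OF A fR u'(1)]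
          by (simp add: u(3) u'(3))
        \<comment> \<open>The common composite with the projection fixes the value at the generic
          term of h^*R, because \<open>code_tcomp_sl\<close> reads it off as the code over
          R.\<close>
        have "feq (src E ?B R) (tcomp (sem r ?AfR u) (sl ?B ?H R)) (tcomp (sem r ?AfR u') (sl ?B ?H R))"
          using tfun_eq_trans[OF tfun_eq_sym[OF sempr[OF u(1)]]] sempr[OF u'(1)] by (simp add: u(2) u'(2))
        from code_cong[OF ob(2) R this]
        show "ftm (sem r ?AfR u) (idn E (src E ?A ?fR)) (fob (Wk E ?A ?fR) ?fR) (idtm E ?A ?fR)
          = ftm (sem r ?AfR u') (idn E (src E ?A ?fR)) (fob (Wk E ?A ?fR) ?fR) (idtm E ?A ?fR)"
          unfolding code_tcomp_sl[OF F ob(2,1) R] by (simp add: code_def)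
      qed
    qed
  qed
  then show ?thesis
    using IncB pr IncA h cmp_Inc_pr2[OF h B R]
    unfolding pullback_def pb_CE
    by (simp add: src_E2C[OF IncB] src_E2C[OF pr] src_E2C[OF IncA] src_E2C[OF h] Over_E2C_iff) blast
qed

lemma CE_system_E2CE: "CE_system CE"
proof (rule CE_system.intro)
  show "strict_category (Fam CE)"
    by (simp add: strict_category_slice_cat[OF cat root_Ob])
  show "strict_category (Con CE)"
    by (simp add: strict_category_E2C root_Ob)
  show "Ob (Con CE) = Ob (Fam CE)" by simp
  show "terminal (Fam CE) (one CE)"
    using pre_E_system.terminal_root[OF pre_E_system_slice[OF pre_E_system_axioms root_Ob]]
    by (simp add: terminal_def hom_def)
  show "strict_functor (Fam CE) (Con CE) \<lparr>fob = \<lambda>\<Gamma>. \<Gamma>, far = Inc CE\<rparr>"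
  proof (unfold_locales, simp_all, goal_cases)
    case (1 A Q)
    then show ?case using Inc_hom by (auto simp: Over_E2C_iff)
  next
    case (2 A Q)
    then show ?case by (rule src_E2C[OF Inc_hom])
  next
    case (3 A)
    then show ?case
      using root_Ob arr_cong[OF root_Ob 3 Wk_by_idn] by (simp add: Inc_CE idn_E2C cat_simps)
  next
    case (4 A P Q)
    let ?A = "src E r A"
    have ob: "?A \<in> Ob E" "cmp E r A P \<in> Over E r" "src E r (cmp E r A P) = src E ?A P"
      using 4 root_Ob by (auto simp: cat_simps)
    have PQ: "cmp E ?A P Q \<in> Over E ?A" "Q \<in> Over E (src E r (cmp E r A P))"
      using 4 ob by (auto simp: cat_simps)
    have hom1: "Inc CE A (cmp E ?A P Q) \<in> hom (E2C E r) (cmp E r (cmp E r A P) Q) A"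
      using Inc_hom[OF 4(1) PQ(1)] 4 root_Ob by (simp add: cmp_assoc ob)
    show ?case
    proof (rule hom_E2C_eqI[OF root_Ob hom1 _ 4(1)])
      note * = Inc_hom[OF 4(1,2)] Inc_hom[OF ob(2) PQ(2)]
      show "cmp (E2C E r) A (Inc CE A P) (Inc CE (cmp E r A P) Q) \<in> hom (E2C E r) (cmp E r (cmp E r A P) Q) A"
        by (rule cmp_hom[OF root_Ob * 4(1)])
      have "feq ?A (sem r A (Inc CE A (cmp E ?A P Q))) (Wk E ?A (cmp E ?A P Q))"
        by (rule sem_Inc[OF 4(1) PQ(1)])
      also have "feq ?A \<dots> (tcomp (Wk E (src E ?A P) Q) (Wk E ?A P))"
        using 4 ob PQ by (intro Wk_by_cmp) simp_all
      also have "feq ?A \<dots> (tcomp (sem r (cmp E r A P) (Inc CE (cmp E r A P) Q)) (Wk E ?A P))"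
        using tcomp_cong_left[OF Wk_functor[OF ob(1) 4(2)] tfun_eq_sym]
          sem_Inc[OF ob(2) PQ(2)] by (simp add: ob(3))
      also have "feq ?A \<dots> (sem r A (cmp (E2C E r) A (Inc CE A P) (Inc CE (cmp E r A P) Q)))"
        by (rule tfun_eq_sym[OF sem_cmp_Inc[OF 4(1,2) *(2)]])
      finally show "feq ?A (sem r A (Inc CE A (cmp E ?A P Q)))
        (sem r A (cmp (E2C E r) A (Inc CE A P) (Inc CE (cmp E r A P) Q)))" .
    qed
  qed
next
  fix B h A
  assume "B \<in> Ob (Fam CE)" "h \<in> hom (Con CE) A B"
  then have B: "B \<in> Over E r" and h: "h \<in> hom (E2C E r) A B" by simp_all
  have A: "A \<in> Over E r" by (rule hom_E2C_Over[OF h])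
  let ?A = "src E r A" and ?B = "src E r B" and ?H = "sem r B h"
  have ob: "?A \<in> Ob E" "?B \<in> Ob E" using A B root_Ob by (auto simp: src_Ob)
  note F = ctx_ehom[OF ctx_sem[OF root_Ob h B]]
  show "pb CE B h (idn (Fam CE) B) = idn (Fam CE) A"
    by (simp add: pb_CE ehom_idn[OF F])
  show "pr2 CE B h (idn (Fam CE) B) = h"
    using pr2_CE[OF h B idn_Over[OF ob(2)]] arr_cong[OF root_Ob B sl_idn[OF ob(2,1) F]] A B root_Ob
    by (simp add: ehom_idn[OF F] cat_simps arr_sem[OF root_Ob h B])
  fix R
  assume "R \<in> Over (Fam CE) B"
  then have R: "R \<in> Over E ?B" by simp
  have fR: "pb CE B h R \<in> Over E ?A" using pb_Over_CE[OF h B R] by (simp add: pb_CE)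
  have BR: "cmp E r B R \<in> Over E r" "src E r (cmp E r B R) = src E ?B R"
    using B R root_Ob by (auto simp: cat_simps)
  note pr = pr2_hom_CE[OF h B R]
  show "pb CE B h R \<in> Over (Fam CE) A" using fR by simp
  show "pr2 CE B h R \<in> hom (Con CE) (src (Fam CE) A (pb CE B h R)) (src (Fam CE) B R)"
    using pr by simp
  show "pullback (Con CE) B (Inc CE B R) h (pr2 CE B h R) (Inc CE A (pb CE B h R))"
    using pb_pullback_CE[OF h B R] by simp
  {
    fix g
    assume "g \<in> Over (Con CE) A"
    then obtain X where g: "g \<in> hom (E2C E r) X A" by (auto simp: Over_E2C_iff)
    note hg = cmp_hom[OF root_Ob h g B] and semhg = sem_cmp[OF root_Ob h g B]
    show pbg: "pb CE B (cmp (Con CE) B h g) R = pb CE A g (pb CE B h R)"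
      using tfun_eq_fob[OF semhg, of R] R by (simp add: pb_CE)
    note prg = pr2_hom_CE[OF g A fR]
    have "pr2 CE B (cmp (E2C E r) B h g) R
      = cmp (E2C E r) (cmp E r B R) (pr2 CE B h R) (pr2 CE A g (pb CE B h R))"
    proof (rule hom_E2C_eqI[OF root_Ob pr2_hom_CE[OF hg B R] _ BR(1)])
      note * = pr prg BR(1)
      show "cmp (E2C E r) (cmp E r B R) (pr2 CE B h R) (pr2 CE A g (pb CE B h R))
          \<in> hom (E2C E r) (cmp E r X (pb CE B (cmp (E2C E r) B h g) R)) (cmp E r B R)"
        using cmp_hom[OF root_Ob *] pbg by simp
      have "feq (src E ?B R) (sem r (cmp E r B R) (pr2 CE B (cmp (E2C E r) B h g) R))
        (sl ?B (sem r B (cmp (E2C E r) B h g)) R)"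
        by (rule sem_pr2[OF hg B R])
      also have "feq (src E ?B R) \<dots> (sl ?B (tcomp (sem r A g) ?H) R)"
        by (rule sl_cong[OF ob(2) R semhg])
      also have "feq (src E ?B R) \<dots> (tcomp (sl ?A (sem r A g) (fob ?H R)) (sl ?B ?H R))"
        by (rule sl_tcomp[OF ob(2) R ehom_tfunctor[OF F]])
      also have "feq (src E ?B R) \<dots> (tcomp (sem r (cmp E r A (pb CE B h R)) (pr2 CE A g (pb CE B h R))) (sl ?B ?H R))"
        using tcomp_cong_left[OF ehom_tfunctor[OF ehom_sl[OF ob(2,1) F R]]
            tfun_eq_sym[OF sem_pr2[OF g A fR, unfolded pb_CE]]] by (simp add: pb_CE)
      also have "feq (src E ?B R) \<dots> (tcomp (sem r (cmp E r A (pb CE B h R)) (pr2 CE A g (pb CE B h R)))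
          (sem r (cmp E r B R) (pr2 CE B h R)))"
        by (rule tcomp_cong_right[OF tfun_eq_sym[OF sem_pr2[OF h B R]]])
      also have "feq (src E ?B R) \<dots> (sem r (cmp E r B R)
          (cmp (E2C E r) (cmp E r B R) (pr2 CE B h R) (pr2 CE A g (pb CE B h R))))"
        using tfun_eq_sym[OF sem_cmp[OF root_Ob *]] by (simp add: BR(2))
      finally show "feq (src E r (cmp E r B R)) (sem r (cmp E r B R) (pr2 CE B (cmp (E2C E r) B h g) R))
        (sem r (cmp E r B R) (cmp (E2C E r) (cmp E r B R) (pr2 CE B h R) (pr2 CE A g (pb CE B h R))))"
        by (simp add: BR(2))
    qed
    then show "pr2 CE B (cmp (Con CE) B h g) R
      = cmp (Con CE) (src (Fam CE) B R) (pr2 CE B h R) (pr2 CE A g (pb CE B h R))"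
      by simp
  }
  fix P
  assume "P \<in> Over (Fam CE) (src (Fam CE) B R)"
  then have P: "P \<in> Over E (src E ?B R)" "P \<in> Over E (src E r (cmp E r B R))" by (simp_all add: BR(2))
  have RP: "cmp E ?B R P \<in> Over E ?B" using ob R P by (simp add: cmp_Over)
  have pbP: "pb CE (cmp E r B R) (pr2 CE B h R) P = far ?H R P"
    using tfun_eq_fob[OF sem_pr2[OF h B R], of P] P R B root_Ob by (simp add: pb_CE cat_simps)
  show pb: "pb CE B h (cmp (Fam CE) B R P)
      = cmp (Fam CE) A (pb CE B h R) (pb CE (src (Fam CE) B R) (pr2 CE B h R) P)"
    using tfunctor_cmp[OF ehom_tfunctor[OF F] R P(1)] by (simp add: pbP[unfolded pb_CE] pb_CE)
  have hom1: "pr2 CE B h (cmp E ?B R P) \<in> hom (E2C E r)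
      (cmp E r (cmp E r A (pb CE B h R)) (pb CE (cmp E r B R) (pr2 CE B h R) P))
      (cmp E r (cmp E r B R) P)"
    using pr2_hom_CE[OF h B RP] pb A B R P fR root_Ob pb_Over_CE[OF pr BR(1) P(2)]
    by (simp add: cat_simps pb_CE)
  have "pr2 CE B h (cmp E ?B R P) = pr2 CE (cmp E r B R) (pr2 CE B h R) P"
  proof (rule hom_E2C_eqI[OF root_Ob hom1 pr2_hom_CE[OF pr BR(1) P(2)] cmp_Over[OF root_Ob BR(1) P(2)]])
    have RPr: "cmp E r (cmp E r B R) P = cmp E r B (cmp E ?B R P)" "src E ?B (cmp E ?B R P) = src E (src E ?B R) P"
      using B R P root_Ob ob by (simp_all add: cat_simps)
    have "feq (src E (src E ?B R) P) (sem r (cmp E r (cmp E r B R) P) (pr2 CE B h (cmp E ?B R P)))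
      (sl ?B ?H (cmp E ?B R P))"
      using sem_pr2[OF h B RP] by (simp add: RPr)
    also have "feq (src E (src E ?B R) P) \<dots> (sl (src E ?B R) (sl ?B ?H R) P)"
      by (rule tfun_eq_sym[OF sl_sl[OF ob(2) R P(1)]])
    also have "feq (src E (src E ?B R) P) \<dots> (sl (src E ?B R) (sem r (cmp E r B R) (pr2 CE B h R)) P)"
      using R P ob by (intro sl_cong tfun_eq_sym[OF sem_pr2[OF h B R]]) (auto simp: src_Ob)
    also have "feq (src E (src E ?B R) P) \<dots> (sem r (cmp E r (cmp E r B R) P) (pr2 CE (cmp E r B R) (pr2 CE B h R) P))"
      using tfun_eq_sym[OF sem_pr2[OF pr BR(1) P(2)]] by (simp add: BR(2))
    finally show "feq (src E r (cmp E r (cmp E r B R) P))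
      (sem r (cmp E r (cmp E r B R) P) (pr2 CE B h (cmp E ?B R P)))
      (sem r (cmp E r (cmp E r B R) P) (pr2 CE (cmp E r B R) (pr2 CE B h R) P))"
      using BR root_Ob P by (simp add: src_cmp)
  qed
  then show "pr2 CE B h (cmp (Fam CE) B R P) = pr2 CE (src (Fam CE) B R) (pr2 CE B h R) P"
    by simp
next
  fix B R
  assume "B \<in> Ob (Fam CE)" "R \<in> Over (Fam CE) B"
  then have B: "B \<in> Over E r" and R: "R \<in> Over E (src E r B)" by simp_all
  note i = idn_hom[OF root_Ob B] and s = sem_idn[OF root_Ob B]
  have BR: "cmp E r B R \<in> Over E r" "src E r (cmp E r B R) = src E (src E r B) R" "src E r B \<in> Ob E"
    using B R root_Ob by (auto simp: cat_simps)
  show pb: "pb CE B (idn (Con CE) B) R = R"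
    using tfun_eq_fob[OF s, of R] R by (simp add: pb_CE)
  have "feq (src E r (cmp E r B R)) (sl (src E r B) (sem r B (idn (E2C E r) B)) R) tid"
    using sl_cong[OF BR(3) R s] by (simp add: BR(2))
  from arr_cong[OF root_Ob BR(1) this]
  show "pr2 CE B (idn (Con CE) B) R = idn (Con CE) (src (Fam CE) B R)"
    using pb pr2_CE[OF i B R] by (simp add: idn_E2C pb_CE)
qed

text \<open>S_x sends the generic term of the identity to x by \<open>Sub_idtm\<close>. But W_id is
  the identity and S_x cancels it, so S_x also fixes that term.\<close>

lemma Tm_idn:
  assumes \<Gamma>: "\<Gamma> \<in> Ob E" and x: "x \<in> Tm E \<Gamma> (idn E \<Gamma>)"
  shows "x = idtm E \<Gamma> (idn E \<Gamma>)"
proof -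
  note id = idn_Over[OF \<Gamma>]
  note W = Wk_by_idn[OF \<Gamma>]
  have *: "idtm E \<Gamma> (idn E \<Gamma>) \<in> Tm E \<Gamma> (idn E \<Gamma>)"
    using idtm_Tm[OF \<Gamma> id] Wk_idn[OF \<Gamma> id] by (simp add: src_idn \<Gamma>)
  then show ?thesis
    using Sub_idtm[OF \<Gamma> id x] tfun_eq_ftm[OF Sub_Wk[OF \<Gamma> id x], of "idn E \<Gamma>" "idn E \<Gamma>"]
      tfun_eq_ftm[OF W, of "idn E \<Gamma>" "idn E \<Gamma>"] tfun_eq_fob[OF W, of "idn E \<Gamma>"]
      tfun_eq_far[OF W, of "idn E \<Gamma>" "idn E \<Gamma>"] id \<Gamma>
    by (simp add: src_idn)
qed

text \<open>Arrows from A to 1 are the terms of W_A(id) = id over \<Gamma>.A, and by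
  \<open>Tm_idn\<close> there is at most one.\<close>

lemma rooted_E2CE: "rooted CE"
proof -
  have id: "idn E r \<in> Over E r" using root_Ob by (rule idn_Over)
  show ?thesis
    unfolding rooted_def terminal_def
  proof (intro conjI ballI)
    show "one CE \<in> Ob (Con CE)" by (simp add: id)
    fix A
    assume "A \<in> Ob (Con CE)"
    then have A: "A \<in> Over E r" by simp
    show "\<exists>!h. h \<in> hom (Con CE) A (one CE)"
    proof (rule ex_ex1I)
      \<comment> \<open>As id.A = A, the family A is itself an arrow from A to the identity; its
        inclusion is the required arrow.\<close>
      show "\<exists>h. h \<in> hom (Con CE) A (one CE)"
        using Inc_hom[OF id, of A] A root_Ob by (auto simp: src_idn cmp_idn_left)
      fix h k
      assume "h \<in> hom (Con CE) A (one CE)" "k \<in> hom (Con CE) A (one CE)"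
      then have "h \<in> hom (E2C E r) A (idn E r)" "k \<in> hom (E2C E r) A (idn E r)" by simp_all
      then show "h = k"
        using A root_Ob Tm_idn[of "src E r A"] Wk_idn[OF root_Ob A]
        by (auto simp: hom_E2C_iff thom_def src_Ob)
    qed
  qed
qed

end

section \<open>The E-system of a CE-system\<close>

lemma CE2E_simps [simp]:
  "Ob (CE2E_ob S) = Ob (Fam S)"
  "Over (CE2E_ob S) = Over (Fam S)"
  "src (CE2E_ob S) = src (Fam S)"
  "idn (CE2E_ob S) = idn (Fam S)"
  "cmp (CE2E_ob S) = cmp (Fam S)"
  "Tm (CE2E_ob S) = sections S"
  "root (CE2E_ob S) = one S"
  "Sub (CE2E_ob S) = (\<lambda>\<Gamma> A x. pb_fun S (src (Fam S) \<Gamma> A) x)"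
  "Wk (CE2E_ob S) = (\<lambda>\<Gamma> A. pb_fun S \<Gamma> (Inc S \<Gamma> A))"
  by (simp_all add: CE2E_ob_def)

lemma hom_iff: "f \<in> hom C X Y \<longleftrightarrow> f \<in> Over C Y \<and> src C Y f = X"
  by (simp add: hom_def)

context CE_system
begin

abbreviation F :: "('o, 'a) cat" where "F \<equiv> Fam S"
abbreviation C :: "('o, 'c) cat" where "C \<equiv> Con S"
abbreviation E :: "('o, 'a, 'c) esys" where "E \<equiv> CE2E_ob S"

sublocale F: strict_category "Fam S" by (rule Fam_category)
sublocale C: strict_category "Con S" by (rule Con_category)

lemma F_simps: "\<lbrakk>\<Gamma> \<in> Ob F; A \<in> Over F \<Gamma>\<rbrakk> \<Longrightarrow> src F \<Gamma> A \<in> Ob F"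
  "\<Gamma> \<in> Ob F \<Longrightarrow> idn F \<Gamma> \<in> Over F \<Gamma>"
  "\<Gamma> \<in> Ob F \<Longrightarrow> src F \<Gamma> (idn F \<Gamma>) = \<Gamma>"
  "\<lbrakk>\<Gamma> \<in> Ob F; A \<in> Over F \<Gamma>; P \<in> Over F (src F \<Gamma> A)\<rbrakk> \<Longrightarrow> cmp F \<Gamma> A P \<in> Over F \<Gamma>"
  "\<lbrakk>\<Gamma> \<in> Ob F; A \<in> Over F \<Gamma>; P \<in> Over F (src F \<Gamma> A)\<rbrakk> \<Longrightarrow> src F \<Gamma> (cmp F \<Gamma> A P) = src F (src F \<Gamma> A) P"
  by (simp_all add: F.src_Ob F.idn_Over F.src_idn F.cmp_Over F.src_cmp)

lemma C_cmp_hom: "\<lbrakk>\<Gamma> \<in> Ob F; f \<in> hom C \<Delta> \<Gamma>; g \<in> hom C \<Theta> \<Delta>\<rbrakk> \<Longrightarrow> cmp C \<Gamma> f g \<in> hom C \<Theta> \<Gamma>"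
  using same_Ob by (auto simp: hom_iff C.cmp_Over C.src_cmp)

lemma C_assoc: "\<lbrakk>\<Gamma> \<in> Ob F; f \<in> hom C \<Delta> \<Gamma>; g \<in> hom C \<Theta> \<Delta>; h \<in> hom C \<Xi> \<Theta>\<rbrakk>
    \<Longrightarrow> cmp C \<Gamma> (cmp C \<Gamma> f g) h = cmp C \<Gamma> f (cmp C \<Delta> g h)"
  using same_Ob C.cmp_assoc[of \<Gamma> f g h] by (auto simp: hom_iff)

lemma C_idn_hom: "\<Gamma> \<in> Ob F \<Longrightarrow> idn C \<Gamma> \<in> hom C \<Gamma> \<Gamma>"
  using same_Ob by (simp add: hom_iff C.idn_Over C.src_idn)

lemma C_idn_left: "\<lbrakk>\<Gamma> \<in> Ob F; f \<in> hom C \<Delta> \<Gamma>\<rbrakk> \<Longrightarrow> cmp C \<Gamma> (idn C \<Gamma>) f = f"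
  using same_Ob by (simp add: hom_iff C.cmp_idn_left)

lemma C_idn_right: "\<lbrakk>\<Gamma> \<in> Ob F; f \<in> hom C \<Delta> \<Gamma>\<rbrakk> \<Longrightarrow> cmp C \<Gamma> f (idn C \<Delta>) = f"
  using same_Ob C.cmp_idn_right by (auto simp: hom_iff)

lemma C_hom_Ob: "\<lbrakk>\<Gamma> \<in> Ob F; f \<in> hom C \<Delta> \<Gamma>\<rbrakk> \<Longrightarrow> \<Delta> \<in> Ob F"
  using same_Ob C.src_Ob by (auto simp: hom_iff)

lemma Inc_hom: "\<lbrakk>\<Gamma> \<in> Ob F; A \<in> Over F \<Gamma>\<rbrakk> \<Longrightarrow> Inc S \<Gamma> A \<in> hom C (src F \<Gamma> A) \<Gamma>"
  using strict_functor.far_Over[OF Inc_functor] strict_functor.src_far[OF Inc_functor]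
  by (simp add: hom_iff)

lemma Inc_idn: "\<Gamma> \<in> Ob F \<Longrightarrow> Inc S \<Gamma> (idn F \<Gamma>) = idn C \<Gamma>"
  using strict_functor.far_idn[OF Inc_functor] by simp

lemma Inc_cmp: "\<lbrakk>\<Gamma> \<in> Ob F; A \<in> Over F \<Gamma>; P \<in> Over F (src F \<Gamma> A)\<rbrakk>
    \<Longrightarrow> Inc S \<Gamma> (cmp F \<Gamma> A P) = cmp C \<Gamma> (Inc S \<Gamma> A) (Inc S (src F \<Gamma> A) P)"
  using strict_functor.far_cmp[OF Inc_functor] by simp

lemma Inc_pr2: "\<lbrakk>\<Gamma> \<in> Ob F; f \<in> hom C \<Delta> \<Gamma>; A \<in> Over F \<Gamma>\<rbrakk>
    \<Longrightarrow> cmp C \<Gamma> (Inc S \<Gamma> A) (pr2 S \<Gamma> f A) = cmp C \<Gamma> f (Inc S \<Delta> (pb S \<Gamma> f A))"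
  using pb_pullback[of \<Gamma> f \<Delta> A] by (simp add: pullback_def)

lemma sections_hom: "x \<in> sections S \<Gamma> A \<Longrightarrow> x \<in> hom C \<Gamma> (src F \<Gamma> A)"
  and sections_cmp: "x \<in> sections S \<Gamma> A \<Longrightarrow> cmp C \<Gamma> (Inc S \<Gamma> A) x = idn C \<Gamma>"
  by (simp_all add: sections_def)

text \<open>Sections of f^*A correspond to lifts of f along I(A): apply the pullback property to w
  and the identity. Both pulled back sections and generic terms arise from it.\<close>

lemma section_ex1:
  assumes \<Gamma>: "\<Gamma> \<in> Ob F" and f: "f \<in> hom C \<Delta> \<Gamma>" and A: "A \<in> Over F \<Gamma>"
    and w: "w \<in> hom C \<Delta> (src F \<Gamma> A)" and fw: "cmp C \<Gamma> (Inc S \<Gamma> A) w = f"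
  shows "\<exists>!z. z \<in> sections S \<Delta> (pb S \<Gamma> f A) \<and> cmp C (src F \<Gamma> A) (pr2 S \<Gamma> f A) z = w"
proof -
  have \<Delta>: "\<Delta> \<in> Ob F" by (rule C_hom_Ob[OF \<Gamma> f])
  have I: "src C \<Gamma> (Inc S \<Gamma> A) = src F \<Gamma> A" "src C \<Gamma> f = \<Delta>"
    "src C (src F \<Gamma> A) (pr2 S \<Gamma> f A) = src F \<Delta> (pb S \<Gamma> f A)"
    "src C \<Delta> (Inc S \<Delta> (pb S \<Gamma> f A)) = src F \<Delta> (pb S \<Gamma> f A)"
    using Inc_hom[OF \<Gamma> A] f pr2_hom[OF \<Gamma> f A] Inc_hom[OF \<Delta> pb_Over[OF \<Gamma> f A]] by (simp_all add: hom_iff)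
  have "\<exists>!u. u \<in> hom C \<Delta> (src F \<Delta> (pb S \<Gamma> f A)) \<and>
        cmp C (src F \<Gamma> A) (pr2 S \<Gamma> f A) u = w \<and> cmp C \<Delta> (Inc S \<Delta> (pb S \<Gamma> f A)) u = idn C \<Delta>"
    using pb_pullback[OF \<Gamma> f A] \<Delta> same_Ob w C_idn_hom[OF \<Delta>] fw C_idn_right[OF \<Gamma> f]
    by (simp add: pullback_def I)
  then show ?thesis
    by (simp add: sections_def conj_ac)
qed

lemma section_unique:
  assumes "\<Gamma> \<in> Ob F" "f \<in> hom C \<Delta> \<Gamma>" "A \<in> Over F \<Gamma>"
    and z: "z \<in> sections S \<Delta> (pb S \<Gamma> f A)" and z': "z' \<in> sections S \<Delta> (pb S \<Gamma> f A)"
    and eq: "cmp C (src F \<Gamma> A) (pr2 S \<Gamma> f A) z = cmp C (src F \<Gamma> A) (pr2 S \<Gamma> f A) z'"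
  shows "z = z'"
proof -
  let ?w = "cmp C (src F \<Gamma> A) (pr2 S \<Gamma> f A) z"
  note \<Delta> = C_hom_Ob[OF assms(1,2)]
  note I = Inc_hom[OF assms(1,3)] pr2_hom[OF assms(1-3)] and J = Inc_hom[OF \<Delta> pb_Over[OF assms(1-3)]]
  have "cmp C \<Gamma> (Inc S \<Gamma> A) ?w = f"
    using C_assoc[OF assms(1) I sections_hom[OF z]] C_assoc[OF assms(1,2) J sections_hom[OF z]]
      Inc_pr2[OF assms(1-3)] sections_cmp[OF z] C_idn_right[OF assms(1,2)] by simp
  from section_ex1[OF assms(1-3) _ this] z z' eq C_cmp_hom[OF _ I(2) sections_hom[OF z]]
    F.src_Ob[OF assms(1,3)]
  show ?thesis by auto
qed

text \<open>The section y pulled back along g. It is the term action of \<open>pb_fun\<close> with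
  the arrow \<pi>_2(f, B) replaced by an arbitrary g, so that composition laws can be stated without
  mentioning B.\<close>

definition tpb :: "'o \<Rightarrow> 'c \<Rightarrow> 'a \<Rightarrow> 'c \<Rightarrow> 'c" where
  "tpb \<Gamma> g Q y = (THE z. z \<in> sections S (src C \<Gamma> g) (pb S \<Gamma> g Q) \<and>
    cmp C (src F \<Gamma> Q) (pr2 S \<Gamma> g Q) z = cmp C (src F \<Gamma> Q) y g)"

lemma
  assumes "\<Gamma> \<in> Ob F" "g \<in> hom C \<Delta> \<Gamma>" "Q \<in> Over F \<Gamma>" "y \<in> sections S \<Gamma> Q"
  shows tpb_section: "tpb \<Gamma> g Q y \<in> sections S \<Delta> (pb S \<Gamma> g Q)"
    and pr2_tpb: "cmp C (src F \<Gamma> Q) (pr2 S \<Gamma> g Q) (tpb \<Gamma> g Q y) = cmp C (src F \<Gamma> Q) y g"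
proof -
  have Q: "src F \<Gamma> Q \<in> Ob F" using assms by (simp add: F.src_Ob)
  note y = sections_hom[OF assms(4)]
  have "cmp C \<Gamma> (Inc S \<Gamma> Q) (cmp C (src F \<Gamma> Q) y g) = g"
    using C_assoc[OF assms(1) Inc_hom[OF assms(1,3)] y assms(2)] sections_cmp[OF assms(4)]
      C_idn_left[OF assms(1,2)] by simp
  from theI'[OF section_ex1[OF assms(1-3) C_cmp_hom[OF Q y assms(2)] this]]
  show "tpb \<Gamma> g Q y \<in> sections S \<Delta> (pb S \<Gamma> g Q)"
    and "cmp C (src F \<Gamma> Q) (pr2 S \<Gamma> g Q) (tpb \<Gamma> g Q y) = cmp C (src F \<Gamma> Q) y g"
    using assms(2) by (simp_all add: tpb_def hom_iff)
qed

lemma tpb_eqI: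
  assumes "\<Gamma> \<in> Ob F" "g \<in> hom C \<Delta> \<Gamma>" "Q \<in> Over F \<Gamma>" "y \<in> sections S \<Gamma> Q"
    and "z \<in> sections S \<Delta> (pb S \<Gamma> g Q)"
    and "cmp C (src F \<Gamma> Q) (pr2 S \<Gamma> g Q) z = cmp C (src F \<Gamma> Q) y g"
  shows "tpb \<Gamma> g Q y = z"
  by (rule section_unique[OF assms(1-3) tpb_section[OF assms(1-4)] assms(5)])
    (simp add: assms(6) pr2_tpb[OF assms(1-4)])

lemma tpb_idn:
  assumes "\<Gamma> \<in> Ob F" "Q \<in> Over F \<Gamma>" "y \<in> sections S \<Gamma> Q"
  shows "tpb \<Gamma> (idn C \<Gamma>) Q y = y"
  by (rule tpb_eqI[OF assms(1) C_idn_hom[OF assms(1)] assms(2,3)])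
    (use assms in \<open>simp_all add: pb_along_idn pr2_along_idn C_idn_left[OF _ sections_hom]
      C_idn_right[OF _ sections_hom] F.src_Ob\<close>)

lemma tpb_cmp:
  assumes "\<Gamma> \<in> Ob F" "g \<in> hom C \<Delta> \<Gamma>" "h \<in> hom C \<Theta> \<Delta>" "Q \<in> Over F \<Gamma>" "y \<in> sections S \<Gamma> Q"
  shows "tpb \<Gamma> (cmp C \<Gamma> g h) Q y = tpb \<Delta> h (pb S \<Gamma> g Q) (tpb \<Gamma> g Q y)"
proof -
  note \<Delta> = C_hom_Ob[OF assms(1,2)] and gQ = pb_Over[OF assms(1,2,4)] and gy = tpb_section[OF assms(1,2,4,5)]
  have Q: "src F \<Gamma> Q \<in> Ob F" using assms by (simp add: F.src_Ob)
  have h: "h \<in> Over C \<Delta>" using assms(3) by (simp add: hom_iff)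
  note gh = C_cmp_hom[OF assms(1-3)] and hgy = tpb_section[OF \<Delta> assms(3) gQ gy]
  let ?Q = "src F \<Gamma> Q"
  show ?thesis
  proof (rule tpb_eqI[OF assms(1) gh assms(4,5)])
    show "tpb \<Delta> h (pb S \<Gamma> g Q) (tpb \<Gamma> g Q y) \<in> sections S \<Theta> (pb S \<Gamma> (cmp C \<Gamma> g h) Q)"
      using hgy by (simp add: pb_along_cmp[OF assms(1,2) h assms(4)])
    note p = pr2_hom[OF assms(1,2,4)]
    have "cmp C ?Q (pr2 S \<Gamma> (cmp C \<Gamma> g h) Q) (tpb \<Delta> h (pb S \<Gamma> g Q) (tpb \<Gamma> g Q y))
      = cmp C ?Q (pr2 S \<Gamma> g Q) (cmp C (src F \<Delta> (pb S \<Gamma> g Q)) (tpb \<Gamma> g Q y) h)"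
      using C_assoc[OF Q p pr2_hom[OF \<Delta> assms(3) gQ] sections_hom[OF hgy]] pr2_tpb[OF \<Delta> assms(3) gQ gy]
      by (simp add: pr2_along_cmp[OF assms(1,2) h assms(4)])
    also have "\<dots> = cmp C ?Q y (cmp C \<Gamma> g h)"
      using C_assoc[OF Q p sections_hom[OF gy] assms(3)] pr2_tpb[OF assms(1,2,4,5)]
        C_assoc[OF Q sections_hom[OF assms(5)] assms(2,3)] by simp
    finally show "cmp C ?Q (pr2 S \<Gamma> (cmp C \<Gamma> g h) Q) (tpb \<Delta> h (pb S \<Gamma> g Q) (tpb \<Gamma> g Q y))
      = cmp C ?Q y (cmp C \<Gamma> g h)" .
  qed
qed

section \<open>Pullback functors as functors with term structure\<close>

lemma pb_fun_fob [simp]: "fob (pb_fun S \<Gamma> f) = pb S \<Gamma> f"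
  and pb_fun_far [simp]: "far (pb_fun S \<Gamma> f) = (\<lambda>B Q. pb S (src F \<Gamma> B) (pr2 S \<Gamma> f B) Q)"
  by (simp_all add: pb_fun_def)

lemma pb_fun_ftm:
  assumes "\<Gamma> \<in> Ob F" "f \<in> hom C \<Delta> \<Gamma>" "B \<in> Over F \<Gamma>" "Q \<in> Over F (src F \<Gamma> B)"
  shows "ftm (pb_fun S \<Gamma> f) B Q y = tpb (src F \<Gamma> B) (pr2 S \<Gamma> f B) Q y"
  using assms(2) pr2_hom[OF assms(1-3)] pr2_cmp[OF assms(1-4)]
  by (simp add: pb_fun_def tpb_def hom_iff Let_def)

abbreviation feq :: "'o \<Rightarrow> ('a, 'a, 'c, 'd, 'e, 'f) tfnct \<Rightarrow> ('a, 'a, 'c, 'd, 'e, 'f) tfnct \<Rightarrow> bool" where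
  "feq \<Gamma> G H \<equiv> tfun_eq (slice E \<Gamma>) G H"

lemma cat: "strict_category E"
  using Fam_category by (simp add: strict_category_def)

lemma pb_fun_idn: "\<Gamma> \<in> Ob F \<Longrightarrow> feq \<Gamma> (pb_fun S \<Gamma> (idn C \<Gamma>)) tid"
  by (rule tfun_eqI)
    (auto simp: pb_along_idn pr2_along_idn pb_fun_ftm[OF _ C_idn_hom] tpb_idn F.src_Ob)

lemma pb_fun_cmp:
  assumes "\<Gamma> \<in> Ob F" "g \<in> hom C \<Delta> \<Gamma>" "h \<in> hom C \<Theta> \<Delta>"
  shows "feq \<Gamma> (pb_fun S \<Gamma> (cmp C \<Gamma> g h)) (tcomp (pb_fun S \<Delta> h) (pb_fun S \<Gamma> g))"
proof -
  have h: "h \<in> Over C \<Delta>" using assms(3) by (simp add: hom_iff)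
  note \<Delta> = C_hom_Ob[OF assms(1,2)]
  show ?thesis
  proof (rule tfun_eqI, simp_all)
    fix B assume B: "B \<in> Over F \<Gamma>"
    then show pbB: "pb S \<Gamma> (cmp C \<Gamma> g h) B = pb S \<Delta> h (pb S \<Gamma> g B)"
      by (rule pb_along_cmp[OF assms(1,2) h])
    fix Q assume Q: "Q \<in> Over F (src F \<Gamma> B)"
    note gB = pb_Over[OF assms(1,2) B]
    note p = pr2_hom[OF assms(1,2) B] pr2_hom[OF \<Delta> assms(3) gB]
    have p2: "pr2 S \<Delta> h (pb S \<Gamma> g B) \<in> Over C (src F \<Delta> (pb S \<Gamma> g B))"
      using p(2) by (simp add: hom_iff)
    have obB: "src F \<Gamma> B \<in> Ob F" using B assms by (simp add: F.src_Ob)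
    show "pb S (src F \<Gamma> B) (pr2 S \<Gamma> (cmp C \<Gamma> g h) B) Q
      = pb S (src F \<Delta> (pb S \<Gamma> g B)) (pr2 S \<Delta> h (pb S \<Gamma> g B)) (pb S (src F \<Gamma> B) (pr2 S \<Gamma> g B) Q)"
      unfolding pr2_along_cmp[OF assms(1,2) h B] by (rule pb_along_cmp[OF obB p(1) p2 Q])
    fix y assume y: "y \<in> sections S (src F \<Gamma> B) Q"
    show "ftm (pb_fun S \<Gamma> (cmp C \<Gamma> g h)) B Q y
      = ftm (pb_fun S \<Delta> h) (pb S \<Gamma> g B) (pb S (src F \<Gamma> B) (pr2 S \<Gamma> g B) Q) (ftm (pb_fun S \<Gamma> g) B Q y)"
      by (simp add: pb_fun_ftm[OF assms(1) C_cmp_hom[OF assms] B Q] pb_fun_ftm[OF assms(1,2) B Q]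
          pb_fun_ftm[OF \<Delta> assms(3) gB pb_Over[OF obB p(1) Q]] pr2_along_cmp[OF assms(1,2) h B]
          tpb_cmp[OF obB p Q y])
  qed
qed

text \<open>By functoriality (d) the slice f^*/B is the pullback functor along \<pi>_2(f, B). With
  \<open>pb_fun_cmp\<close>, equations between composites of slices and substitutions thereby become
  equations between arrows of the second category.\<close>

lemma pb_fun_slice:
  assumes "\<Gamma> \<in> Ob F" "f \<in> hom C \<Delta> \<Gamma>" "B \<in> Over F \<Gamma>"
  shows "feq (src F \<Gamma> B) (slice_fun (slice E \<Gamma>) (pb_fun S \<Gamma> f) B) (pb_fun S (src F \<Gamma> B) (pr2 S \<Gamma> f B))"
proof -
  have B: "src F \<Gamma> B \<in> Ob F" using assms by (simp add: F.src_Ob)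
  note p = pr2_hom[OF assms]
  show ?thesis
    by (rule tfun_eqI)
      (use assms B in \<open>simp_all add: F_simps pr2_cmp[OF assms] pb_fun_ftm[OF assms(1,2)]
        pb_fun_ftm[OF B p]\<close>)
qed

lemma tfunctor_pb_fun:
  assumes "\<Gamma> \<in> Ob F" "f \<in> hom C \<Delta> \<Gamma>"
  shows "tfunctor (slice E \<Gamma>) (slice E \<Delta>) (pb_fun S \<Gamma> f)"
proof (unfold_locales, simp_all)
  note \<Delta> = C_hom_Ob[OF assms]
  fix B assume B: "B \<in> Over F \<Gamma>"
  note obB = F.src_Ob[OF assms(1) B] and p = pr2_hom[OF assms B]
  show "pb S \<Gamma> f B \<in> Over F \<Delta>" by (rule pb_Over[OF assms B])
  show "pb S (src F \<Gamma> B) (pr2 S \<Gamma> f B) (idn F (src F \<Gamma> B)) = idn F (src F \<Delta> (pb S \<Gamma> f B))"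
    by (rule pb_idn[OF obB p])
  fix Q assume Q: "Q \<in> Over F (src F \<Gamma> B)"
  show "pb S (src F \<Gamma> B) (pr2 S \<Gamma> f B) Q \<in> Over F (src F \<Delta> (pb S \<Gamma> f B))"
    by (rule pb_Over[OF obB p Q])
  show "cmp F \<Delta> (pb S \<Gamma> f B) (pb S (src F \<Gamma> B) (pr2 S \<Gamma> f B) Q) = pb S \<Gamma> f (cmp F \<Gamma> B Q)"
    by (rule pb_cmp[OF assms B Q, symmetric])
  show "ftm (pb_fun S \<Gamma> f) B Q x \<in> sections S (src F \<Delta> (pb S \<Gamma> f B)) (pb S (src F \<Gamma> B) (pr2 S \<Gamma> f B) Q)"
    if "x \<in> sections S (src F \<Gamma> B) Q" for x
    unfolding pb_fun_ftm[OF assms B Q] by (rule tpb_section[OF obB p Q that])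
  show "pb S (src F \<Gamma> B) (pr2 S \<Gamma> f B) (cmp F (src F \<Gamma> B) Q R)
    = cmp F (src F \<Delta> (pb S \<Gamma> f B)) (pb S (src F \<Gamma> B) (pr2 S \<Gamma> f B) Q)
       (pb S (src F \<Gamma> (cmp F \<Gamma> B Q)) (pr2 S \<Gamma> f (cmp F \<Gamma> B Q)) R)"
    if "R \<in> Over F (src F \<Gamma> (cmp F \<Gamma> B Q))" for R
    using pb_cmp[OF obB p Q, of R] that assms B Q by (simp add: F_simps pr2_cmp)
qed

lemma
  assumes "\<Gamma> \<in> Ob F" "A \<in> Over F \<Gamma>"
  shows idtm_section: "idtm E \<Gamma> A \<in> sections S (src F \<Gamma> A) (pb S \<Gamma> (Inc S \<Gamma> A) A)"
    and pr2_idtm: "cmp C (src F \<Gamma> A) (pr2 S \<Gamma> (Inc S \<Gamma> A) A) (idtm E \<Gamma> A) = idn C (src F \<Gamma> A)"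
proof -
  have A: "src F \<Gamma> A \<in> Ob F" using assms by (simp add: F.src_Ob)
  note I = Inc_hom[OF assms]
  from theI'[OF section_ex1[OF assms(1) I assms(2) C_idn_hom[OF A] C_idn_right[OF assms(1) I]]]
  show "idtm E \<Gamma> A \<in> sections S (src F \<Gamma> A) (pb S \<Gamma> (Inc S \<Gamma> A) A)"
    and "cmp C (src F \<Gamma> A) (pr2 S \<Gamma> (Inc S \<Gamma> A) A) (idtm E \<Gamma> A) = idn C (src F \<Gamma> A)"
    by (simp_all add: CE2E_ob_def)
qed

text \<open>Recovers g from the pulled back generic term. It is behind the law S_x(idtm) = x, the
  preservation of generic terms by pullback, and the computation of the counit.\<close>

lemma pr2_tpb_idtm:
  assumes "\<Gamma> \<in> Ob F" "B \<in> Over F \<Gamma>" "g \<in> hom C \<Delta> (src F \<Gamma> B)"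
  shows "cmp C (src F \<Gamma> B) (pr2 S \<Gamma> (cmp C \<Gamma> (Inc S \<Gamma> B) g) B)
    (tpb (src F \<Gamma> B) g (pb S \<Gamma> (Inc S \<Gamma> B) B) (idtm E \<Gamma> B)) = g"
proof -
  let ?B = "src F \<Gamma> B" and ?W = "pb S \<Gamma> (Inc S \<Gamma> B) B"
  have B: "?B \<in> Ob F" using assms by (simp add: F.src_Ob)
  note I = Inc_hom[OF assms(1,2)] and i = idtm_section[OF assms(1,2)]
  have W: "?W \<in> Over F ?B" by (rule pb_Over[OF assms(1) I assms(2)])
  have g: "g \<in> Over C ?B" using assms(3) by (simp add: hom_iff)
  note p = pr2_hom[OF assms(1) I assms(2)] and q = pr2_hom[OF B assms(3) W]
    and t = sections_hom[OF tpb_section[OF B assms(3) W i]]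
  show ?thesis
    using C_assoc[OF B p q t] pr2_tpb[OF B assms(3) W i] C_assoc[OF B p sections_hom[OF i] assms(3)]
      pr2_idtm[OF assms(1,2)] C_idn_left[OF B assms(3)]
    by (simp add: pr2_along_cmp[OF assms(1) I g assms(2)])
qed

text \<open>Both sides are sections of the pullback of P along the diagonal g I(g^*P) = I(P)
  \<pi>_2(g, P) of the chosen square. Their projections to \<Gamma>.P both equal \<pi>_2(g, P), so
  they coincide.\<close>

lemma tpb_idtm:
  assumes "\<Gamma> \<in> Ob F" "g \<in> hom C \<Delta> \<Gamma>" "P \<in> Over F \<Gamma>"
  shows "tpb (src F \<Gamma> P) (pr2 S \<Gamma> g P) (pb S \<Gamma> (Inc S \<Gamma> P) P) (idtm E \<Gamma> P) = idtm E \<Delta> (pb S \<Gamma> g P)"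
proof -
  let ?P = "src F \<Gamma> P" and ?W = "pb S \<Gamma> (Inc S \<Gamma> P) P" and ?gP = "pb S \<Gamma> g P"
  note \<Delta> = C_hom_Ob[OF assms(1,2)] and P = F.src_Ob[OF assms(1,3)]
  note gP = pb_Over[OF assms] and p = pr2_hom[OF assms]
  note I = Inc_hom[OF assms(1,3)] and i = idtm_section[OF assms(1,3)]
  note W = pb_Over[OF assms(1) I assms(3)]
  note J = Inc_hom[OF \<Delta> gP] and j = idtm_section[OF \<Delta> gP]
  note gJ = C_cmp_hom[OF assms(1,2) J]
  have Jo: "Inc S \<Delta> ?gP \<in> Over C \<Delta>" and po: "pr2 S \<Gamma> g P \<in> Over C ?P" using J p by (simp_all add: hom_iff)
  have eq: "cmp C \<Gamma> g (Inc S \<Delta> ?gP) = cmp C \<Gamma> (Inc S \<Gamma> P) (pr2 S \<Gamma> g P)"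
    by (simp add: Inc_pr2[OF assms])
  have t: "tpb ?P (pr2 S \<Gamma> g P) ?W (idtm E \<Gamma> P) \<in> sections S (src F \<Delta> ?gP) (pb S \<Gamma> (cmp C \<Gamma> g (Inc S \<Delta> ?gP)) P)"
    unfolding eq pb_along_cmp[OF assms(1) I po assms(3)] by (rule tpb_section[OF P p W i])
  have j': "idtm E \<Delta> ?gP \<in> sections S (src F \<Delta> ?gP) (pb S \<Gamma> (cmp C \<Gamma> g (Inc S \<Delta> ?gP)) P)"
    unfolding pb_along_cmp[OF assms(1,2) Jo assms(3)] by (rule j)
  show ?thesis
  proof (rule section_unique[OF assms(1) gJ assms(3) t j'])
    have "cmp C ?P (pr2 S \<Gamma> (cmp C \<Gamma> g (Inc S \<Delta> ?gP)) P) (idtm E \<Delta> ?gP) = pr2 S \<Gamma> g P"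
      using C_assoc[OF P p pr2_hom[OF \<Delta> J gP] sections_hom[OF j]] pr2_idtm[OF \<Delta> gP] C_idn_right[OF P p]
      by (simp add: pr2_along_cmp[OF assms(1,2) Jo assms(3)])
    then show "cmp C ?P (pr2 S \<Gamma> (cmp C \<Gamma> g (Inc S \<Delta> ?gP)) P) (tpb ?P (pr2 S \<Gamma> g P) ?W (idtm E \<Gamma> P))
      = cmp C ?P (pr2 S \<Gamma> (cmp C \<Gamma> g (Inc S \<Delta> ?gP)) P) (idtm E \<Delta> ?gP)"
      using pr2_tpb_idtm[OF assms(1,3) p] by (simp add: eq)
  qed
qed

text \<open>As pullback is functorial in the arrow, compatibility with S_x is the square that
  characterises the pulled back section, compatibility with W_P is the chosen pullback square, and
  the generic terms are \<open>tpb_idtm\<close>.\<close>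

lemma pre_E_hom_pb_fun:
  assumes "\<Gamma> \<in> Ob F" "f \<in> hom C \<Delta> \<Gamma>"
  shows "pre_E_hom (slice E \<Gamma>) (slice E \<Delta>) (pb_fun S \<Gamma> f)"
proof (rule pre_E_hom.intro[OF tfunctor_pb_fun[OF assms]], unfold_locales)
  note \<Delta> = C_hom_Ob[OF assms]
  show "fob (pb_fun S \<Gamma> f) (root (slice E \<Gamma>)) = root (slice E \<Delta>)"
    using pb_idn[OF assms] by simp
  {
    fix A P
    assume "A \<in> Ob (slice E \<Gamma>)" "P \<in> Over (slice E \<Gamma>) A"
    then have A: "A \<in> Over F \<Gamma>" and P: "P \<in> Over F (src F \<Gamma> A)" by simp_all
    let ?A = "src F \<Gamma> A" and ?f = "pr2 S \<Gamma> f A" and ?\<Delta> = "src F \<Delta> (pb S \<Gamma> f A)"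
    note obA = F.src_Ob[OF assms(1) A] and p = pr2_hom[OF assms A]
    let ?P = "src F ?A P" and ?f' = "pr2 S ?A ?f P"
    note obP = F.src_Ob[OF obA P] and p' = pr2_hom[OF obA p P]
    have AP: "cmp F \<Gamma> A P \<in> Over F \<Gamma>" "src F \<Gamma> (cmp F \<Gamma> A P) = ?P" "pr2 S \<Gamma> f (cmp F \<Gamma> A P) = ?f'"
      using assms A P by (simp_all add: F_simps pr2_cmp)
    have sl: "feq ?A (slice_fun (slice E \<Gamma>) (pb_fun S \<Gamma> f) A) (pb_fun S ?A ?f)"
      "feq ?P (slice_fun (slice E \<Gamma>) (pb_fun S \<Gamma> f) (cmp F \<Gamma> A P)) (pb_fun S ?P ?f')"
      using pb_fun_slice[OF assms A] pb_fun_slice[OF assms AP(1)] AP by simp_all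
    note fA = pb_Over[OF assms A] and fP = pb_Over[OF obA p P]
    note ob\<Delta> = F.src_Ob[OF \<Delta> fA]
    {
      fix x
      assume "x \<in> Tm (slice E \<Gamma>) A P"
      then have x: "x \<in> sections S ?A P" by simp
      note t = tpb_section[OF obA p P x]
      have "feq ?P (tcomp (slice_fun (slice E \<Gamma>) (pb_fun S \<Gamma> f) A) (pb_fun S ?P x))
        (tcomp (pb_fun S ?A ?f) (pb_fun S ?P x))"
        by (rule tcomp_cong_left[OF tfunctor_pb_fun[OF obP sections_hom[OF x]] sl(1)])
      also have "feq ?P \<dots> (pb_fun S ?P (cmp C ?P x ?f))"
        by (rule tfun_eq_sym[OF pb_fun_cmp[OF obP sections_hom[OF x] p]])
      also have "cmp C ?P x ?f = cmp C ?P ?f' (tpb ?A ?f P x)"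
        by (rule pr2_tpb[OF obA p P x, symmetric])
      also have "feq ?P (pb_fun S ?P \<dots>) (tcomp (pb_fun S (src F ?\<Delta> (pb S ?A ?f P)) (tpb ?A ?f P x)) (pb_fun S ?P ?f'))"
        by (rule pb_fun_cmp[OF obP p' sections_hom[OF t]])
      also have "feq ?P \<dots> (tcomp (pb_fun S (src F ?\<Delta> (pb S ?A ?f P)) (tpb ?A ?f P x))
          (slice_fun (slice E \<Gamma>) (pb_fun S \<Gamma> f) (cmp F \<Gamma> A P)))"
        by (rule tcomp_cong_right[OF tfun_eq_sym[OF sl(2)]])
      finally show "tfun_eq (slice (slice E \<Gamma>) (src (slice E \<Gamma>) A P))
        (tcomp (slice_fun (slice E \<Gamma>) (pb_fun S \<Gamma> f) A) (Sub (slice E \<Gamma>) A P x))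
        (tcomp (Sub (slice E \<Delta>) (fob (pb_fun S \<Gamma> f) A) (far (pb_fun S \<Gamma> f) A P) (ftm (pb_fun S \<Gamma> f) A P x))
          (slice_fun (slice E \<Gamma>) (pb_fun S \<Gamma> f) (src (slice E \<Gamma>) A P)))"
        using assms(1) AP A P by (simp add: tfun_eq_slice_slice[OF cat] pb_fun_ftm[OF assms A P])
    }
    note I = Inc_hom[OF obA P] and J = Inc_hom[OF ob\<Delta> fP]
    have "feq ?A (tcomp (slice_fun (slice E \<Gamma>) (pb_fun S \<Gamma> f) (cmp F \<Gamma> A P)) (pb_fun S ?A (Inc S ?A P)))
      (tcomp (pb_fun S ?P ?f') (pb_fun S ?A (Inc S ?A P)))"
      by (rule tcomp_cong_left[OF tfunctor_pb_fun[OF obA I] sl(2)])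
    also have "feq ?A \<dots> (pb_fun S ?A (cmp C ?A (Inc S ?A P) ?f'))"
      by (rule tfun_eq_sym[OF pb_fun_cmp[OF obA I p']])
    also have "cmp C ?A (Inc S ?A P) ?f' = cmp C ?A ?f (Inc S ?\<Delta> (pb S ?A ?f P))"
      by (rule Inc_pr2[OF obA p P])
    also have "feq ?A (pb_fun S ?A \<dots>) (tcomp (pb_fun S ?\<Delta> (Inc S ?\<Delta> (pb S ?A ?f P))) (pb_fun S ?A ?f))"
      by (rule pb_fun_cmp[OF obA p J])
    also have "feq ?A \<dots> (tcomp (pb_fun S ?\<Delta> (Inc S ?\<Delta> (pb S ?A ?f P))) (slice_fun (slice E \<Gamma>) (pb_fun S \<Gamma> f) A))"
      by (rule tcomp_cong_right[OF tfun_eq_sym[OF sl(1)]])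
    finally show "tfun_eq (slice (slice E \<Gamma>) A)
        (tcomp (slice_fun (slice E \<Gamma>) (pb_fun S \<Gamma> f) (src (slice E \<Gamma>) A P)) (Wk (slice E \<Gamma>) A P))
        (tcomp (Wk (slice E \<Delta>) (fob (pb_fun S \<Gamma> f) A) (far (pb_fun S \<Gamma> f) A P)) (slice_fun (slice E \<Gamma>) (pb_fun S \<Gamma> f) A))"
      using assms(1) AP A P by (simp add: tfun_eq_slice_slice[OF cat])
    have W: "pb S ?A (Inc S ?A P) P \<in> Over F (src F \<Gamma> (cmp F \<Gamma> A P))"
      using pb_Over[OF obA I P] by (simp add: AP)
    show "ftm (pb_fun S \<Gamma> f) (src (slice E \<Gamma>) A P) (fob (Wk (slice E \<Gamma>) A P) P) (idtm (slice E \<Gamma>) A P)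
        = idtm (slice E \<Delta>) (fob (pb_fun S \<Gamma> f) A) (far (pb_fun S \<Gamma> f) A P)"
      using tpb_idtm[OF obA p P] pb_fun_ftm[OF assms AP(1) W] by (simp add: AP)
  }
qed

text \<open>The cancellation laws are equations between arrows: I(A) x = id gives
  \<open>Sub_Wk\<close>, and \<pi>_2(I(A), A) composed with the generic section is the identity,
  which gives \<open>Sub_by_idtm\<close>.\<close>

lemma E_system_CE2E: "E_system E"
proof (intro E_system.intro E_system_axioms.intro pre_E_system.intro pre_E_system_axioms.intro cat)
  show "terminal E (root E)"
    using terminal_one by (simp add: terminal_def hom_def)
next
  fix \<Gamma> A x
  assume "\<Gamma> \<in> Ob E" "A \<in> Over E \<Gamma>" "x \<in> Tm E \<Gamma> A"
  then have \<Gamma>: "\<Gamma> \<in> Ob F" and A: "A \<in> Over F \<Gamma>" and x: "x \<in> sections S \<Gamma> A" by simp_all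
  note obA = F.src_Ob[OF \<Gamma> A] and h = sections_hom[OF x] and I = Inc_hom[OF \<Gamma> A]
  show "tfunctor (slice E (src E \<Gamma> A)) (slice E \<Gamma>) (Sub E \<Gamma> A x)"
    using tfunctor_pb_fun[OF obA h] by simp
  show "pre_E_hom (slice E (src E \<Gamma> A)) (slice E \<Gamma>) (Sub E \<Gamma> A x)"
    using pre_E_hom_pb_fun[OF obA h] by simp
  show "fob (Sub E \<Gamma> A x) (idn E (src E \<Gamma> A)) = idn E \<Gamma>"
    using pb_idn[OF obA h] by simp
  have "feq \<Gamma> (tcomp (pb_fun S (src F \<Gamma> A) x) (pb_fun S \<Gamma> (Inc S \<Gamma> A))) (pb_fun S \<Gamma> (idn C \<Gamma>))"
    using tfun_eq_sym[OF pb_fun_cmp[OF \<Gamma> I h]] by (simp add: sections_cmp[OF x])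
  then show "tfun_eq (slice E \<Gamma>) (tcomp (Sub E \<Gamma> A x) (Wk E \<Gamma> A)) tid"
    using tfun_eq_trans[OF _ pb_fun_idn[OF \<Gamma>]] by simp
  have W: "pb S \<Gamma> (Inc S \<Gamma> A) A \<in> Over F (src F \<Gamma> A)" by (rule pb_Over[OF \<Gamma> I A])
  have i: "idn F (src F \<Gamma> A) \<in> Over F (src F \<Gamma> A)" by (rule F.idn_Over[OF obA])
  \<comment> \<open>This is \<open>pr2_tpb_idtm\<close> for g = x: as I(A) x is the identity, the
    projection in front of the pulled back term is an identity as well.\<close>
  have t: "tpb (src F \<Gamma> A) x (pb S \<Gamma> (Inc S \<Gamma> A) A) (idtm E \<Gamma> A) = x"
    using pr2_tpb_idtm[OF \<Gamma> A h] sections_cmp[OF x] C_idn_left[OF obA]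
      sections_hom[OF tpb_section[OF obA h W idtm_section[OF \<Gamma> A]]]
      pb_along_cmp[OF \<Gamma> I _ A, of x, symmetric] h \<Gamma> A
    by (simp add: pr2_along_idn pb_along_idn hom_iff)
  then show "ftm (Sub E \<Gamma> A x) (idn E (src E \<Gamma> A)) (fob (Wk E \<Gamma> A) A) (idtm E \<Gamma> A) = x"
    using pb_fun_ftm[OF obA h i, of "pb S \<Gamma> (Inc S \<Gamma> A) A"] W obA by (simp add: F_simps pr2_idn[OF obA h])
next
  fix \<Gamma> A
  assume "\<Gamma> \<in> Ob E" "A \<in> Over E \<Gamma>"
  then have \<Gamma>: "\<Gamma> \<in> Ob F" and A: "A \<in> Over F \<Gamma>" by simp_all
  note obA = F.src_Ob[OF \<Gamma> A] and I = Inc_hom[OF \<Gamma> A] and i = idtm_section[OF \<Gamma> A]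
  show "tfunctor (slice E \<Gamma>) (slice E (src E \<Gamma> A)) (Wk E \<Gamma> A)"
    using tfunctor_pb_fun[OF \<Gamma> I] by simp
  show "pre_E_hom (slice E \<Gamma>) (slice E (src E \<Gamma> A)) (Wk E \<Gamma> A)"
    using pre_E_hom_pb_fun[OF \<Gamma> I] by simp
  show "fob (Wk E \<Gamma> A) (idn E \<Gamma>) = idn E (src E \<Gamma> A)"
    using pb_idn[OF \<Gamma> I] by simp
  show "idtm E \<Gamma> A \<in> Tm E (src E \<Gamma> A) (fob (Wk E \<Gamma> A) A)"
    using i by simp
  show "tfun_eq (slice E \<Gamma>) (Wk E \<Gamma> (cmp E \<Gamma> A P)) (tcomp (Wk E (src E \<Gamma> A) P) (Wk E \<Gamma> A))"
    if "P \<in> Over E (src E \<Gamma> A)" for P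
    using pb_fun_cmp[OF \<Gamma> I Inc_hom[OF obA], of P] that by (simp add: Inc_cmp[OF \<Gamma> A])
  let ?p = "pr2 S \<Gamma> (Inc S \<Gamma> A) A" and ?W = "pb S \<Gamma> (Inc S \<Gamma> A) A"
  note p = pr2_hom[OF \<Gamma> I A]
  note obW = F.src_Ob[OF obA pb_Over[OF \<Gamma> I A]]
  have "feq (src F \<Gamma> A) (tcomp (pb_fun S (src F (src F \<Gamma> A) ?W) (idtm E \<Gamma> A))
      (slice_fun (slice E \<Gamma>) (pb_fun S \<Gamma> (Inc S \<Gamma> A)) A))
    (tcomp (pb_fun S (src F (src F \<Gamma> A) ?W) (idtm E \<Gamma> A)) (pb_fun S (src F \<Gamma> A) ?p))"
    by (rule tcomp_cong_right[OF pb_fun_slice[OF \<Gamma> I A]])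
  also have "feq (src F \<Gamma> A) \<dots> (pb_fun S (src F \<Gamma> A) (cmp C (src F \<Gamma> A) ?p (idtm E \<Gamma> A)))"
    by (rule tfun_eq_sym[OF pb_fun_cmp[OF obA p sections_hom[OF i]]])
  also have "feq (src F \<Gamma> A) \<dots> tid"
    unfolding pr2_idtm[OF \<Gamma> A] by (rule pb_fun_idn[OF obA])
  finally show "tfun_eq (slice E (src E \<Gamma> A))
      (tcomp (Sub E (src E \<Gamma> A) (fob (Wk E \<Gamma> A) A) (idtm E \<Gamma> A)) (slice_fun (slice E \<Gamma>) (Wk E \<Gamma> A) A)) tid"
    by simp
next
  fix \<Gamma>
  assume "\<Gamma> \<in> Ob E"
  then show "tfun_eq (slice E \<Gamma>) (Wk E \<Gamma> (idn E \<Gamma>)) tid"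
    by (simp add: Inc_idn pb_fun_idn)
qed

end

section \<open>The categories of E-systems and of CE-systems\<close>

lemma tfun_eq_trestr: "tfun_eq C (trestr C F) F"
  by (simp add: tfun_eq_def trestr_def)

lemma trestr_eq_iff: "trestr C F = trestr C G \<longleftrightarrow> tfun_eq C F G"
proof
  assume "trestr C F = trestr C G"
  then show "tfun_eq C F G"
    using tfun_eq_trestr[of C F] tfun_eq_trestr[of C G] by (simp add: tfun_eq_def)
next
  assume "tfun_eq C F G"
  then show "trestr C F = trestr C G"
    by (auto simp: tfun_eq_def trestr_def restrict_def fun_eq_iff)
qed

lemma trestr_trestr: "trestr C (trestr C F) = trestr C F"
  by (simp add: trestr_eq_iff tfun_eq_trestr)

definition fun_eq :: "('o, 'a, 'z) cat_scheme \<Rightarrow> ('o, 'a, 'p, 'b) fnct \<Rightarrow> ('o, 'a, 'p, 'b) fnct \<Rightarrow> bool" where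
  "fun_eq C F G \<longleftrightarrow>
    (\<forall>\<Gamma> \<in> Ob C. fob F \<Gamma> = fob G \<Gamma> \<and> (\<forall>A \<in> Over C \<Gamma>. far F \<Gamma> A = far G \<Gamma> A))"

lemma fun_eq_sym: "fun_eq C F G \<Longrightarrow> fun_eq C G F"
  by (simp add: fun_eq_def)

lemma fun_eq_frestr: "fun_eq C (frestr C F) F"
  by (simp add: fun_eq_def frestr_def)

lemma frestr_eq_iff: "frestr C F = frestr C G \<longleftrightarrow> fun_eq C F G"
proof
  assume "frestr C F = frestr C G"
  then show "fun_eq C F G"
    using fun_eq_frestr[of C F] fun_eq_frestr[of C G] by (simp add: fun_eq_def)
next
  assume "fun_eq C F G"
  then show "frestr C F = frestr C G"
    by (auto simp: fun_eq_def frestr_def restrict_def fun_eq_iff)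
qed

lemma frestr_frestr: "frestr C (frestr C F) = frestr C F"
  by (simp add: frestr_eq_iff fun_eq_frestr)

lemma fcomp_simps [simp]:
  "fob (fcomp G F) = (\<lambda>\<Gamma>. fob G (fob F \<Gamma>))"
  "far (fcomp G F) = (\<lambda>\<Gamma> A. far G (fob F \<Gamma>) (far F \<Gamma> A))"
  "fob fid = (\<lambda>\<Gamma>. \<Gamma>)" "far fid = (\<lambda>\<Gamma> A. A)"
  by (simp_all add: fcomp_def fid_def)

lemma fcomp_cong:
  assumes "strict_functor C D F" and "fun_eq C F F'" and "fun_eq D G G'"
  shows "fun_eq C (fcomp G F) (fcomp G' F')"
proof -
  interpret strict_functor C D F by fact
  show ?thesis
    using assms(2,3) fob_Ob far_Over by (auto simp: fun_eq_def)
qed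

lemma strict_functor_cong:
  assumes "strict_category C" and "strict_functor C D F" and "fun_eq C F G"
  shows "strict_functor C D G"
proof -
  interpret strict_category C by fact
  interpret strict_functor C D F by fact
  have "fob G \<Gamma> = fob F \<Gamma>" "A \<in> Over C \<Gamma> \<Longrightarrow> far G \<Gamma> A = far F \<Gamma> A" if "\<Gamma> \<in> Ob C" for \<Gamma> A
    using assms(3) that by (auto simp: fun_eq_def)
  then show ?thesis
    by unfold_locales
      (auto simp: fob_Ob far_Over src_far far_idn far_cmp src_Ob idn_Over cmp_Over)
qed

lemma strict_functor_fcomp:
  assumes "strict_category C" and "strict_functor C D F" and "strict_functor D B G"
  shows "strict_functor C B (fcomp G F)"
proof -
  interpret strict_category C by fact
  interpret F: strict_functor C D F by fact
  interpret G: strict_functor D B G by fact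
  show ?thesis
    by unfold_locales
      (auto simp: src_Ob F.fob_Ob F.far_Over F.src_far F.far_idn F.far_cmp
        G.fob_Ob G.far_Over G.src_far G.far_idn G.far_cmp)
qed

lemma pre_E_hom_tid: "pre_E_hom E E tid"
  by unfold_locales simp_all

lemma Esys_simps [simp]:
  "Ob Esys = {E. E_system E}"
  "Over Esys = (\<lambda>D. {(E, H). E_system E \<and> pre_E_hom E D H \<and> trestr E H = H})"
  "src Esys = (\<lambda>D (E, H). E)"
  "idn Esys = (\<lambda>E. (E, trestr E tid))"
  "cmp Esys = (\<lambda>D (E, H) (E', K). (E', trestr E' (tcomp H K)))"
  by (simp_all add: Esys_def)

lemma E_system_pre: "E_system E \<Longrightarrow> pre_E_system E"
  by (rule E_system.axioms(1))

lemma pre_E_hom_trestr: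
  "\<lbrakk>E_system E; E_system D; pre_E_hom E D H\<rbrakk> \<Longrightarrow> pre_E_hom E D (trestr E H)"
  by (rule pre_E_hom_cong[OF E_system_pre E_system_pre _ tfun_eq_sym[OF tfun_eq_trestr]])

lemma trestr_tcomp_trestr_left:
  assumes "tfunctor C D K"
  shows "trestr C (tcomp (trestr D H) K) = trestr C (tcomp H K)"
  unfolding trestr_eq_iff by (rule tcomp_cong_left[OF assms tfun_eq_trestr])

lemma trestr_tcomp_trestr_right: "trestr C (tcomp H (trestr C K)) = trestr C (tcomp H K)"
  unfolding trestr_eq_iff by (rule tcomp_cong_right[OF tfun_eq_trestr])

lemma strict_category_Esys: "strict_category Esys"
proof (unfold_locales, goal_cases)
  \<comment> \<open>Goal 4 is closure under composition; goals 6, 7 and 8 are the unit laws and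
    associativity. Restrictions inside a composite are absorbed by the outer one, which leaves the
    same laws for \<open>tcomp\<close>.\<close>
  case (4 D f g)
  then show ?case
    by (auto simp: trestr_trestr intro!: pre_E_hom_trestr pre_E_hom_tcomp E_system_pre)
next
  case (6 D f)
  then show ?case
    by (auto simp: trestr_tcomp_trestr_left[OF pre_E_hom.axioms(1)])
next
  case (7 D f)
  then show ?case
    by (auto simp: trestr_tcomp_trestr_right)
next
  case (8 D f g h)
  then show ?case
    by (auto simp: trestr_tcomp_trestr_left[OF pre_E_hom.axioms(1)] trestr_tcomp_trestr_right tcomp_assoc)
qed (auto simp: trestr_trestr intro!: pre_E_hom_trestr pre_E_hom_tid)

section \<open>Composition of CE-homomorphisms and their category\<close>

lemma CE_hom_cong:
  assumes "CE_system S" and "CE_hom S S' FF FC" and FF: "fun_eq (Fam S) FF GF" and FC: "fun_eq (Con S) FC GC"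
  shows "CE_hom S S' GF GC"
proof -
  interpret S: CE_system S by fact
  interpret CE_hom S S' FF FC by fact
  have F: "fob GF \<Gamma> = fob FF \<Gamma>" "A \<in> Over (Fam S) \<Gamma> \<Longrightarrow> far GF \<Gamma> A = far FF \<Gamma> A"
    if "\<Gamma> \<in> Ob (Fam S)" for \<Gamma> A
    using FF that by (auto simp: fun_eq_def)
  have C: "fob GC \<Gamma> = fob FC \<Gamma>" "f \<in> hom (Con S) \<Delta> \<Gamma> \<Longrightarrow> far GC \<Gamma> f = far FC \<Gamma> f"
    if "\<Gamma> \<in> Ob (Fam S)" for \<Gamma> \<Delta> f
    using FC that S.same_Ob by (auto simp: fun_eq_def hom_iff)
  show ?thesis
  proof (rule CE_hom.intro)
    show "strict_functor (Fam S) (Fam S') GF" "strict_functor (Con S) (Con S') GC"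
      by (rule strict_functor_cong[OF S.Fam_category functor_Fam FF],
          rule strict_functor_cong[OF S.Con_category functor_Con FC])
    show "fob GF (one S) = one S'"
      using S.terminal_one hom_one by (simp add: F terminal_def)
  next
    fix \<Gamma> assume \<Gamma>: "\<Gamma> \<in> Ob (Fam S)"
    then show "fob GC \<Gamma> = fob GF \<Gamma>" by (simp add: F C commute_Ob)
    fix A assume A: "A \<in> Over (Fam S) \<Gamma>"
    with \<Gamma> show "far GC \<Gamma> (Inc S \<Gamma> A) = Inc S' (fob GF \<Gamma>) (far GF \<Gamma> A)"
      by (simp add: F C(2)[OF _ S.Inc_hom] commute_Inc)
    fix f \<Delta> assume f: "f \<in> hom (Con S) \<Delta> \<Gamma>"
    note * = S.C_hom_Ob[OF \<Gamma> f] S.pb_Over[OF \<Gamma> f A] S.F.src_Ob[OF \<Gamma> A] S.pr2_hom[OF \<Gamma> f A]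
    show "far GF \<Delta> (pb S \<Gamma> f A) = pb S' (fob GF \<Gamma>) (far GC \<Gamma> f) (far GF \<Gamma> A)"
      using hom_pb[OF \<Gamma> f A] \<Gamma> A by (simp add: F C(2)[OF \<Gamma> f] *)
    show "far GC (src (Fam S) \<Gamma> A) (pr2 S \<Gamma> f A) = pr2 S' (fob GF \<Gamma>) (far GC \<Gamma> f) (far GF \<Gamma> A)"
      using hom_pr2[OF \<Gamma> f A] \<Gamma> A by (simp add: F C(2)[OF \<Gamma> f] C(2)[OF *(3,4)])
  qed
qed

lemma (in CE_hom) FF_Ob: "\<Gamma> \<in> Ob (Fam S) \<Longrightarrow> fob FF \<Gamma> \<in> Ob (Fam S')"
  and FF_Over: "\<lbrakk>\<Gamma> \<in> Ob (Fam S); A \<in> Over (Fam S) \<Gamma>\<rbrakk> \<Longrightarrow> far FF \<Gamma> A \<in> Over (Fam S') (fob FF \<Gamma>)"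
  and FF_src: "\<lbrakk>\<Gamma> \<in> Ob (Fam S); A \<in> Over (Fam S) \<Gamma>\<rbrakk>
    \<Longrightarrow> src (Fam S') (fob FF \<Gamma>) (far FF \<Gamma> A) = fob FF (src (Fam S) \<Gamma> A)"
  using strict_functor.fob_Ob[OF functor_Fam] strict_functor.far_Over[OF functor_Fam]
    strict_functor.src_far[OF functor_Fam] by auto

lemma CE_hom_FC_hom:
  assumes "CE_system S" and "CE_hom S S' FF FC" and "\<Gamma> \<in> Ob (Fam S)" and "f \<in> hom (Con S) \<Delta> \<Gamma>"
  shows "far FC \<Gamma> f \<in> hom (Con S') (fob FF \<Delta>) (fob FF \<Gamma>)"
proof -
  interpret S: CE_system S by fact
  interpret CE_hom S S' FF FC by fact
  interpret FC: strict_functor "Con S" "Con S'" FC by (rule functor_Con)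
  show ?thesis
    using assms(3,4) S.same_Ob S.C_hom_Ob[OF assms(3,4)] commute_Ob[of \<Gamma>] commute_Ob[of \<Delta>]
      FC.far_Over[of \<Gamma> f] FC.src_far[of \<Gamma> f] by (auto simp: hom_iff)
qed

lemma CE_hom_fcomp:
  assumes "CE_system S" and "CE_hom S S' FF FC" and "CE_hom S' S'' GF GC"
  shows "CE_hom S S'' (fcomp GF FF) (fcomp GC FC)"
proof -
  interpret S: CE_system S by fact
  interpret F: CE_hom S S' FF FC by fact
  interpret G: CE_hom S' S'' GF GC by fact
  note FC = CE_hom_FC_hom[OF assms(1,2)]
  show ?thesis
  proof (rule CE_hom.intro)
    show "strict_functor (Fam S) (Fam S'') (fcomp GF FF)" "strict_functor (Con S) (Con S'') (fcomp GC FC)"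
      by (rule strict_functor_fcomp[OF S.Fam_category F.functor_Fam G.functor_Fam],
          rule strict_functor_fcomp[OF S.Con_category F.functor_Con G.functor_Con])
    show "fob (fcomp GF FF) (one S) = one S''"
      by (simp add: F.hom_one G.hom_one)
  next
    fix \<Gamma> assume \<Gamma>: "\<Gamma> \<in> Ob (Fam S)"
    then show "fob (fcomp GC FC) \<Gamma> = fob (fcomp GF FF) \<Gamma>" by (simp add: F.commute_Ob G.commute_Ob F.FF_Ob)
    fix A assume A: "A \<in> Over (Fam S) \<Gamma>"
    with \<Gamma> show "far (fcomp GC FC) \<Gamma> (Inc S \<Gamma> A) = Inc S'' (fob (fcomp GF FF) \<Gamma>) (far (fcomp GF FF) \<Gamma> A)"
      by (simp add: F.commute_Inc G.commute_Inc F.commute_Ob F.FF_Ob F.FF_Over)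
    fix f \<Delta> assume f: "f \<in> hom (Con S) \<Delta> \<Gamma>"
    note * = S.C_hom_Ob[OF \<Gamma> f] S.F.src_Ob[OF \<Gamma> A]
    show "far (fcomp GF FF) \<Delta> (pb S \<Gamma> f A)
        = pb S'' (fob (fcomp GF FF) \<Gamma>) (far (fcomp GC FC) \<Gamma> f) (far (fcomp GF FF) \<Gamma> A)"
      using F.hom_pb[OF \<Gamma> f A] G.hom_pb[OF F.FF_Ob[OF \<Gamma>] FC[OF \<Gamma> f] F.FF_Over[OF \<Gamma> A]] \<Gamma>
      by (simp add: F.commute_Ob)
    show "far (fcomp GC FC) (src (Fam S) \<Gamma> A) (pr2 S \<Gamma> f A)
        = pr2 S'' (fob (fcomp GF FF) \<Gamma>) (far (fcomp GC FC) \<Gamma> f) (far (fcomp GF FF) \<Gamma> A)"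
      using F.hom_pr2[OF \<Gamma> f A] G.hom_pr2[OF F.FF_Ob[OF \<Gamma>] FC[OF \<Gamma> f] F.FF_Over[OF \<Gamma> A]] \<Gamma> A *
      by (simp add: F.commute_Ob F.FF_src)
  qed
qed

lemma CE_hom_fid: "CE_hom S S fid fid"
  by (rule CE_hom.intro) (auto intro!: strict_functor.intro)

lemma CEsys_simps [simp]:
  "Ob CEsys = {S. CE_system S}"
  "Over CEsys = (\<lambda>S'. {(S, FF, FC). CE_system S \<and> CE_hom S S' FF FC \<and>
       frestr (Fam S) FF = FF \<and> frestr (Con S) FC = FC})"
  "src CEsys = (\<lambda>S' (S, FF, FC). S)"
  "idn CEsys = (\<lambda>S. (S, frestr (Fam S) fid, frestr (Con S) fid))"
  "cmp CEsys = (\<lambda>S'' (S', GF, GC) (S, FF, FC).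
       (S, frestr (Fam S) (fcomp GF FF), frestr (Con S) (fcomp GC FC)))"
  by (simp_all add: CEsys_def)

lemma CE_hom_frestr:
  assumes "CE_system S" and "CE_hom S S' FF FC"
  shows "CE_hom S S' (frestr (Fam S) FF) (frestr (Con S) FC)"
  by (rule CE_hom_cong[OF assms fun_eq_sym[OF fun_eq_frestr] fun_eq_sym[OF fun_eq_frestr]])

lemma frestr_fcomp_frestr_left:
  assumes "strict_functor C D K"
  shows "frestr C (fcomp (frestr D H) K) = frestr C (fcomp H K)"
  unfolding frestr_eq_iff by (rule fcomp_cong[OF assms _ fun_eq_frestr]) (simp add: fun_eq_def)

lemma frestr_fcomp_frestr_right: "frestr C (fcomp H (frestr C K)) = frestr C (fcomp H K)"
  unfolding frestr_eq_iff by (simp add: fun_eq_def frestr_def)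

lemma fcomp_fid [simp]: "fcomp F fid = F" "fcomp fid F = F"
  by (simp_all add: fcomp_def)

lemma fcomp_assoc: "fcomp (fcomp F G) H = fcomp F (fcomp G H)"
  by (simp add: fcomp_def)

lemma strict_category_CEsys: "strict_category CEsys"
proof (unfold_locales, goal_cases)
  case (4 D f g)
  then show ?case
    by (auto simp: frestr_frestr intro!: CE_hom_frestr CE_hom_fcomp)
next
  case (6 D f)
  then show ?case
    by (auto simp: frestr_fcomp_frestr_left[OF CE_hom.functor_Fam] frestr_fcomp_frestr_left[OF CE_hom.functor_Con])
next
  case (7 D f)
  then show ?case
    by (auto simp: frestr_fcomp_frestr_right)
next
  case (8 D f g h)
  then show ?case
    by (auto simp: frestr_fcomp_frestr_left[OF CE_hom.functor_Fam] frestr_fcomp_frestr_left[OF CE_hom.functor_Con]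
        frestr_fcomp_frestr_right fcomp_assoc)
qed (auto simp: frestr_frestr intro!: CE_hom_frestr CE_hom_fid)

section \<open>The functor from CE-systems to E-systems\<close>

lemma CE_hom_far_cmp:
  assumes "CE_system S" and "CE_hom S S' FF FC"
    and "\<Gamma> \<in> Ob (Fam S)" "f \<in> hom (Con S) \<Delta> \<Gamma>" "h \<in> hom (Con S) \<Theta> \<Delta>"
  shows "far FC \<Gamma> (cmp (Con S) \<Gamma> f h) = cmp (Con S') (fob FF \<Gamma>) (far FC \<Gamma> f) (far FC \<Delta> h)"
proof -
  interpret S: CE_system S by fact
  interpret H: CE_hom S S' FF FC by fact
  show ?thesis
    using strict_functor.far_cmp[OF H.functor_Con, of \<Gamma> f h] assms(3-) S.same_Ob H.commute_Ob[of \<Gamma>]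
    by (auto simp: hom_iff)
qed

lemma CE_hom_far_idn:
  assumes "CE_system S" and "CE_hom S S' FF FC" and "\<Gamma> \<in> Ob (Fam S)"
  shows "far FC \<Gamma> (idn (Con S) \<Gamma>) = idn (Con S') (fob FF \<Gamma>)"
proof -
  interpret S: CE_system S by fact
  interpret H: CE_hom S S' FF FC by fact
  show ?thesis
    using strict_functor.far_idn[OF H.functor_Con, of \<Gamma>] assms(3) S.same_Ob H.commute_Ob[of \<Gamma>] by simp
qed

lemma CE_hom_sections:
  assumes "CE_system S" and "CE_hom S S' FF FC"
    and "\<Gamma> \<in> Ob (Fam S)" "Q \<in> Over (Fam S) \<Gamma>" "y \<in> sections S \<Gamma> Q"
  shows "far FC (src (Fam S) \<Gamma> Q) y \<in> sections S' (fob FF \<Gamma>) (far FF \<Gamma> Q)"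
proof -
  interpret S: CE_system S by fact
  interpret H: CE_hom S S' FF FC by fact
  note y = S.sections_hom[OF assms(5)]
  show ?thesis
    using CE_hom_FC_hom[OF assms(1,2) S.F.src_Ob[OF assms(3,4)] y]
      CE_hom_far_cmp[OF assms(1-3) S.Inc_hom[OF assms(3,4)] y]
      S.sections_cmp[OF assms(5)] CE_hom_far_idn[OF assms(1-3)] assms(3,4)
    by (simp add: sections_def H.FF_src H.commute_Inc)
qed

text \<open>A CE-homomorphism preserves chosen pullbacks and projections, so the image of a pulled
  back section satisfies the equations that characterise the pulled back section of the
  image.\<close>

lemma CE_hom_tpb:
  assumes "CE_system S" and "CE_system S'" and "CE_hom S S' FF FC"
    and \<Gamma>: "\<Gamma> \<in> Ob (Fam S)" and g: "g \<in> hom (Con S) \<Delta> \<Gamma>" and Q: "Q \<in> Over (Fam S) \<Gamma>"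
    and y: "y \<in> sections S \<Gamma> Q"
  shows "far FC (src (Fam S) \<Delta> (pb S \<Gamma> g Q)) (CE_system.tpb S \<Gamma> g Q y)
      = CE_system.tpb S' (fob FF \<Gamma>) (far FC \<Gamma> g) (far FF \<Gamma> Q) (far FC (src (Fam S) \<Gamma> Q) y)"
proof -
  interpret S: CE_system S by fact
  interpret S': CE_system S' by fact
  interpret H: CE_hom S S' FF FC by fact
  note FC = CE_hom_FC_hom[OF assms(1,3)] and sec = CE_hom_sections[OF assms(1,3)]
    and FCc = CE_hom_far_cmp[OF assms(1,3)]
  note t = S.tpb_section[OF \<Gamma> g Q y] and \<Delta> = S.C_hom_Ob[OF \<Gamma> g] and gQ = S.pb_Over[OF \<Gamma> g Q]
    and obQ = S.F.src_Ob[OF \<Gamma> Q]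
  show "far FC (src (Fam S) \<Delta> (pb S \<Gamma> g Q)) (S.tpb \<Gamma> g Q y)
      = S'.tpb (fob FF \<Gamma>) (far FC \<Gamma> g) (far FF \<Gamma> Q) (far FC (src (Fam S) \<Gamma> Q) y)"
  proof (rule sym, rule S'.tpb_eqI[OF H.FF_Ob[OF \<Gamma>] FC[OF \<Gamma> g] H.FF_Over[OF \<Gamma> Q] sec[OF \<Gamma> Q y]])
    show "far FC (src (Fam S) \<Delta> (pb S \<Gamma> g Q)) (S.tpb \<Gamma> g Q y)
        \<in> sections S' (fob FF \<Delta>) (pb S' (fob FF \<Gamma>) (far FC \<Gamma> g) (far FF \<Gamma> Q))"
      using sec[OF \<Delta> gQ t] by (simp add: H.hom_pb[OF \<Gamma> g Q])
    show "cmp (Con S') (src (Fam S') (fob FF \<Gamma>) (far FF \<Gamma> Q)) (pr2 S' (fob FF \<Gamma>) (far FC \<Gamma> g) (far FF \<Gamma> Q))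
          (far FC (src (Fam S) \<Delta> (pb S \<Gamma> g Q)) (S.tpb \<Gamma> g Q y))
        = cmp (Con S') (src (Fam S') (fob FF \<Gamma>) (far FF \<Gamma> Q)) (far FC (src (Fam S) \<Gamma> Q) y) (far FC \<Gamma> g)"
      using FCc[OF obQ S.pr2_hom[OF \<Gamma> g Q] S.sections_hom[OF t]] FCc[OF obQ S.sections_hom[OF y] g]
        S.pr2_tpb[OF \<Gamma> g Q y] by (simp add: H.hom_pr2[OF \<Gamma> g Q] H.FF_src[OF \<Gamma> Q])
  qed
qed

lemma pre_E_hom_CE2E:
  assumes "CE_system S" and "CE_system S'" and "CE_hom S S' FF FC"
  shows "pre_E_hom (CE2E_ob S) (CE2E_ob S') \<lparr>fob = fob FF, far = far FF, ftm = \<lambda>\<Gamma> A x. far FC (src (Fam S) \<Gamma> A) x\<rparr>"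
    (is "pre_E_hom ?E ?E' ?H")
proof -
  interpret S: CE_system S by fact
  interpret S': CE_system S' by fact
  interpret H: CE_hom S S' FF FC by fact
  interpret FF: strict_functor "Fam S" "Fam S'" FF by (rule H.functor_Fam)
  interpret FC: strict_functor "Con S" "Con S'" FC by (rule H.functor_Con)
  note FC = CE_hom_FC_hom[OF assms(1,3)]
  note tpb = CE_hom_tpb[OF assms] and sec = CE_hom_sections[OF assms(1,3)]
  have tf: "tfunctor ?E ?E' ?H"
    by unfold_locales
      (use FF.fob_Ob FF.far_Over FF.src_far FF.far_idn FF.far_cmp sec in auto)
  \<comment> \<open>Substitution and weakening are both pullback functors, along x and along I(A),
    so this single square yields \<open>hom_Sub\<close> and \<open>hom_Wk\<close>.\<close>
  have pb_fun: "tfun_eq (slice ?E \<Gamma>) (tcomp (slice_fun ?E ?H \<Delta>) (pb_fun S \<Gamma> f))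
    (tcomp (pb_fun S' (fob FF \<Gamma>) (far FC \<Gamma> f)) (slice_fun ?E ?H \<Gamma>))"
    if \<Gamma>: "\<Gamma> \<in> Ob (Fam S)" and f: "f \<in> hom (Con S) \<Delta> \<Gamma>" for \<Gamma> \<Delta> f
  proof (rule tfun_eqI, simp_all)
    fix B assume B: "B \<in> Over (Fam S) \<Gamma>"
    note p = S.pr2_hom[OF \<Gamma> f B] and obB = S.F.src_Ob[OF \<Gamma> B] and fB = S.pb_Over[OF \<Gamma> f B]
      and \<Delta> = S.C_hom_Ob[OF \<Gamma> f]
    show "far FF \<Delta> (pb S \<Gamma> f B) = pb S' (fob FF \<Gamma>) (far FC \<Gamma> f) (far FF \<Gamma> B)"
      by (rule H.hom_pb[OF \<Gamma> f B])
    fix Q assume Q: "Q \<in> Over (Fam S) (src (Fam S) \<Gamma> B)"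
    show "far FF (src (Fam S) \<Delta> (pb S \<Gamma> f B)) (pb S (src (Fam S) \<Gamma> B) (pr2 S \<Gamma> f B) Q)
      = pb S' (src (Fam S') (fob FF \<Gamma>) (far FF \<Gamma> B)) (pr2 S' (fob FF \<Gamma>) (far FC \<Gamma> f) (far FF \<Gamma> B))
         (far FF (src (Fam S) \<Gamma> B) Q)"
      using H.hom_pb[OF obB p Q] by (simp add: H.hom_pr2[OF \<Gamma> f B] H.FF_src[OF \<Gamma> B])
    fix y assume y: "y \<in> sections S (src (Fam S) \<Gamma> B) Q"
    show "far FC (src (Fam S) (src (Fam S) \<Delta> (pb S \<Gamma> f B)) (pb S (src (Fam S) \<Gamma> B) (pr2 S \<Gamma> f B) Q))
        (ftm (pb_fun S \<Gamma> f) B Q y)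
      = ftm (pb_fun S' (fob FF \<Gamma>) (far FC \<Gamma> f)) (far FF \<Gamma> B) (far FF (src (Fam S) \<Gamma> B) Q)
         (far FC (src (Fam S) (src (Fam S) \<Gamma> B) Q) y)"
      using tpb[OF obB p Q y] H.FF_Over[OF obB Q]
      by (simp add: S.pb_fun_ftm[OF \<Gamma> f B Q]
          S'.pb_fun_ftm[OF H.FF_Ob[OF \<Gamma>] FC[OF \<Gamma> f] H.FF_Over[OF \<Gamma> B]] H.FF_src[OF \<Gamma> B] H.hom_pr2[OF \<Gamma> f B])
  qed
  show ?thesis
  proof (rule pre_E_hom.intro[OF tf], unfold_locales)
    show "fob ?H (root ?E) = root ?E'" by (simp add: H.hom_one)
  next
    fix \<Gamma> A x
    assume "\<Gamma> \<in> Ob ?E" "A \<in> Over ?E \<Gamma>" "x \<in> Tm ?E \<Gamma> A"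
    then have \<Gamma>: "\<Gamma> \<in> Ob (Fam S)" and A: "A \<in> Over (Fam S) \<Gamma>" and x: "x \<in> sections S \<Gamma> A" by simp_all
    show "tfun_eq (slice ?E (src ?E \<Gamma> A)) (tcomp (slice_fun ?E ?H \<Gamma>) (Sub ?E \<Gamma> A x))
      (tcomp (Sub ?E' (fob ?H \<Gamma>) (far ?H \<Gamma> A) (ftm ?H \<Gamma> A x)) (slice_fun ?E ?H (src ?E \<Gamma> A)))"
      using pb_fun[OF S.F.src_Ob[OF \<Gamma> A] S.sections_hom[OF x]] by (simp add: H.FF_src[OF \<Gamma> A])
  next
    fix \<Gamma> A
    assume "\<Gamma> \<in> Ob ?E" "A \<in> Over ?E \<Gamma>"
    then have \<Gamma>: "\<Gamma> \<in> Ob (Fam S)" and A: "A \<in> Over (Fam S) \<Gamma>" by simp_all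
    note I = S.Inc_hom[OF \<Gamma> A] and i = S.idtm_section[OF \<Gamma> A] and obA = S.F.src_Ob[OF \<Gamma> A]
    show "tfun_eq (slice ?E \<Gamma>) (tcomp (slice_fun ?E ?H (src ?E \<Gamma> A)) (Wk ?E \<Gamma> A))
      (tcomp (Wk ?E' (fob ?H \<Gamma>) (far ?H \<Gamma> A)) (slice_fun ?E ?H \<Gamma>))"
      using pb_fun[OF \<Gamma> I] by (simp add: H.commute_Inc[OF \<Gamma> A])
    have W: "pb S \<Gamma> (Inc S \<Gamma> A) A \<in> Over (Fam S) (src (Fam S) \<Gamma> A)" by (rule S.pb_Over[OF \<Gamma> I A])
    have i': "far FC (src (Fam S) (src (Fam S) \<Gamma> A) (pb S \<Gamma> (Inc S \<Gamma> A) A)) (idtm ?E \<Gamma> A)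
      \<in> sections S' (fob FF (src (Fam S) \<Gamma> A)) (pb S' (fob FF \<Gamma>) (Inc S' (fob FF \<Gamma>) (far FF \<Gamma> A)) (far FF \<Gamma> A))"
      using sec[OF obA W i] H.hom_pb[OF \<Gamma> I A] by (simp add: H.commute_Inc[OF \<Gamma> A])
    \<comment> \<open>The image of the generic section of A has the projection that characterises
      the generic section of the image of A.\<close>
    have "cmp (Con S') (fob FF (src (Fam S) \<Gamma> A))
        (pr2 S' (fob FF \<Gamma>) (Inc S' (fob FF \<Gamma>) (far FF \<Gamma> A)) (far FF \<Gamma> A))
        (far FC (src (Fam S) (src (Fam S) \<Gamma> A) (pb S \<Gamma> (Inc S \<Gamma> A) A)) (idtm ?E \<Gamma> A))
      = idn (Con S') (fob FF (src (Fam S) \<Gamma> A))"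
      using FC.far_cmp[of "src (Fam S) \<Gamma> A" "pr2 S \<Gamma> (Inc S \<Gamma> A) A" "idtm ?E \<Gamma> A"]
        S.pr2_idtm[OF \<Gamma> A] S.same_Ob obA S.pr2_hom[OF \<Gamma> I A] S.sections_hom[OF i] FC.far_idn[of "src (Fam S) \<Gamma> A"]
        H.hom_pr2[OF \<Gamma> I A] H.commute_Ob[OF obA] H.commute_Inc[OF \<Gamma> A]
      by (simp add: hom_iff)
    then show "ftm ?H (src ?E \<Gamma> A) (fob (Wk ?E \<Gamma> A) A) (idtm ?E \<Gamma> A) = idtm ?E' (fob ?H \<Gamma>) (far ?H \<Gamma> A)"
      using S'.section_unique[OF H.FF_Ob[OF \<Gamma>] S'.Inc_hom[OF H.FF_Ob[OF \<Gamma>] H.FF_Over[OF \<Gamma> A]] H.FF_Over[OF \<Gamma> A]]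
        i' S'.idtm_section[OF H.FF_Ob[OF \<Gamma>] H.FF_Over[OF \<Gamma> A]]
        S'.pr2_idtm[OF H.FF_Ob[OF \<Gamma>] H.FF_Over[OF \<Gamma> A]]
      by (simp add: H.FF_src[OF \<Gamma> A])
  qed
qed

lemma CE2E_hom_cong:
  assumes "CE_system S" and "fun_eq (Fam S) FF GF" and "fun_eq (Con S) FC GC"
  shows "CE2E_hom S FF FC = CE2E_hom S GF GC"
proof -
  interpret S: CE_system S by fact
  show ?thesis
    unfolding CE2E_hom_def trestr_eq_iff
    using assms(2,3) S.same_Ob
    by (auto simp: tfun_eq_def fun_eq_def sections_def hom_iff S.F.src_Ob)
qed

lemma strict_functor_CE2E: "strict_functor CEsys Esys CE2E"
proof (unfold_locales, goal_cases)
  case (1 S)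
  then show ?case by (auto simp: CE2E_def CE_system.E_system_CE2E)
next
  case (2 S' f)
  then show ?case
    by (auto simp: CE2E_def CE2E_hom_def trestr_trestr CE_system.E_system_CE2E
        intro!: pre_E_hom_trestr pre_E_hom_CE2E)
next
  case (3 S' f)
  then show ?case by (auto simp: CE2E_def)
next
  case (4 S)
  then interpret S: CE_system S by simp
  show ?case
    using CE2E_hom_cong[OF S.CE_system_axioms fun_eq_frestr fun_eq_frestr, of fid fid]
    by (simp add: CE2E_def CE2E_hom_def tid_def)
next
  case (5 S' f g)
  then obtain S1 GF GC S2 FF FC where f: "f = (S1, GF, GC)" and g: "g = (S2, FF, FC)"
    and hom: "CE_hom S1 S' GF GC" "CE_hom S2 S1 FF FC" and S: "CE_system S1" "CE_system S2" "CE_system S'"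
    by auto
  interpret S1: CE_system S1 by fact
  interpret S2: CE_system S2 by fact
  interpret G: CE_hom S1 S' GF GC by fact
  interpret F: CE_hom S2 S1 FF FC by fact
  have "tfun_eq (CE2E_ob S2)
    \<lparr>fob = fob (fcomp GF FF), far = far (fcomp GF FF), ftm = \<lambda>\<Gamma> A x. far (fcomp GC FC) (src (Fam S2) \<Gamma> A) x\<rparr>
    (tcomp \<lparr>fob = fob GF, far = far GF, ftm = \<lambda>\<Gamma> A x. far GC (src (Fam S1) \<Gamma> A) x\<rparr>
      \<lparr>fob = fob FF, far = far FF, ftm = \<lambda>\<Gamma> A x. far FC (src (Fam S2) \<Gamma> A) x\<rparr>)"
    by (rule tfun_eqI) (simp_all add: F.FF_src F.commute_Ob S2.F.src_Ob)
  then have "CE2E_hom S2 (frestr (Fam S2) (fcomp GF FF)) (frestr (Con S2) (fcomp GC FC))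
    = trestr (CE2E_ob S2) (tcomp (CE2E_hom S1 GF GC) (CE2E_hom S2 FF FC))"
    unfolding CE2E_hom_cong[OF S(2) fun_eq_frestr fun_eq_frestr]
    unfolding CE2E_hom_def trestr_tcomp_trestr_right
      trestr_tcomp_trestr_left[OF pre_E_hom.axioms(1)[OF pre_E_hom_CE2E[OF S(2,1) hom(2)]]]
    by (simp add: trestr_eq_iff)
  then show ?case by (simp add: CE2E_def f g)
qed

section \<open>The functor from E-systems to CE-systems\<close>

lemma slice_fun_slice_fun:
  assumes "strict_category E" and "\<Gamma> \<in> Ob E" and "A \<in> Over E \<Gamma>"
  shows "tfun_eq (slice E (src E \<Gamma> A)) (slice_fun (slice E \<Gamma>) (slice_fun E H \<Gamma>) A)
    (slice_fun E H (src E \<Gamma> A))"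
proof -
  interpret strict_category E by fact
  show ?thesis
    using assms(2,3) by (auto intro!: tfun_eqI simp: src_cmp)
qed

locale small_E_hom = E: small_E_system E + D: small_E_system D + pre_E_hom E D H
  for E D :: "('u::infinite, 'u, 'u) esys" and H :: "('u, 'u, 'u, 'u, 'u, 'u) tfnct"
begin

abbreviation res :: "'u \<Rightarrow> ('u, 'u, 'u, 'u, 'u, 'u) tfnct" where
  "res \<Gamma> \<equiv> slice_fun E H \<Gamma>"

abbreviation Hr :: "'u \<Rightarrow> 'u" where "Hr A \<equiv> far H E.r A"

definition Harr :: "'u \<Rightarrow> 'u \<Rightarrow> 'u" where
  "Harr B h = (case untag h of (A, f) \<Rightarrow> tag (Hr A, ftm H (src E E.r A) (fob (Wk E E.r A) B) f))"

lemma Hr_Over: "A \<in> Over E E.r \<Longrightarrow> Hr A \<in> Over D D.r"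
  using far_Over[OF E.root_Ob] hom_root by simp

lemma src_Hr: "A \<in> Over E E.r \<Longrightarrow> src D D.r (Hr A) = fob H (src E E.r A)"
  using src_far[OF E.root_Ob] hom_root by simp

lemma res_tfunctor: "\<Gamma> \<in> Ob E \<Longrightarrow> tfunctor (slice E \<Gamma>) (slice D (fob H \<Gamma>)) (res \<Gamma>)"
  by (rule tfunctor_slice_fun[OF E.cat tfunctor_axioms])

lemma Wk_H:
  assumes "A \<in> Over E E.r" "B \<in> Over E E.r"
  shows "far H (src E E.r A) (fob (Wk E E.r A) B) = fob (Wk D D.r (Hr A)) (Hr B)"
  using tfun_eq_fob[OF hom_Wk[OF E.root_Ob assms(1)], of B] assms(2) hom_root by simp

text \<open>f^* is built from S_f and a slice of W_A, and H commutes with both, so H f^* = H(f)^*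
  H.\<close>

lemma tstar_H:
  assumes A: "A \<in> Over E E.r" and B: "B \<in> Over E E.r" and f: "f \<in> thom E E.r A B"
  defines "f' \<equiv> ftm H (src E E.r A) (fob (Wk E E.r A) B) f"
  shows "f' \<in> thom D D.r (Hr A) (Hr B)"
    and "E.feq (src E E.r B) (tcomp (res (src E E.r A)) (tstar E E.r A B f))
      (tcomp (tstar D D.r (Hr A) (Hr B) f') (res (src E E.r B)))"
proof -
  let ?A = "src E E.r A" and ?B = "src E E.r B" and ?W = "fob (Wk E E.r A) B"
  have ob: "?A \<in> Ob E" "?B \<in> Ob E" using A B E.root_Ob by (auto simp: E.src_Ob)
  have W: "?W \<in> Over E ?A" by (rule E.Wk_fob_Over[OF E.root_Ob A B])
  have f0: "f \<in> Tm E ?A ?W" using f by (simp add: thom_def)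
  show "f' \<in> thom D D.r (Hr A) (Hr B)"
    using ftm_Tm[OF ob(1) W f0] by (simp add: thom_def f'_def src_Hr A Wk_H[OF A B])
  note WA = E.Wk_functor[OF E.root_Ob A]
  have slW: "tfunctor (slice E ?B) (slice E (src E ?A ?W)) (E.sl E.r (Wk E E.r A) B)"
    by (rule E.ehom_tfunctor[OF E.ehom_sl[OF E.root_Ob ob(1) E.Wk_hom[OF E.root_Ob A] B]])
  have "E.feq ?B (tcomp (res ?A) (tstar E E.r A B f))
    (tcomp (tcomp (Sub D (fob H ?A) (far H ?A ?W) f') (res (src E ?A ?W))) (E.sl E.r (Wk E E.r A) B))"
    unfolding tstar_def tcomp_assoc[symmetric] f'_def
    by (rule tcomp_cong_left[OF slW hom_Sub[OF ob(1) W f0]])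
  also have "E.feq ?B \<dots> (tcomp (Sub D (fob H ?A) (far H ?A ?W) f')
      (tcomp (D.sl D.r (Wk D D.r (Hr A)) (Hr B)) (res ?B)))"
    unfolding tcomp_assoc
  proof (rule tcomp_cong_right)
    have "E.feq ?B (tcomp (res (src E ?A ?W)) (E.sl E.r (Wk E E.r A) B))
      (tcomp (E.sl ?A (res ?A) ?W) (E.sl E.r (Wk E E.r A) B))"
      by (rule tcomp_cong_left[OF slW tfun_eq_sym[OF slice_fun_slice_fun[OF E.cat ob(1) W]]])
    also have "E.feq ?B \<dots> (E.sl E.r (tcomp (res ?A) (Wk E E.r A)) B)"
      using slice_fun_tcomp[OF WA, of B "res ?A"] B
      by (simp add: tfun_eq_sym tfun_eq_slice_slice[OF E.cat E.root_Ob])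
    also have "E.feq ?B \<dots> (E.sl E.r (tcomp (Wk D D.r (Hr A)) (res E.r)) B)"
      using slice_fun_cong[OF strict_category_slice[OF E.cat E.root_Ob] hom_Wk[OF E.root_Ob A], of B] B
      by (simp add: tfun_eq_slice_slice[OF E.cat E.root_Ob] hom_root)
    also have "E.feq ?B \<dots> (tcomp (D.sl D.r (Wk D D.r (Hr A)) (Hr B)) (E.sl E.r (res E.r) B))"
      using slice_fun_tcomp[OF res_tfunctor[OF E.root_Ob], of B "Wk D D.r (Hr A)"] B
      by (simp add: tfun_eq_slice_slice[OF E.cat E.root_Ob] hom_root)
    also have "E.feq ?B \<dots> (tcomp (D.sl D.r (Wk D D.r (Hr A)) (Hr B)) (res ?B))"
      by (rule tcomp_cong_right[OF slice_fun_slice_fun[OF E.cat E.root_Ob B]])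
    finally show "E.feq ?B (tcomp (res (src E ?A ?W)) (E.sl E.r (Wk E E.r A) B))
      (tcomp (D.sl D.r (Wk D D.r (Hr A)) (Hr B)) (res ?B))" .
  qed
  finally show "E.feq ?B (tcomp (res ?A) (tstar E E.r A B f))
      (tcomp (tstar D D.r (Hr A) (Hr B) f') (res ?B))"
    by (simp add: tstar_def tcomp_assoc src_Hr A Wk_H[OF A B])
qed

lemma
  assumes "h \<in> hom (E2C E E.r) A B" and B: "B \<in> Over E E.r"
  shows Harr_hom: "Harr B h \<in> hom (E2C D D.r) (Hr A) (Hr B)"
    and Harr_sem: "E.feq (src E E.r B) (tcomp (res (src E E.r A)) (E.sem E.r B h))
      (tcomp (D.sem D.r (Hr B) (Harr B h)) (res (src E E.r B)))"
proof -
  obtain f where f: "f \<in> thom E E.r A B" "h = tag (A, f)" and A: "A \<in> Over E E.r"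
    using assms(1) by (auto simp: E.hom_E2C_iff)
  show "Harr B h \<in> hom (E2C D D.r) (Hr A) (Hr B)"
    and "E.feq (src E E.r B) (tcomp (res (src E E.r A)) (E.sem E.r B h))
      (tcomp (D.sem D.r (Hr B) (Harr B h)) (res (src E E.r B)))"
    using tstar_H[OF A B f(1)] Hr_Over[OF A] by (simp_all add: f(2) Harr_def D.hom_E2C_iff E.sem_def D.sem_def)
qed

text \<open>Computes \<open>Harr\<close> on an arrow given by a functor G: evaluating the square at
  the generic term of B, which H preserves, matches the two codes. Identities, composites,
  inclusions, projections and the sections of the unit are all treated this way.\<close>

lemma Harr_arr:
  assumes A: "A \<in> Over E E.r" and B: "B \<in> Over E E.r" and G: "E.ctx E.r A B G"
    and eq: "E.feq (src E E.r B) (tcomp (res (src E E.r A)) G) (tcomp G' (res (src E E.r B)))"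
  shows "Harr B (E.arr E.r A B G) = D.arr D.r (Hr A) (Hr B) G'"
proof -
  let ?A = "src E E.r A" and ?B = "src E E.r B" and ?W = "fob (Wk E E.r B) B"
  have ob: "?A \<in> Ob E" "?B \<in> Ob E" using A B E.root_Ob by (auto simp: E.src_Ob)
  have W: "?W \<in> Over E ?B" by (rule E.Wk_fob_Over[OF E.root_Ob B B])
  note Ge = E.ctx_ehom[OF G]
  have GW: "far G (idn E ?B) ?W = fob (Wk E E.r A) B"
    using E.ehom_far_idn[OF Ge ob(2,1) W] tfun_eq_fob[OF E.ctx_Wk_eq[OF G], of B] B by simp
  have "ftm H ?A (fob (Wk E E.r A) B) (E.code E.r B G) = D.code D.r (Hr B) G'"
    using tfun_eq_ftm[OF eq, of "idn E ?B" ?W "idtm E E.r B"] E.idtm_Tm[OF E.root_Ob B] W ob B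
      E.ehom_idn[OF Ge] GW Wk_H[OF B B] hom_idtm[OF E.root_Ob B] far_idn[OF ob(2)]
    by (simp add: E.code_def D.code_def E.idn_Over E.src_idn src_Hr hom_root)
  then show ?thesis
    by (simp add: Harr_def E.arr_def D.arr_def)
qed

definition HF :: "('u, 'u, 'u, 'u) fnct" where "HF = \<lparr>fob = Hr, far = \<lambda>A P. far H (src E E.r A) P\<rparr>"
definition HC :: "('u, 'u, 'u, 'u) fnct" where "HC = \<lparr>fob = Hr, far = Harr\<rparr>"

lemma E2CE_hom_eq: "E2CE_hom E H = (frestr (Fam E.CE) HF, frestr (Con E.CE) HC)"
  by (simp add: E2CE_hom_def HF_def HC_def Harr_def[abs_def] Let_def)

lemma CE_hom_H: "CE_hom E.CE D.CE HF HC"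
proof (rule CE_hom.intro, simp_all add: HF_def HC_def)
  show "strict_functor (slice_cat E E.r) (slice_cat D D.r) \<lparr>fob = Hr, far = \<lambda>A. far H (src E E.r A)\<rparr>"
  proof -
    interpret R: tfunctor "slice E E.r" "slice D D.r" "res E.r"
      using res_tfunctor[OF E.root_Ob] by (simp add: hom_root)
    show ?thesis
      by unfold_locales (use R.fob_Ob R.far_Over R.src_far R.far_idn R.far_cmp in simp_all)
  qed
  show "strict_functor (E2C E E.r) (E2C D D.r) \<lparr>fob = Hr, far = Harr\<rparr>"
  proof (unfold_locales, simp_all add: Hr_Over, goal_cases)
    case (1 B h)
    then show ?case by (auto simp: E.Over_E2C_iff D.Over_E2C_iff dest: Harr_hom)
  next
    case (2 B h)
    then obtain A where h: "h \<in> hom (E2C E E.r) A B" by (auto simp: E.Over_E2C_iff)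
    then show ?case using D.src_E2C[OF Harr_hom[OF h 2(1)]] by (simp add: E.src_E2C)
  next
    case (3 A)
    then show ?case
      unfolding E.idn_E2C D.idn_E2C
      by (intro Harr_arr[OF _ _ E.ctx_tid[OF E.root_Ob]]) simp_all
  next
    case (4 C h k)
    then obtain B A where h: "h \<in> hom (E2C E E.r) B C" and k: "k \<in> hom (E2C E E.r) A B"
      by (auto simp: E.Over_E2C_iff E.src_E2C)
    have A: "A \<in> Over E E.r" and B: "B \<in> Over E E.r" using E.hom_E2C_Over h k by blast+
    note kctx = E.ctx_sem[OF E.root_Ob k B] and hctx = E.ctx_sem[OF E.root_Ob h 4(1)]
    note htf = E.ehom_tfunctor[OF E.ctx_ehom[OF hctx]]
    have "E.feq (src E E.r C) (tcomp (res (src E E.r A)) (tcomp (E.sem E.r B k) (E.sem E.r C h)))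
      (tcomp (tcomp (D.sem D.r (Hr B) (Harr B k)) (res (src E E.r B))) (E.sem E.r C h))"
      unfolding tcomp_assoc[symmetric] by (rule tcomp_cong_left[OF htf Harr_sem[OF k B]])
    also have "E.feq (src E E.r C) \<dots> (tcomp (tcomp (D.sem D.r (Hr B) (Harr B k)) (D.sem D.r (Hr C) (Harr C h))) (res (src E E.r C)))"
      unfolding tcomp_assoc by (rule tcomp_cong_right[OF Harr_sem[OF h 4(1)]])
    finally have "Harr C (E.arr E.r A C (tcomp (E.sem E.r B k) (E.sem E.r C h)))
      = D.arr D.r (Hr A) (Hr C) (tcomp (D.sem D.r (Hr B) (Harr B k)) (D.sem D.r (Hr C) (Harr C h)))"
      by (rule Harr_arr[OF A 4(1) E.ctx_tcomp[OF E.root_Ob 4(1) kctx hctx]])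
    then show ?case
      by (simp add: E.src_E2C[OF h] E.cmp_E2C[OF E.root_Ob h k 4(1)]
          D.cmp_E2C[OF D.root_Ob Harr_hom[OF h 4(1)] Harr_hom[OF k B] Hr_Over[OF 4(1)]])
  qed
  show "Hr (idn E E.r) = idn D D.r" by (simp add: far_idn E.root_Ob hom_root)
next
  fix A Q assume A: "A \<in> Over E E.r" and Q: "Q \<in> Over E (src E E.r A)"
  have AQ: "cmp E E.r A Q \<in> Over E E.r" "src E E.r (cmp E E.r A Q) = src E (src E E.r A) Q"
    using A Q E.root_Ob by (auto simp: E.cat_simps)
  have HAQ: "Hr (cmp E E.r A Q) = cmp D D.r (Hr A) (far H (src E E.r A) Q)"
    using far_cmp[OF E.root_Ob A Q] by (simp add: hom_root)
  have obA: "src E E.r A \<in> Ob E" using A E.root_Ob by (simp add: E.src_Ob)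
  show "Harr A (Inc E.CE A Q) = Inc D.CE (Hr A) (far H (src E E.r A) Q)"
    unfolding E.Inc_CE D.Inc_CE HAQ[symmetric] src_Hr[OF A]
    by (rule Harr_arr[OF AQ(1) A E.ctx_Wk[OF E.root_Ob A Q]]) (use hom_Wk[OF obA Q] in \<open>simp add: AQ(2)\<close>)
next
  fix B h A R
  assume B: "B \<in> Over E E.r" and h: "h \<in> hom (E2C E E.r) A B" and R: "R \<in> Over E (src E E.r B)"
  let ?A = "src E E.r A" and ?B = "src E E.r B"
  have A: "A \<in> Over E E.r" by (rule E.hom_E2C_Over[OF h])
  have ob: "?A \<in> Ob E" "?B \<in> Ob E" using A B E.root_Ob by (auto simp: E.src_Ob)
  note hs = Harr_sem[OF h B] and hh = Harr_hom[OF h B] and hctx = E.ctx_sem[OF E.root_Ob h B]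
  show pb: "far H ?A (pb E.CE B h R) = pb D.CE (Hr B) (Harr B h) (far H ?B R)"
    using tfun_eq_fob[OF hs, of R] R by (simp add: E.pb_CE D.pb_CE)
  have fR: "pb E.CE B h R \<in> Over E ?A" using E.pb_Over_CE[OF h B R] by (simp add: E.pb_CE)
  have BR: "cmp E E.r B R \<in> Over E E.r" "src E E.r (cmp E E.r B R) = src E ?B R"
    and AfR: "cmp E E.r A (pb E.CE B h R) \<in> Over E E.r" "src E E.r (cmp E E.r A (pb E.CE B h R)) = src E ?A (pb E.CE B h R)"
    using A B R fR E.root_Ob by (auto simp: E.cat_simps)
  have HR: "far H ?B R \<in> Over D (src D D.r (Hr B))" using far_Over[OF ob(2) R] by (simp add: src_Hr B)
  have Hcmp: "Hr (cmp E E.r B R) = cmp D D.r (Hr B) (far H ?B R)"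
    "Hr (cmp E E.r A (pb E.CE B h R)) = cmp D D.r (Hr A) (pb D.CE (Hr B) (Harr B h) (far H ?B R))"
    using far_cmp[OF E.root_Ob B R] far_cmp[OF E.root_Ob A fR] pb by (simp_all add: hom_root)
  have hom_tf: "tfunctor (slice E ?B) (slice E ?A) (E.sem E.r B h)" by (rule E.ehom_tfunctor[OF E.ctx_ehom[OF hctx]])
  \<comment> \<open>Slicing the square of \<open>Harr_sem\<close> over R produces the square for
    h^*/R that \<open>Harr_arr\<close> asks for.\<close>
  have "E.feq (src E ?B R) (tcomp (res (src E ?A (pb E.CE B h R))) (E.sl ?B (E.sem E.r B h) R))
    (tcomp (E.sl ?A (res ?A) (pb E.CE B h R)) (E.sl ?B (E.sem E.r B h) R))"
    using tfun_eq_sym[OF slice_fun_slice_fun[OF E.cat ob(1) fR]]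
      E.ehom_tfunctor[OF E.ehom_sl[OF ob(2,1) E.ctx_ehom[OF hctx] R]]
    by (intro tcomp_cong_left) (auto simp: E.pb_CE)
  also have "E.feq (src E ?B R) \<dots> (E.sl ?B (tcomp (res ?A) (E.sem E.r B h)) R)"
    using slice_fun_tcomp[OF hom_tf, of R "res ?A"] R
    by (simp add: tfun_eq_sym tfun_eq_slice_slice[OF E.cat ob(2)] E.pb_CE)
  also have "E.feq (src E ?B R) \<dots> (E.sl ?B (tcomp (D.sem D.r (Hr B) (Harr B h)) (res ?B)) R)"
    using slice_fun_cong[OF strict_category_slice[OF E.cat ob(2)] hs, of R] R
    by (simp add: tfun_eq_slice_slice[OF E.cat ob(2)])
  also have "E.feq (src E ?B R) \<dots> (tcomp (D.sl (src D D.r (Hr B)) (D.sem D.r (Hr B) (Harr B h)) (far H ?B R)) (E.sl ?B (res ?B) R))"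
    using slice_fun_tcomp[OF res_tfunctor[OF ob(2)], of R "D.sem D.r (Hr B) (Harr B h)"] R
    by (simp add: tfun_eq_slice_slice[OF E.cat ob(2)] src_Hr B)
  also have "E.feq (src E ?B R) \<dots> (tcomp (D.sl (src D D.r (Hr B)) (D.sem D.r (Hr B) (Harr B h)) (far H ?B R)) (res (src E ?B R)))"
    by (rule tcomp_cong_right[OF slice_fun_slice_fun[OF E.cat ob(2) R]])
  finally have "E.feq (src E E.r (cmp E E.r B R))
    (tcomp (res (src E E.r (cmp E E.r A (pb E.CE B h R)))) (E.sl ?B (E.sem E.r B h) R))
    (tcomp (D.sl (src D D.r (Hr B)) (D.sem D.r (Hr B) (Harr B h)) (far H ?B R)) (res (src E E.r (cmp E E.r B R))))"
    by (simp add: BR AfR)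
  from Harr_arr[OF AfR(1) BR(1) _ this] E.ctx_sl[OF E.root_Ob A B hctx R]
  show "Harr (cmp E E.r B R) (pr2 E.CE B h R) = pr2 D.CE (Hr B) (Harr B h) (far H ?B R)"
    unfolding E.pr2_CE[OF h B R] D.pr2_CE[OF hh Hr_Over[OF B] HR] Hcmp
    by (simp add: E.pb_CE D.pb_CE)
qed

end

lemma small_E_system_iff: "small_E_system E \<longleftrightarrow> E_system E"
  by (simp add: small_E_system_def)

lemma small_E_homI: "\<lbrakk>E_system E; E_system D; pre_E_hom E D H\<rbrakk> \<Longrightarrow> small_E_hom E D H"
  by (simp add: small_E_hom_def small_E_system_iff)

lemma E2CE_hom_eq':
  "E2CE_hom E H = (frestr (Fam (E2CE_ob E)) \<lparr>fob = far H (root E), far = \<lambda>A P. far H (src E (root E) A) P\<rparr>,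
    frestr (Con (E2CE_ob E)) \<lparr>fob = far H (root E), far = \<lambda>B h. case untag h of (A, f) \<Rightarrow>
      tag (far H (root E) A, ftm H (src E (root E) A) (fob (Wk E (root E) A) B) f)\<rparr>)"
  by (simp add: E2CE_hom_def E2CE_ob_def Let_def)

lemma E2CE_hom_cong:
  assumes "E_system E" and eq: "tfun_eq E H K"
  shows "E2CE_hom E H = E2CE_hom E K"
proof -
  interpret small_E_system E using assms by (simp add: small_E_system_iff)
  show ?thesis
    unfolding E2CE_hom_eq'
    using root_Ob Wk_fob_Over[OF root_Ob]
    by (auto simp: frestr_eq_iff fun_eq_def tfun_eq_far[OF eq] tfun_eq_ftm[OF eq] src_Ob Over_E2C_iff hom_E2C_iff
        thom_def)
qed

lemma strict_functor_E2CE: "strict_functor Esys CEsys E2CE"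
proof (unfold_locales, goal_cases)
  case (1 E)
  then show ?case by (simp add: E2CE_def small_E_system.CE_system_E2CE small_E_system_iff)
next
  case (2 D f)
  then obtain E H where f: "f = (E, H)" and EH: "E_system E" "E_system D" "pre_E_hom E D H" by auto
  interpret small_E_hom E D H by (rule small_E_homI[OF EH])
  show ?case
    using CE_hom_frestr[OF E.CE_system_E2CE CE_hom_H] E.CE_system_E2CE
    by (simp add: f E2CE_def E2CE_hom_eq frestr_frestr)
next
  case (3 D f)
  then show ?case by (auto simp: E2CE_def E2CE_hom_def Let_def)
next
  case (4 E)
  then interpret small_E_system E by (simp add: small_E_system_iff)
  show ?case
    using E2CE_hom_cong[OF E_system_axioms tfun_eq_trestr[of E tid]]
    by (auto simp: E2CE_def E2CE_hom_eq' frestr_eq_iff fun_eq_def Over_E2C_iff hom_E2C_iff)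
next
  case (5 D f g)
  then obtain E H E' K where f: "f = (E, H)" and g: "g = (E', K)"
    and EH: "E_system E" "E_system D" "pre_E_hom E D H" and EK: "E_system E'" "pre_E_hom E' E K" by auto
  interpret H: small_E_hom E D H by (rule small_E_homI[OF EH])
  interpret K: small_E_hom E' E K by (rule small_E_homI[OF EK(1) EH(1) EK(2)])
  note r = K.E.root_Ob and W = K.E.Wk_fob_Over[OF K.E.root_Ob]
  \<comment> \<open>On arrows both sides apply K and then H to the same term; \<open>K.Wk_H\<close>
    identifies the types at which H is applied.\<close>
  have "E2CE_hom E' (tcomp H K) = (frestr (Fam K.E.CE) (fcomp H.HF K.HF), frestr (Con K.E.CE) (fcomp H.HC K.HC))"
    using K.Wk_H
    by (auto simp: E2CE_hom_eq' frestr_eq_iff fun_eq_def K.E.Over_E2C_iff K.E.hom_E2C_iff r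
        H.HF_def H.HC_def H.Harr_def K.HF_def K.HC_def K.Harr_def K.hom_root K.src_Hr)
  then show ?case
    using CE_hom.functor_Fam[OF K.CE_hom_H] CE_hom.functor_Con[OF K.CE_hom_H]
    by (simp add: f g E2CE_def E2CE_hom_cong[OF EK(1) tfun_eq_trestr] H.E2CE_hom_eq K.E2CE_hom_eq
        frestr_fcomp_frestr_left frestr_fcomp_frestr_right)
qed

section \<open>The unit\<close>

context small_E_system
begin

definition bang :: "'u \<Rightarrow> 'u" where "bang \<Gamma> = (THE f. f \<in> hom E \<Gamma> r)"

lemma
  assumes "\<Gamma> \<in> Ob E"
  shows bang_Over: "bang \<Gamma> \<in> Over E r" and src_bang: "src E r (bang \<Gamma>) = \<Gamma>"
  using theI'[of "\<lambda>f. f \<in> hom E \<Gamma> r"] terminal_root assms by (auto simp: terminal_def bang_def hom_iff)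

text \<open>A is itself an arrow from its domain to the root, hence the unique one. So objects of E
  are the same as families over the root.\<close>

lemma bang_src:
  assumes "A \<in> Over E r"
  shows "bang (src E r A) = A"
proof -
  have "src E r A \<in> Ob E" using assms root_Ob by (simp add: src_Ob)
  then show ?thesis
    using terminal_root assms unfolding terminal_def bang_def
    by (metis (mono_tags, lifting) hom_iff the_equality)
qed

lemma bang_cmp: "\<lbrakk>\<Gamma> \<in> Ob E; A \<in> Over E \<Gamma>\<rbrakk> \<Longrightarrow> bang (src E \<Gamma> A) = cmp E r (bang \<Gamma>) A"
  using bang_src[of "cmp E r (bang \<Gamma>) A"] root_Ob by (simp add: bang_Over src_bang cmp_Over src_cmp)

text \<open>\<open>sec A P x\<close> is the section \<open>h\<close> of \<open>P\<close> with \<open>h\<^sup>* = S\<^sub>x\<close>.\<close>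

definition sec :: "'u \<Rightarrow> 'u \<Rightarrow> 'u \<Rightarrow> 'u" where
  "sec A P x = arr r A (cmp E r A P) (Sub E (src E r A) P x)"

text \<open>The action on arrows is the identity: the arrows of the slice over the root with
  codomain \<open>bang \<Gamma>\<close> are literally the elements of
  \<open>Over E \<Gamma>\<close>.\<close>

definition unit :: "('u, 'u, 'u, 'u, 'u, 'u) tfnct" where
  "unit = \<lparr>fob = bang, far = \<lambda>\<Gamma> A. A, ftm = \<lambda>\<Gamma> A x. sec (bang \<Gamma>) A x\<rparr>"

context
  fixes A P
  assumes A: "A \<in> Over E r" and P: "P \<in> Over E (src E r A)"
begin

lemma A_Ob: "src E r A \<in> Ob E" and AP_Over: "cmp E r A P \<in> Over E r"
  and src_AP: "src E r (cmp E r A P) = src E (src E r A) P"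
  using A P root_Ob by (simp_all add: src_Ob cmp_Over src_cmp)

text \<open>S_x W_{A.P} = S_x W_P W_A = W_A, so S_x lies over the root and has a corresponding
  arrow.\<close>

lemma ctx_Sub:
  assumes x: "x \<in> Tm E (src E r A) P"
  shows "ctx r A (cmp E r A P) (Sub E (src E r A) P x)"
proof -
  have "feq r (tcomp (Sub E (src E r A) P x) (Wk E r (cmp E r A P)))
    (tcomp (Sub E (src E r A) P x) (tcomp (Wk E (src E r A) P) (Wk E r A)))"
    by (rule tcomp_cong_right[OF Wk_by_cmp[OF root_Ob A P]])
  also have "feq r \<dots> (tcomp tid (Wk E r A))"
    unfolding tcomp_assoc[symmetric]
    by (rule tcomp_cong_left[OF Wk_functor[OF root_Ob A] Sub_Wk[OF A_Ob P x]])
  finally show ?thesis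
    using Sub_hom[OF A_Ob P x] by (simp add: ctx_def src_AP)
qed

lemma
  assumes x: "x \<in> Tm E (src E r A) P"
  shows sec_hom: "sec A P x \<in> hom (E2C E r) A (cmp E r A P)"
    and sem_sec: "feq (src E (src E r A) P) (sem r (cmp E r A P) (sec A P x)) (Sub E (src E r A) P x)"
    and sec_section: "sec A P x \<in> sections CE A P"
proof -
  show hom: "sec A P x \<in> hom (E2C E r) A (cmp E r A P)"
    and sem: "feq (src E (src E r A) P) (sem r (cmp E r A P) (sec A P x)) (Sub E (src E r A) P x)"
    using arr_hom[OF root_Ob A AP_Over ctx_Sub[OF x]] sem_arr[OF root_Ob A AP_Over ctx_Sub[OF x]]
    by (simp_all add: sec_def src_AP)
  have "cmp (E2C E r) A (Inc CE A P) (sec A P x) = idn (E2C E r) A"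
  proof (rule hom_E2C_eqI[OF root_Ob cmp_hom[OF root_Ob Inc_hom[OF A P] hom A] idn_hom[OF root_Ob A] A])
    have "feq (src E r A) (sem r A (cmp (E2C E r) A (Inc CE A P) (sec A P x)))
      (tcomp (sem r (cmp E r A P) (sec A P x)) (Wk E (src E r A) P))"
      by (rule sem_cmp_Inc[OF A P hom])
    also have "feq (src E r A) \<dots> (tcomp (Sub E (src E r A) P x) (Wk E (src E r A) P))"
      by (rule tcomp_cong_left[OF Wk_functor[OF A_Ob P] sem])
    also have "feq (src E r A) \<dots> tid" by (rule Sub_Wk[OF A_Ob P x])
    also have "feq (src E r A) \<dots> (sem r A (idn (E2C E r) A))"
      by (rule tfun_eq_sym[OF sem_idn[OF root_Ob A]])
    finally show "feq (src E r A) (sem r A (cmp (E2C E r) A (Inc CE A P) (sec A P x)))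
      (sem r A (idn (E2C E r) A))" .
  qed
  then show "sec A P x \<in> sections CE A P"
    using hom by (simp add: sections_def)
qed

text \<open>Injective since S_x(idtm) = x. For surjectivity, the functor U of a section satisfies U
  W_P = id, so \<open>ehom_generic\<close> with K the identity writes U as S_x for x =
  U(idtm).\<close>

lemma bij_sec: "bij_betw (sec A P) (Tm E (src E r A) P) (sections CE A P)"
proof (rule bij_betwI')
  fix x y assume x: "x \<in> Tm E (src E r A) P" and y: "y \<in> Tm E (src E r A) P"
  have c: "code (src E r A) P (Sub E (src E r A) P x) = x" if "x \<in> Tm E (src E r A) P" for x
    using Sub_idtm[OF A_Ob P that] by (simp add: code_def)
  have "x = y" if "sec A P x = sec A P y"
  proof -
    have "feq (src E (src E r A) P) (Sub E (src E r A) P x) (Sub E (src E r A) P y)"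
      using tfun_eq_trans[OF tfun_eq_sym[OF sem_sec[OF x]]] sem_sec[OF y] that by simp
    from code_cong[OF A_Ob P this] show ?thesis by (simp add: c x y)
  qed
  then show "(sec A P x = sec A P y) = (x = y)" by blast
  show "sec A P x \<in> sections CE A P" by (rule sec_section[OF x])
next
  fix s assume s: "s \<in> sections CE A P"
  let ?U = "sem r (cmp E r A P) s" and ?A = "src E r A"
  have hom: "s \<in> hom (E2C E r) A (cmp E r A P)" and id: "cmp (E2C E r) A (Inc CE A P) s = idn (E2C E r) A"
    using s by (simp_all add: sections_def)
  have U: "ehom (src E ?A P) ?A ?U"
    using ctx_ehom[OF ctx_sem[OF root_Ob hom AP_Over]] by (simp add: src_AP)
  have "feq ?A (tcomp ?U (Wk E ?A P)) tid"
    using tfun_eq_trans[OF tfun_eq_sym[OF sem_cmp_Inc[OF A P hom]]] sem_idn[OF root_Ob A] by (simp add: id)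
  note gen = ehom_generic[OF U A_Ob A_Ob P this]
  have x: "code ?A P ?U \<in> Tm E ?A P"
    using ehom_ftm_Tm[OF U _ A_Ob Wk_fob_Over[OF A_Ob P P] idtm_Tm[OF A_Ob P]] A_Ob P
      tfun_eq_fob[OF \<open>feq ?A (tcomp ?U (Wk E ?A P)) tid\<close>, of P]
    by (simp add: code_def src_Ob)
  have "s = sec A P (code ?A P ?U)"
    by (rule hom_E2C_eqI[OF root_Ob hom sec_hom[OF x] AP_Over])
      (use tfun_eq_trans[OF gen] tfun_eq_sym[OF sem_sec[OF x]] in \<open>simp add: src_AP code_def\<close>)
  then show "\<exists>x \<in> Tm E ?A P. s = sec A P x" using x by blast
qed

end

text \<open>Pulling back the section of y along h gives the section of h^*(y). Under
  \<open>sem\<close> the characterising square reads S_{h^*(y)} (h^*/R) = h^* S_y, compatibility of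
  h^* with substitution.\<close>

lemma tpb_sec:
  assumes h: "h \<in> hom (E2C E r) A B" and B: "B \<in> Over E r" and R: "R \<in> Over E (src E r B)"
    and y: "y \<in> Tm E (src E r B) R"
  shows "CE_system.tpb CE B h R (sec B R y)
    = sec A (pb CE B h R) (ftm (sem r B h) (idn E (src E r B)) R y)"
proof -
  interpret S: CE_system CE by (rule CE_system_E2CE)
  let ?A = "src E r A" and ?B = "src E r B" and ?BR = "cmp E r B R" and ?F = "sem r B h"
  have A: "A \<in> Over E r" by (rule hom_E2C_Over[OF h])
  have ob: "?A \<in> Ob E" "?B \<in> Ob E" using A B root_Ob by (auto simp: src_Ob)
  note F = ctx_ehom[OF ctx_sem[OF root_Ob h B]]
  have fR: "pb CE B h R \<in> Over E ?A" using pb_Over_CE[OF h B R] by (simp add: pb_CE)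
  have BR: "?BR \<in> Over E r" "src E r ?BR = src E ?B R" using AP_Over[OF B R] src_AP[OF B R] by auto
  let ?y = "ftm ?F (idn E ?B) R y"
  have y': "?y \<in> Tm E ?A (pb CE B h R)"
    using ehom_ftm_Tm[OF F ob(2,1) R y] by (simp add: pb_CE)
  note s = sec_hom[OF B R y] and s' = sec_hom[OF A fR y'] and pr = pr2_hom_CE[OF h B R]
  have pr_s': "cmp (E2C E r) ?BR (pr2 CE B h R) (sec A (pb CE B h R) ?y) = cmp (E2C E r) ?BR (sec B R y) h"
  proof (rule hom_E2C_eqI[OF root_Ob cmp_hom[OF root_Ob pr s' BR(1)] cmp_hom[OF root_Ob s h BR(1)] BR(1)])
    have "feq (src E ?B R) (sem r ?BR (cmp (E2C E r) ?BR (pr2 CE B h R) (sec A (pb CE B h R) ?y)))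
      (tcomp (sem r (cmp E r A (pb CE B h R)) (sec A (pb CE B h R) ?y)) (sem r ?BR (pr2 CE B h R)))"
      using sem_cmp[OF root_Ob pr s' BR(1)] by (simp add: BR)
    also have "feq (src E ?B R) \<dots> (tcomp (sem r (cmp E r A (pb CE B h R)) (sec A (pb CE B h R) ?y)) (sl ?B ?F R))"
      by (rule tcomp_cong_right[OF sem_pr2[OF h B R]])
    also have "feq (src E ?B R) \<dots> (tcomp (Sub E ?A (pb CE B h R) ?y) (sl ?B ?F R))"
      using ehom_tfunctor[OF ehom_sl[OF ob(2,1) F R]] sem_sec[OF A fR y']
      by (intro tcomp_cong_left) (auto simp: pb_CE)
    also have "feq (src E ?B R) \<dots> (tcomp ?F (Sub E ?B R y))"
      using ehom_Sub[OF F ob(2,1) R y] by (simp add: pb_CE tfun_eq_sym)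
    also have "feq (src E ?B R) \<dots> (tcomp ?F (sem r ?BR (sec B R y)))"
      by (rule tcomp_cong_right[OF tfun_eq_sym[OF sem_sec[OF B R y]]])
    also have "feq (src E ?B R) \<dots> (sem r ?BR (cmp (E2C E r) ?BR (sec B R y) h))"
      using tfun_eq_sym[OF sem_cmp[OF root_Ob s h BR(1)]] by (simp add: BR)
    finally show "feq (src E r ?BR) (sem r ?BR (cmp (E2C E r) ?BR (pr2 CE B h R) (sec A (pb CE B h R) ?y)))
      (sem r ?BR (cmp (E2C E r) ?BR (sec B R y) h))"
      by (simp add: BR)
  qed
  show ?thesis
    by (rule S.tpb_eqI) (use B h R sec_section[OF B R y] sec_section[OF A fR y'] pr_s' in simp_all)
qed

text \<open>One square for both operations: it is applied to h the section of x with F = S_x, and to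
  h the inclusion of A with F = W_A. Allowing any F equal to h^* on the slice makes both instances
  direct.\<close>

lemma unit_pb_fun:
  assumes h: "h \<in> hom (E2C E r) A B" and B: "B \<in> Over E r" and F: "feq (src E r B) (sem r B h) F"
  shows "feq (src E r B) (tcomp (slice_fun E unit (src E r A)) F)
    (tcomp (pb_fun CE B h) (slice_fun E unit (src E r B)))"
proof -
  interpret S: CE_system CE by (rule CE_system_E2CE)
  let ?A = "src E r A" and ?B = "src E r B" and ?F = "sem r B h"
  have A: "A \<in> Over E r" by (rule hom_E2C_Over[OF h])
  have ob: "?A \<in> Ob E" "?B \<in> Ob E" using A B root_Ob by (auto simp: src_Ob)
  note Fh = ctx_ehom[OF ctx_sem[OF root_Ob h B]]
  note Ft = ehom_tfunctor[OF Fh]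
  have "feq ?B (tcomp (slice_fun E unit ?A) ?F) (tcomp (pb_fun CE B h) (slice_fun E unit ?B))"
  proof (rule tfun_eqI, simp_all add: unit_def pb_CE)
    fix P assume P: "P \<in> Over E ?B"
    note pr = pr2_hom_CE[OF h B P] and BP = AP_Over[OF B P] src_AP[OF B P]
    fix Q assume Q: "Q \<in> Over E (src E ?B P)"
    have QBP: "Q \<in> Over E (src E r (cmp E r B P))" using Q by (simp add: BP)
    show far: "far ?F P Q = fob (sem r (cmp E r B P) (pr2 CE B h P)) Q"
      using tfun_eq_fob[OF sem_pr2[OF h B P], of Q] Q cmp_idn_right[OF ob(2) P] by simp
    fix y assume y: "y \<in> Tm E (src E ?B P) Q"
    note fP = tfunctor_fob_Over[OF Ft P]
    have "ftm (pb_fun CE B h) P Q (sec (bang (src E ?B P)) Q y)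
      = S.tpb (cmp E r B P) (pr2 CE B h P) Q (sec (cmp E r B P) Q y)"
      using S.pb_fun_ftm[of B h A P Q] B h P QBP bang_cmp[OF ob(2) P] bang_src[OF B] by (simp add: BP)
    also have "\<dots> = sec (cmp E r A (pb CE B h P)) (far ?F P Q)
      (ftm (sem r (cmp E r B P) (pr2 CE B h P)) (idn E (src E ?B P)) Q y)"
      using tpb_sec[OF pr BP(1) QBP, of y] y far by (simp add: BP pb_CE)
    also have "ftm (sem r (cmp E r B P) (pr2 CE B h P)) (idn E (src E ?B P)) Q y = ftm ?F P Q y"
      using tfun_eq_ftm[OF sem_pr2[OF h B P], of "idn E (src E ?B P)" Q y] Q y ob P
      by (simp add: idn_Over src_idn src_Ob cmp_idn_right)
    also have "cmp E r A (pb CE B h P) = bang (src E ?A (fob ?F P))"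
      using bang_cmp[OF ob(1) fP] bang_src[OF A] by (simp add: pb_CE)
    finally show "sec (bang (src E ?A (fob ?F P))) (far ?F P Q) (ftm ?F P Q y)
      = ftm (pb_fun CE B h) P Q (sec (bang (src E ?B P)) Q y)" by simp
  qed
  then show ?thesis
    using tcomp_cong_right[OF tfun_eq_sym[OF F]] by (rule tfun_eq_trans[rotated])
qed

lemma pre_E_hom_unit: "pre_E_hom E (CE2E_ob CE) unit"
proof -
  interpret S: CE_system CE by (rule CE_system_E2CE)
  have tf: "tfunctor E (CE2E_ob CE) unit"
    by unfold_locales
      (simp_all add: unit_def bang_Over src_bang bang_cmp sec_section)
  show ?thesis
  proof (rule pre_E_hom.intro[OF tf], unfold_locales)
    show "fob unit r = root (CE2E_ob CE)"
      using bang_src[OF idn_Over[OF root_Ob]] root_Ob by (simp add: unit_def src_idn)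
  next
    fix \<Gamma> A x
    assume \<Gamma>: "\<Gamma> \<in> Ob E" and A: "A \<in> Over E \<Gamma>" and x: "x \<in> Tm E \<Gamma> A"
    let ?b = "bang \<Gamma>"
    have b: "?b \<in> Over E r" "A \<in> Over E (src E r ?b)" "x \<in> Tm E (src E r ?b) A"
      using \<Gamma> A x by (simp_all add: bang_Over src_bang)
    note bA = AP_Over[OF b(1,2)] src_AP[OF b(1,2)]
    show "feq (src E \<Gamma> A) (tcomp (slice_fun E unit \<Gamma>) (Sub E \<Gamma> A x))
      (tcomp (Sub (CE2E_ob CE) (fob unit \<Gamma>) (far unit \<Gamma> A) (ftm unit \<Gamma> A x)) (slice_fun E unit (src E \<Gamma> A)))"
      using unit_pb_fun[OF sec_hom[OF b] bA(1), of "Sub E \<Gamma> A x"] sem_sec[OF b] \<Gamma>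
      by (simp add: bA src_bang) (simp add: unit_def)
  next
    fix \<Gamma> A
    assume \<Gamma>: "\<Gamma> \<in> Ob E" and A: "A \<in> Over E \<Gamma>"
    let ?b = "bang \<Gamma>"
    have b: "?b \<in> Over E r" "A \<in> Over E (src E r ?b)"
      using \<Gamma> A by (simp_all add: bang_Over src_bang)
    note bA = AP_Over[OF b(1,2)] src_AP[OF b(1,2)]
    show "feq \<Gamma> (tcomp (slice_fun E unit (src E \<Gamma> A)) (Wk E \<Gamma> A))
      (tcomp (Wk (CE2E_ob CE) (fob unit \<Gamma>) (far unit \<Gamma> A)) (slice_fun E unit \<Gamma>))"
      using unit_pb_fun[OF Inc_hom[OF b] b(1), of "Wk E \<Gamma> A"] sem_Inc[OF b] \<Gamma>
      by (simp add: bA src_bang) (simp add: unit_def)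
    let ?W = "fob (Wk E \<Gamma> A) A" and ?bA = "cmp E r ?b A" and ?I = "Inc CE ?b A"
    note IW = sem_Inc[OF b, unfolded src_bang[OF \<Gamma>]] and I = Inc_hom[OF b]
    have W: "?W \<in> Over E (src E \<Gamma> A)" by (rule Wk_fob_Over[OF \<Gamma> A A])
    have pbI: "pb CE ?b ?I A = ?W" using tfun_eq_fob[OF IW, of A] A by (simp add: pb_CE)
    have srcA: "src E r ?bA = src E \<Gamma> A" using bA(2) \<Gamma> by (simp add: src_bang)
    have s: "W' \<in> Over E (src E r ?bA) \<longleftrightarrow> W' \<in> Over E (src E \<Gamma> A)" for W' by (simp add: srcA)
    have W': "?W \<in> Over E (src E r ?bA)" and i: "idtm E \<Gamma> A \<in> Tm E (src E r ?bA) ?W"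
      using W idtm_Tm[OF \<Gamma> A] by (simp_all add: srcA)
    note pr = pr2_hom_CE[OF I b] and ss = sec_hom[OF bA(1) W' i]
    \<comment> \<open>The generic section is characterised by its projection. Under
      \<open>sem\<close> this projection becomes S_i (W_A/A) with i the generic term of A, which is
      the identity by \<open>Sub_by_idtm\<close>.\<close>
    have "cmp (E2C E r) ?bA (pr2 CE ?b ?I A) (sec ?bA ?W (idtm E \<Gamma> A)) = idn (E2C E r) ?bA"
    proof (rule hom_E2C_eqI[OF root_Ob cmp_hom[OF root_Ob pr _ bA(1)] idn_hom[OF root_Ob bA(1)] bA(1)])
      show ss': "sec ?bA ?W (idtm E \<Gamma> A) \<in> hom (E2C E r) ?bA (cmp E r ?bA (pb CE ?b ?I A))"
        using ss by (simp add: pbI)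
      have slW: "tfunctor (slice E (src E \<Gamma> A)) (slice E (src E (src E \<Gamma> A) ?W)) (sl \<Gamma> (Wk E \<Gamma> A) A)"
        using ehom_tfunctor[OF ehom_sl[OF \<Gamma> _ Wk_hom[OF \<Gamma> A] A]] \<Gamma> A by (simp add: src_Ob)
      have "feq (src E \<Gamma> A) (sem r ?bA (cmp (E2C E r) ?bA (pr2 CE ?b ?I A) (sec ?bA ?W (idtm E \<Gamma> A))))
        (tcomp (sem r (cmp E r ?bA ?W) (sec ?bA ?W (idtm E \<Gamma> A))) (sem r ?bA (pr2 CE ?b ?I A)))"
        using sem_cmp[OF root_Ob pr ss' bA(1)] by (simp add: srcA pbI)
      also have "feq (src E \<Gamma> A) \<dots> (tcomp (sem r (cmp E r ?bA ?W) (sec ?bA ?W (idtm E \<Gamma> A))) (sl \<Gamma> (Wk E \<Gamma> A) A))"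
        using tfun_eq_trans[OF _ sl_cong[OF \<Gamma> A IW]] sem_pr2[OF I b] \<Gamma>
        by (intro tcomp_cong_right) (simp add: src_bang)
      also have "feq (src E \<Gamma> A) \<dots> (tcomp (Sub E (src E \<Gamma> A) ?W (idtm E \<Gamma> A)) (sl \<Gamma> (Wk E \<Gamma> A) A))"
        using sem_sec[OF bA(1) W' i] by (intro tcomp_cong_left[OF slW]) (simp add: srcA)
      also have "feq (src E \<Gamma> A) \<dots> tid" by (rule Sub_by_idtm[OF \<Gamma> A])
      also have "feq (src E \<Gamma> A) \<dots> (sem r ?bA (idn (E2C E r) ?bA))"
        using tfun_eq_sym[OF sem_idn[OF root_Ob bA(1)]] by (simp add: srcA)
      finally show "feq (src E r ?bA) (sem r ?bA (cmp (E2C E r) ?bA (pr2 CE ?b ?I A) (sec ?bA ?W (idtm E \<Gamma> A))))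
        (sem r ?bA (idn (E2C E r) ?bA))" by (simp add: srcA)
    qed
    then show "ftm unit (src E \<Gamma> A) ?W (idtm E \<Gamma> A) = idtm (CE2E_ob CE) (fob unit \<Gamma>) (far unit \<Gamma> A)"
      using S.section_unique[of ?b ?I ?bA A "sec ?bA ?W (idtm E \<Gamma> A)" "idtm (CE2E_ob CE) ?b A"]
        S.idtm_section[of ?b A] S.pr2_idtm[of ?b A] sec_section[OF bA(1) W' i] I b pbI bang_cmp[OF \<Gamma> A]
      by (simp add: unit_def)
  qed
qed

end

section \<open>The counit\<close>

locale small_CE_system = CE_system S for S :: "('u::infinite, 'u, 'u) cesys"
begin

sublocale L: small_E_system "CE2E_ob S"
  by (simp add: small_E_system_iff E_system_CE2E)

abbreviation o1 :: 'u where "o1 \<equiv> one S"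

lemma o1_Ob: "o1 \<in> Ob F"
  using terminal_one by (simp add: terminal_def)

definition eps :: "'u \<Rightarrow> 'u \<Rightarrow> 'u" where
  "eps B h = (case untag h of (A, f) \<Rightarrow> cmp C (src F o1 B) (pr2 S o1 (Inc S o1 A) B) f)"

definition epsF :: "('u, 'u, 'u, 'u) fnct" where "epsF = \<lparr>fob = src F o1, far = \<lambda>A P. P\<rparr>"
definition epsC :: "('u, 'u, 'u, 'u) fnct" where "epsC = \<lparr>fob = src F o1, far = eps\<rparr>"

text \<open>The functor f^* of the E-system is the pullback functor along I(A), sliced over B,
  followed by that along the section f. By \<open>pb_fun_slice\<close> this is pullback along
  \<pi>_2(I(A), B) f, so \<open>eps\<close> preserves the functor of an arrow.\<close>

lemma
  assumes h: "h \<in> hom (E2C E o1) A B" and B: "B \<in> Over F o1"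
  shows eps_hom: "eps B h \<in> hom C (src F o1 A) (src F o1 B)"
    and Inc_eps: "cmp C o1 (Inc S o1 B) (eps B h) = Inc S o1 A"
    and sem_eps: "feq (src F o1 B) (L.sem o1 B h) (pb_fun S (src F o1 B) (eps B h))"
proof -
  obtain f where f: "f \<in> sections S (src F o1 A) (pb S o1 (Inc S o1 A) B)" "h = tag (A, f)" and A: "A \<in> Over F o1"
    using h by (auto simp: L.hom_E2C_iff thom_def)
  note I = Inc_hom[OF o1_Ob A] and fh = sections_hom[OF f(1)]
  note p = pr2_hom[OF o1_Ob I B] and obA = F.src_Ob[OF o1_Ob A] and obB = F.src_Ob[OF o1_Ob B]
    and W = pb_Over[OF o1_Ob I B]
  have e: "eps B h = cmp C (src F o1 B) (pr2 S o1 (Inc S o1 A) B) f"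
    by (simp add: eps_def f(2))
  show "eps B h \<in> hom C (src F o1 A) (src F o1 B)"
    unfolding e by (rule C_cmp_hom[OF obB p fh])
  show "cmp C o1 (Inc S o1 B) (eps B h) = Inc S o1 A"
    unfolding e using C_assoc[OF o1_Ob Inc_hom[OF o1_Ob B] p fh] Inc_pr2[OF o1_Ob I B]
      C_assoc[OF o1_Ob I Inc_hom[OF obA W] fh] sections_cmp[OF f(1)] C_idn_right[OF o1_Ob I] by simp
  have "feq (src F o1 B) (L.sem o1 B h) (tcomp (pb_fun S (src F (src F o1 A) (pb S o1 (Inc S o1 A) B)) f)
    (pb_fun S (src F o1 B) (pr2 S o1 (Inc S o1 A) B)))"
    using tcomp_cong_right[OF pb_fun_slice[OF o1_Ob I B]] by (simp add: L.sem_def f(2) tstar_def)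
  also have "feq (src F o1 B) \<dots> (pb_fun S (src F o1 B) (eps B h))"
    unfolding e by (rule tfun_eq_sym[OF pb_fun_cmp[OF obB p fh]])
  finally show "feq (src F o1 B) (L.sem o1 B h) (pb_fun S (src F o1 B) (eps B h))" .
qed

text \<open>An arrow g over 1 is recovered from its pullback functor. The code of that functor is
  the generic section of B pulled back along g, and since I(A) = I(B) g, \<open>pr2_tpb_idtm\<close>
  says that its projection is g.\<close>

lemma eps_arr:
  assumes A: "A \<in> Over F o1" and B: "B \<in> Over F o1" and g: "g \<in> hom C (src F o1 A) (src F o1 B)"
    and Ig: "cmp C o1 (Inc S o1 B) g = Inc S o1 A"
    and G: "feq (src F o1 B) G (pb_fun S (src F o1 B) g)"
  shows "eps B (L.arr o1 A B G) = g"
proof -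
  let ?B = "src F o1 B" and ?W = "pb S o1 (Inc S o1 B) B"
  note obB = F.src_Ob[OF o1_Ob B] and W = pb_Over[OF o1_Ob Inc_hom[OF o1_Ob B] B]
  have "L.code o1 B G = tpb ?B g ?W (idtm E o1 B)"
    using tfun_eq_ftm[OF G, of "idn F ?B" ?W "idtm E o1 B"] idtm_section[OF o1_Ob B] W obB
      pb_fun_ftm[OF obB g F.idn_Over[OF obB], of ?W] pr2_idn[OF obB g]
    by (simp add: L.code_def F_simps)
  then show ?thesis
    using pr2_tpb_idtm[OF o1_Ob B g] by (simp add: eps_def L.arr_def Ig)
qed

text \<open>The identity, composition, inclusion and projection clauses follow by presenting the
  arrow by its functor, recognising that functor as a pullback functor along an arrow over 1, and
  applying \<open>eps_arr\<close>.\<close>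

lemma CE_hom_eps: "CE_hom L.CE S epsF epsC"
proof (rule CE_hom.intro, simp_all add: epsF_def epsC_def)
  show "strict_functor (slice_cat E o1) F \<lparr>fob = src F o1, far = \<lambda>A P. P\<rparr>"
    by unfold_locales (use o1_Ob in \<open>auto simp: F_simps\<close>)
  show "src F o1 (idn F o1) = o1" by (rule F.src_idn[OF o1_Ob])
  show "strict_functor (E2C E o1) C \<lparr>fob = src F o1, far = eps\<rparr>"
  proof (unfold_locales, simp_all add: same_Ob F.src_Ob o1_Ob, goal_cases)
    case (1 B h)
    then obtain A where "h \<in> hom (E2C E o1) A B" by (auto simp: L.Over_E2C_iff)
    then show ?case using eps_hom[of h A B] 1 by (simp add: hom_def)
  next
    case (2 B h)
    then obtain A where h: "h \<in> hom (E2C E o1) A B" by (auto simp: L.Over_E2C_iff)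
    then show ?case using eps_hom[OF h] 2 by (simp add: L.src_E2C hom_iff[of _ C])
  next
    case (3 A)
    note obA = F.src_Ob[OF o1_Ob 3]
    show ?case
      unfolding L.idn_E2C
      by (rule eps_arr[OF 3 3 C_idn_hom[OF obA] C_idn_right[OF o1_Ob Inc_hom[OF o1_Ob 3]]
            tfun_eq_sym[OF pb_fun_idn[OF obA]]])
  next
    case (4 X h k)
    have X: "X \<in> Over F o1" by (rule 4(1))
    from 4 obtain B A where h: "h \<in> hom (E2C E o1) B X" and k: "k \<in> hom (E2C E o1) A B"
      by (auto simp: L.Over_E2C_iff L.src_E2C)
    have A: "A \<in> Over F o1" and B: "B \<in> Over F o1" using L.hom_E2C_Over h k by fastforce+
    have r: "o1 \<in> Ob E" using o1_Ob by simp
    have X': "X \<in> Over E o1" and B': "B \<in> Over E o1" using X B by simp_all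
    note eh = eps_hom[OF h X] and ek = eps_hom[OF k B] and obX = F.src_Ob[OF o1_Ob X]
    note hk = C_cmp_hom[OF obX eh ek]
    have "cmp C o1 (Inc S o1 X) (cmp C (src F o1 X) (eps X h) (eps B k)) = Inc S o1 A"
      using C_assoc[OF o1_Ob Inc_hom[OF o1_Ob X] eh ek] Inc_eps[OF h X] Inc_eps[OF k B] by simp
    moreover have "feq (src F o1 X) (tcomp (L.sem o1 B k) (L.sem o1 X h))
      (pb_fun S (src F o1 X) (cmp C (src F o1 X) (eps X h) (eps B k)))"
    proof -
      have "feq (src F o1 X) (tcomp (L.sem o1 B k) (L.sem o1 X h))
        (tcomp (L.sem o1 B k) (pb_fun S (src F o1 X) (eps X h)))"
        by (rule tcomp_cong_right[OF sem_eps[OF h X]])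
      also have "feq (src F o1 X) \<dots> (tcomp (pb_fun S (src F o1 B) (eps B k)) (pb_fun S (src F o1 X) (eps X h)))"
        by (rule tcomp_cong_left[OF tfunctor_pb_fun[OF obX eh] sem_eps[OF k B]])
      also have "feq (src F o1 X) \<dots> (pb_fun S (src F o1 X) (cmp C (src F o1 X) (eps X h) (eps B k)))"
        by (rule tfun_eq_sym[OF pb_fun_cmp[OF obX eh ek]])
      finally show ?thesis .
    qed
    ultimately have "eps X (L.arr o1 A X (tcomp (L.sem o1 B k) (L.sem o1 X h)))
      = cmp C (src F o1 X) (eps X h) (eps B k)"
      by (rule eps_arr[OF A X hk])
    then show ?case
      by (simp add: L.src_E2C[OF h] L.cmp_E2C[OF r h k X'])
  qed
next
  fix A Q assume A: "A \<in> Over F o1" and Q: "Q \<in> Over F (src F o1 A)"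
  note obA = F.src_Ob[OF o1_Ob A]
  have AQ: "cmp F o1 A Q \<in> Over F o1" "src F o1 (cmp F o1 A Q) = src F (src F o1 A) Q"
    using A Q o1_Ob by (simp_all add: F_simps)
  have "eps A (L.arr o1 (cmp F o1 A Q) A (pb_fun S (src F o1 A) (Inc S (src F o1 A) Q))) = Inc S (src F o1 A) Q"
    by (rule eps_arr[OF AQ(1) A]) (use Inc_hom[OF obA Q] Inc_cmp[OF o1_Ob A Q] AQ in simp_all)
  then show "eps A (Inc L.CE A Q) = Inc S (src F o1 A) Q"
    using L.Inc_CE[of A Q] by simp
next
  fix B h A R
  assume B: "B \<in> Over F o1" and h: "h \<in> hom (E2C E o1) A B" and R: "R \<in> Over F (src F o1 B)"
  let ?A = "src F o1 A" and ?B = "src F o1 B"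
  have A: "A \<in> Over F o1" using L.hom_E2C_Over[OF h] by simp
  note obA = F.src_Ob[OF o1_Ob A] and obB = F.src_Ob[OF o1_Ob B]
  note e = eps_hom[OF h B] and se = sem_eps[OF h B]
  have pbE: "pb L.CE B h R = fob (L.sem o1 B h) R" using L.pb_CE[of B h R] by simp
  show pb: "pb L.CE B h R = pb S ?B (eps B h) R"
    using tfun_eq_fob[OF se, of R] R by (simp add: pbE)
  note eR = pb_Over[OF obB e R] and p = pr2_hom[OF obB e R]
  have BR: "cmp F o1 B R \<in> Over F o1" "src F o1 (cmp F o1 B R) = src F ?B R"
    and AR: "cmp F o1 A (pb S ?B (eps B h) R) \<in> Over F o1"
      "src F o1 (cmp F o1 A (pb S ?B (eps B h) R)) = src F ?A (pb S ?B (eps B h) R)"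
    using A B R eR o1_Ob by (simp_all add: F_simps)
  have "pr2 L.CE B h R = L.arr o1 (cmp F o1 A (pb S ?B (eps B h) R)) (cmp F o1 B R) (L.sl ?B (L.sem o1 B h) R)"
    using L.pr2_CE[of h A B R] h B R pb by (simp add: pbE)
  moreover have "eps (cmp F o1 B R) \<dots> = pr2 S ?B (eps B h) R"
  proof (rule eps_arr[OF AR(1) BR(1)])
    show "pr2 S ?B (eps B h) R \<in> hom C (src F o1 (cmp F o1 A (pb S ?B (eps B h) R))) (src F o1 (cmp F o1 B R))"
      using p by (simp add: AR BR)
    have "cmp C o1 (Inc S o1 (cmp F o1 B R)) (pr2 S ?B (eps B h) R)
      = cmp C o1 (Inc S o1 B) (cmp C ?B (eps B h) (Inc S ?A (pb S ?B (eps B h) R)))"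
      using C_assoc[OF o1_Ob Inc_hom[OF o1_Ob B] Inc_hom[OF obB R] p] Inc_pr2[OF obB e R]
      by (simp add: Inc_cmp[OF o1_Ob B R])
    also have "\<dots> = Inc S o1 (cmp F o1 A (pb S ?B (eps B h) R))"
      using C_assoc[OF o1_Ob Inc_hom[OF o1_Ob B] e Inc_hom[OF obA eR]] Inc_eps[OF h B]
      by (simp add: Inc_cmp[OF o1_Ob A eR])
    finally show "cmp C o1 (Inc S o1 (cmp F o1 B R)) (pr2 S ?B (eps B h) R)
      = Inc S o1 (cmp F o1 A (pb S ?B (eps B h) R))" .
    show "feq (src F o1 (cmp F o1 B R)) (L.sl ?B (L.sem o1 B h) R)
       (pb_fun S (src F o1 (cmp F o1 B R)) (pr2 S ?B (eps B h) R))"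
      using tfun_eq_trans[OF _ pb_fun_slice[OF obB e R]] L.sl_cong[of ?B R, OF _ _ se] obB R by (simp add: BR)
  qed
  ultimately show "eps (cmp F o1 B R) (pr2 L.CE B h R) = pr2 S ?B (eps B h) R" by simp
qed

end

section \<open>Isomorphisms\<close>

lemma strict_functor_inverse:
  assumes "strict_category C" and "strict_functor C D F"
    and GF_ob: "\<And>\<Gamma>. \<Gamma> \<in> Ob C \<Longrightarrow> fob G (fob F \<Gamma>) = \<Gamma>"
    and GF_ar: "\<And>\<Gamma> A. \<lbrakk>\<Gamma> \<in> Ob C; A \<in> Over C \<Gamma>\<rbrakk> \<Longrightarrow> far G (fob F \<Gamma>) (far F \<Gamma> A) = A"
    and G_ob: "\<And>\<Delta>. \<Delta> \<in> Ob D \<Longrightarrow> fob G \<Delta> \<in> Ob C"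
    and FG_ob: "\<And>\<Delta>. \<Delta> \<in> Ob D \<Longrightarrow> fob F (fob G \<Delta>) = \<Delta>"
    and G_ar: "\<And>\<Delta> B. \<lbrakk>\<Delta> \<in> Ob D; B \<in> Over D \<Delta>\<rbrakk> \<Longrightarrow> far G \<Delta> B \<in> Over C (fob G \<Delta>)"
    and FG_ar: "\<And>\<Delta> B. \<lbrakk>\<Delta> \<in> Ob D; B \<in> Over D \<Delta>\<rbrakk> \<Longrightarrow> far F (fob G \<Delta>) (far G \<Delta> B) = B"
  shows "strict_functor D C G"
proof -
  interpret strict_category C by fact
  interpret F: strict_functor C D F by fact
  have src: "src C (fob G \<Delta>) (far G \<Delta> B) = fob G (src D \<Delta> B)" if "\<Delta> \<in> Ob D" "B \<in> Over D \<Delta>" for \<Delta> B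
    using GF_ob[of "src C (fob G \<Delta>) (far G \<Delta> B)"] F.src_far[of "fob G \<Delta>" "far G \<Delta> B"] that
    by (simp add: G_ob G_ar FG_ob FG_ar src_Ob)
  show ?thesis
  proof
    fix \<Delta> assume \<Delta>: "\<Delta> \<in> Ob D"
    then show "fob G \<Delta> \<in> Ob C" by (rule G_ob)
    show "far G \<Delta> (idn D \<Delta>) = idn C (fob G \<Delta>)"
      using GF_ar[of "fob G \<Delta>" "idn C (fob G \<Delta>)"] \<Delta> by (simp add: G_ob FG_ob F.far_idn idn_Over)
    fix B assume B: "B \<in> Over D \<Delta>"
    show "far G \<Delta> B \<in> Over C (fob G \<Delta>)" by (rule G_ar[OF \<Delta> B])
    show "src C (fob G \<Delta>) (far G \<Delta> B) = fob G (src D \<Delta> B)" by (rule src[OF \<Delta> B])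
    fix Q assume Q: "Q \<in> Over D (src D \<Delta> B)"
    have obB: "src D \<Delta> B \<in> Ob D"
      using F.fob_Ob[of "src C (fob G \<Delta>) (far G \<Delta> B)"] F.src_far[of "fob G \<Delta>" "far G \<Delta> B"] \<Delta> B
      by (simp add: G_ob G_ar FG_ob FG_ar src_Ob)
    let ?c = "cmp C (fob G \<Delta>) (far G \<Delta> B) (far G (src D \<Delta> B) Q)"
    have "far F (fob G \<Delta>) ?c = cmp D \<Delta> B Q"
      using F.far_cmp[of "fob G \<Delta>" "far G \<Delta> B" "far G (src D \<Delta> B) Q"] \<Delta> B Q obB G_ar[OF obB Q] src[OF \<Delta> B]
      by (simp add: G_ob G_ar FG_ob FG_ar)
    then show "far G \<Delta> (cmp D \<Delta> B Q) = ?c"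
      using GF_ar[of "fob G \<Delta>" ?c] \<Delta> B Q G_ar[OF obB Q] src[OF \<Delta> B]
      by (simp add: G_ob G_ar FG_ob cmp_Over)
  qed
qed

text \<open>Conjugation: with y = H(x), K S_y = K S_y H K = K H S_x K = S_x K, each functor
  restricted to the relevant slice; the same works for weakening.\<close>

lemma pre_E_hom_inverse:
  assumes E: "E_system E" and D: "E_system D" and H: "pre_E_hom E D H"
    and bij_ob: "bij_betw (fob H) (Ob E) (Ob D)"
    and bij_ar: "\<And>\<Gamma>. \<Gamma> \<in> Ob E \<Longrightarrow> bij_betw (far H \<Gamma>) (Over E \<Gamma>) (Over D (fob H \<Gamma>))"
    and bij_tm: "\<And>\<Gamma> A. \<lbrakk>\<Gamma> \<in> Ob E; A \<in> Over E \<Gamma>\<rbrakk>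
      \<Longrightarrow> bij_betw (ftm H \<Gamma> A) (Tm E \<Gamma> A) (Tm D (fob H \<Gamma>) (far H \<Gamma> A))"
  obtains K where "pre_E_hom D E K" "tfun_eq E (tcomp K H) tid" "tfun_eq D (tcomp H K) tid"
proof -
  interpret E: E_system E by fact
  interpret D: E_system D by fact
  interpret H: pre_E_hom E D H by fact
  define ob where "ob = inv_into (Ob E) (fob H)"
  define ar where "ar \<Delta> = inv_into (Over E (ob \<Delta>)) (far H (ob \<Delta>))" for \<Delta>
  define K where "K = \<lparr>fob = ob, far = ar,
    ftm = \<lambda>\<Delta> B. inv_into (Tm E (ob \<Delta>) (ar \<Delta> B)) (ftm H (ob \<Delta>) (ar \<Delta> B))\<rparr>"
  have KH_ob: "ob (fob H \<Gamma>) = \<Gamma>" if "\<Gamma> \<in> Ob E" for \<Gamma>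
    using bij_betw_inv_into_left[OF bij_ob that] by (simp add: ob_def)
  have KH_ar: "ar (fob H \<Gamma>) (far H \<Gamma> A) = A" if "\<Gamma> \<in> Ob E" "A \<in> Over E \<Gamma>" for \<Gamma> A
    using bij_betw_inv_into_left[OF bij_ar that(2)] that by (simp add: ar_def KH_ob)
  have HK_ob: "ob \<Delta> \<in> Ob E" "fob H (ob \<Delta>) = \<Delta>" if "\<Delta> \<in> Ob D" for \<Delta>
    using bij_betw_inv_into_right[OF bij_ob that] bij_betwE[OF bij_betw_inv_into[OF bij_ob]] that
    by (simp_all add: ob_def)
  have HK_ar: "ar \<Delta> B \<in> Over E (ob \<Delta>)" "far H (ob \<Delta>) (ar \<Delta> B) = B" if "\<Delta> \<in> Ob D" "B \<in> Over D \<Delta>" for \<Delta> B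
    using bij_betw_inv_into_right[OF bij_ar[of "ob \<Delta>"], of B]
      bij_betwE[OF bij_betw_inv_into[OF bij_ar[of "ob \<Delta>"]]] that
    by (simp_all add: ar_def HK_ob)
  have HK_tm: "ftm K \<Delta> B y \<in> Tm E (ob \<Delta>) (ar \<Delta> B)" "ftm H (ob \<Delta>) (ar \<Delta> B) (ftm K \<Delta> B y) = y"
    if "\<Delta> \<in> Ob D" "B \<in> Over D \<Delta>" "y \<in> Tm D \<Delta> B" for \<Delta> B y
    using bij_betw_inv_into_right[OF bij_tm[of "ob \<Delta>" "ar \<Delta> B"], of y]
      bij_betwE[OF bij_betw_inv_into[OF bij_tm[of "ob \<Delta>" "ar \<Delta> B"]]] that
    by (simp_all add: K_def HK_ob HK_ar)
  have KH: "tfun_eq E (tcomp K H) tid"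
    using bij_betw_inv_into_left[OF bij_tm] by (auto intro!: tfun_eqI simp: K_def KH_ob KH_ar)
  have HK: "tfun_eq D (tcomp H K) tid"
    using HK_ob HK_ar HK_tm by (auto intro!: tfun_eqI simp: K_def)
  have "strict_functor D E K"
    by (rule strict_functor_inverse[OF E.cat H.strict_functor_axioms])
      (simp_all add: K_def KH_ob KH_ar HK_ob HK_ar)
  then have K: "tfunctor D E K"
    by (rule tfunctor.intro) (unfold_locales, use HK_tm in \<open>simp add: K_def\<close>)
  interpret K: tfunctor D E K by fact
  note [simp] = D.src_Ob
  have slHK: "tfun_eq (slice D \<Delta>) (tcomp (slice_fun E H (fob K \<Delta>)) (slice_fun D K \<Delta>)) tid" if "\<Delta> \<in> Ob D" for \<Delta>
    using tfun_eq_trans[OF tfun_eq_sym[OF slice_fun_tcomp[OF K that, of H]] slice_fun_cong[OF D.cat HK that]] by simp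
  have slKH: "tfun_eq (slice E \<Gamma>) (tcomp (slice_fun D K (fob H \<Gamma>)) (slice_fun E H \<Gamma>)) tid" if "\<Gamma> \<in> Ob E" for \<Gamma>
    using tfun_eq_trans[OF tfun_eq_sym[OF slice_fun_tcomp[OF H.tfunctor_axioms that, of K]] slice_fun_cong[OF E.cat KH that]] by simp
  note slK = tfunctor_slice_fun[OF D.cat K]
  have "pre_E_hom D E K"
  proof (rule pre_E_hom.intro[OF K], unfold_locales)
    have "root E \<in> Ob E" using E.terminal_root by (simp add: terminal_def)
    then show "fob K (root D) = root E"
      using tfun_eq_fob[OF KH, of "root E"] by (simp add: H.hom_root)
  next
    fix \<Delta> B y assume *: "\<Delta> \<in> Ob D" "B \<in> Over D \<Delta>" "y \<in> Tm D \<Delta> B"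
    let ?G = "fob K \<Delta>" and ?A = "far K \<Delta> B" and ?x = "ftm K \<Delta> B y" and ?DB = "src D \<Delta> B"
    have EK: "?G \<in> Ob E" "?A \<in> Over E ?G" "?x \<in> Tm E ?G ?A" "src E ?G ?A = fob K ?DB"
      using K.fob_Ob K.far_Over K.ftm_Tm K.src_far * by auto
    have HK': "fob H ?G = \<Delta>" "far H ?G ?A = B" "ftm H ?G ?A ?x = y"
      using tfun_eq_fob[OF HK *(1)] tfun_eq_far[OF HK *(1,2)] tfun_eq_ftm[OF HK *] by simp_all
    note tfS = tfunctor_tcomp[OF strict_category_slice[OF D.cat] slK E.Sub_functor[OF EK(1-3), unfolded EK(4)]]
    have "tfun_eq (slice D ?DB) (tcomp (slice_fun D K \<Delta>) (Sub D \<Delta> B y))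
      (tcomp (tcomp (slice_fun D K \<Delta>) (Sub D \<Delta> B y)) (tcomp (slice_fun E H (fob K ?DB)) (slice_fun D K ?DB)))"
      using tcomp_cong_right[OF tfun_eq_sym[OF slHK[of ?DB]]] * by fastforce
    also have "tfun_eq (slice D ?DB) \<dots>
      (tcomp (slice_fun D K \<Delta>) (tcomp (tcomp (slice_fun E H ?G) (Sub E ?G ?A ?x)) (slice_fun D K ?DB)))"
      using tcomp_cong_left[OF slK[of ?DB] tfun_eq_sym[OF H.hom_Sub[OF EK(1-3), unfolded EK(4)]]] *
      unfolding tcomp_assoc by (intro tcomp_cong_right) (simp add: HK' tcomp_assoc)
    also have "tfun_eq (slice D ?DB) \<dots> (tcomp tid (tcomp (Sub E ?G ?A ?x) (slice_fun D K ?DB)))"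
      using tcomp_cong_left[OF tfS slKH[OF EK(1)]] * by (simp add: HK' tcomp_assoc)
    finally show "tfun_eq (slice D ?DB) (tcomp (slice_fun D K \<Delta>) (Sub D \<Delta> B y))
      (tcomp (Sub E ?G ?A ?x) (slice_fun D K ?DB))" by simp
  next
    fix \<Delta> B assume *: "\<Delta> \<in> Ob D" "B \<in> Over D \<Delta>"
    let ?G = "fob K \<Delta>" and ?A = "far K \<Delta> B" and ?DB = "src D \<Delta> B"
    have EK: "?G \<in> Ob E" "?A \<in> Over E ?G" "src E ?G ?A = fob K ?DB"
      using K.fob_Ob K.far_Over K.src_far * by auto
    have HK': "fob H ?G = \<Delta>" "far H ?G ?A = B" "fob H (fob K ?DB) = ?DB"
      using tfun_eq_fob[OF HK *(1)] tfun_eq_far[OF HK *(1,2)] tfun_eq_fob[OF HK, of ?DB] * by simp_all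
    note tfW = tfunctor_tcomp[OF strict_category_slice[OF D.cat] slK E.Wk_functor[OF EK(1,2), unfolded EK(3)]]
    have "tfun_eq (slice D \<Delta>) (tcomp (slice_fun D K ?DB) (Wk D \<Delta> B))
      (tcomp (tcomp (slice_fun D K ?DB) (Wk D \<Delta> B)) (tcomp (slice_fun E H ?G) (slice_fun D K \<Delta>)))"
      using tcomp_cong_right[OF tfun_eq_sym[OF slHK[of \<Delta>]]] * by fastforce
    also have "tfun_eq (slice D \<Delta>) \<dots>
      (tcomp (slice_fun D K ?DB) (tcomp (tcomp (slice_fun E H (fob K ?DB)) (Wk E ?G ?A)) (slice_fun D K \<Delta>)))"
      using tcomp_cong_left[OF slK[of \<Delta>] tfun_eq_sym[OF H.hom_Wk[OF EK(1,2), unfolded EK(3)]]] *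
      unfolding tcomp_assoc by (intro tcomp_cong_right) (simp add: HK' tcomp_assoc)
    also have "tfun_eq (slice D \<Delta>) \<dots> (tcomp tid (tcomp (Wk E ?G ?A) (slice_fun D K \<Delta>)))"
      using tcomp_cong_left[OF tfW slKH[of "fob K ?DB"]] * K.fob_Ob[of ?DB] by (simp add: HK' tcomp_assoc)
    finally show "tfun_eq (slice D \<Delta>) (tcomp (slice_fun D K ?DB) (Wk D \<Delta> B))
      (tcomp (Wk E ?G ?A) (slice_fun D K \<Delta>))" by simp
    have W: "fob (Wk E ?G ?A) ?A \<in> Over E (fob K ?DB)"
      using E.Wk_fob_Over[OF EK(1,2,2)] by (simp add: EK(3))
    have "far H (fob K ?DB) (fob (Wk E ?G ?A) ?A) = fob (Wk D \<Delta> B) B"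
      using tfun_eq_fob[OF H.hom_Wk[OF EK(1,2)], of ?A] EK by (simp add: HK')
    moreover have "ftm H (fob K ?DB) (fob (Wk E ?G ?A) ?A) (idtm E ?G ?A) = idtm D \<Delta> B"
      using H.hom_idtm[OF EK(1,2)] by (simp add: EK(3) HK')
    ultimately show "ftm K ?DB (fob (Wk D \<Delta> B) B) (idtm D \<Delta> B) = idtm E ?G ?A"
      using tfun_eq_ftm[OF KH _ W, of "idtm E ?G ?A"] E.idtm_Tm[OF EK(1,2)] K.fob_Ob[of ?DB] * HK'(3)
      by (simp add: EK(3))
  qed
  then show thesis by (rule that[OF _ KH HK])
qed

text \<open>The structure of a CE-system is equational, so its preservation passes to inverse
  bijections: each law for the inverse is the corresponding law of the given homomorphism read at
  preimages.\<close>

lemma CE_hom_inverse: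
  assumes S: "CE_system S" and S': "CE_system S'" and H: "CE_hom S S' FF FC"
    and bij_ob: "bij_betw (fob FF) (Ob (Fam S)) (Ob (Fam S'))"
    and bij_ar: "\<And>\<Gamma>. \<Gamma> \<in> Ob (Fam S) \<Longrightarrow> bij_betw (far FF \<Gamma>) (Over (Fam S) \<Gamma>) (Over (Fam S') (fob FF \<Gamma>))"
    and bij_con: "\<And>\<Gamma>. \<Gamma> \<in> Ob (Fam S) \<Longrightarrow> bij_betw (far FC \<Gamma>) (Over (Con S) \<Gamma>) (Over (Con S') (fob FF \<Gamma>))"
  obtains GF GC where "CE_hom S' S GF GC"
    "fun_eq (Fam S) (fcomp GF FF) fid" "fun_eq (Fam S') (fcomp FF GF) fid"
    "fun_eq (Con S) (fcomp GC FC) fid" "fun_eq (Con S') (fcomp FC GC) fid"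
proof -
  interpret S: CE_system S by fact
  interpret S': CE_system S' by fact
  interpret H: CE_hom S S' FF FC by fact
  define ob where "ob = inv_into (Ob (Fam S)) (fob FF)"
  define GF where "GF = \<lparr>fob = ob, far = \<lambda>\<Delta>. inv_into (Over (Fam S) (ob \<Delta>)) (far FF (ob \<Delta>))\<rparr>"
  define GC where "GC = \<lparr>fob = ob, far = \<lambda>\<Delta>. inv_into (Over (Con S) (ob \<Delta>)) (far FC (ob \<Delta>))\<rparr>"
  have ob: "fob GF = ob" "fob GC = ob" by (simp_all add: GF_def GC_def)
  have GF_ob: "ob (fob FF \<Gamma>) = \<Gamma>" if "\<Gamma> \<in> Ob (Fam S)" for \<Gamma>
    using bij_betw_inv_into_left[OF bij_ob that] by (simp add: ob_def)
  have FG_ob: "ob \<Delta> \<in> Ob (Fam S)" "fob FF (ob \<Delta>) = \<Delta>" if "\<Delta> \<in> Ob (Fam S')" for \<Delta>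
    using bij_betw_inv_into_right[OF bij_ob that] bij_betwE[OF bij_betw_inv_into[OF bij_ob]] that
    by (simp_all add: ob_def)
  have GF_ar: "far GF (fob FF \<Gamma>) (far FF \<Gamma> A) = A" if "\<Gamma> \<in> Ob (Fam S)" "A \<in> Over (Fam S) \<Gamma>" for \<Gamma> A
    using bij_betw_inv_into_left[OF bij_ar that(2)] that by (simp add: GF_def GF_ob)
  have FG_ar: "far GF \<Delta> B \<in> Over (Fam S) (ob \<Delta>)" "far FF (ob \<Delta>) (far GF \<Delta> B) = B"
    if "\<Delta> \<in> Ob (Fam S')" "B \<in> Over (Fam S') \<Delta>" for \<Delta> B
    using bij_betw_inv_into_right[OF bij_ar[of "ob \<Delta>"], of B]
      bij_betwE[OF bij_betw_inv_into[OF bij_ar[of "ob \<Delta>"]]] that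
    by (simp_all add: GF_def FG_ob)
  have GF_con: "far GC (fob FF \<Gamma>) (far FC \<Gamma> A) = A" if "\<Gamma> \<in> Ob (Fam S)" "A \<in> Over (Con S) \<Gamma>" for \<Gamma> A
    using bij_betw_inv_into_left[OF bij_con that(2)] that by (simp add: GC_def GF_ob)
  have FG_con: "far GC \<Delta> B \<in> Over (Con S) (ob \<Delta>)" "far FC (ob \<Delta>) (far GC \<Delta> B) = B"
    if "\<Delta> \<in> Ob (Fam S')" "B \<in> Over (Con S') \<Delta>" for \<Delta> B
    using bij_betw_inv_into_right[OF bij_con[of "ob \<Delta>"], of B]
      bij_betwE[OF bij_betw_inv_into[OF bij_con[of "ob \<Delta>"]]] that
    by (simp_all add: GC_def FG_ob)
  have functor_GF: "strict_functor (Fam S') (Fam S) GF"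
    by (rule strict_functor_inverse[OF S.Fam_category H.functor_Fam])
      (simp_all add: ob GF_ob FG_ob GF_ar FG_ar)
  have functor_GC: "strict_functor (Con S') (Con S) GC"
    by (rule strict_functor_inverse[OF S.Con_category H.functor_Con])
      (simp_all add: ob S.same_Ob S'.same_Ob H.commute_Ob GF_ob FG_ob GF_con FG_con)
  note src_GF = strict_functor.src_far[OF functor_GF, unfolded ob]
  have "CE_hom S' S GF GC"
  proof (rule CE_hom.intro[OF functor_GF functor_GC], simp_all add: ob)
    show "ob (one S') = one S"
      using GF_ob[of "one S"] S.terminal_one by (simp add: H.hom_one terminal_def)
    show "far GC \<Delta> (Inc S' \<Delta> B) = Inc S (ob \<Delta>) (far GF \<Delta> B)"
      if "\<Delta> \<in> Ob (Fam S')" "B \<in> Over (Fam S') \<Delta>" for \<Delta> B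
      using H.commute_Inc[of "ob \<Delta>" "far GF \<Delta> B"] GF_con[of "ob \<Delta>" "Inc S (ob \<Delta>) (far GF \<Delta> B)"]
        S.Inc_hom[of "ob \<Delta>" "far GF \<Delta> B"] that by (simp add: FG_ob FG_ar hom_iff)
  next
    fix \<Delta> f \<Theta> B
    assume \<Delta>: "\<Delta> \<in> Ob (Fam S')" and f: "f \<in> hom (Con S') \<Theta> \<Delta>" and B: "B \<in> Over (Fam S') \<Delta>"
    have f': "f \<in> Over (Con S') \<Delta>" "src (Con S') \<Delta> f = \<Theta>" using f by (simp_all add: hom_iff)
    note \<Theta> = S'.C_hom_Ob[OF \<Delta> f] and o\<Delta> = FG_ob[OF \<Delta>] and GB = FG_ar[OF \<Delta> B] and Gf = FG_con[OF \<Delta> f'(1)]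
    have Gf': "far GC \<Delta> f \<in> hom (Con S) (ob \<Theta>) (ob \<Delta>)"
      using strict_functor.src_far[OF functor_GC, of \<Delta> f] Gf f' \<Delta> by (simp add: hom_iff ob S'.same_Ob)
    show "far GF \<Theta> (pb S' \<Delta> f B) = pb S (ob \<Delta>) (far GC \<Delta> f) (far GF \<Delta> B)"
      using H.hom_pb[OF o\<Delta>(1) Gf' GB(1)] GF_ar[OF FG_ob(1)[OF \<Theta>] S.pb_Over[OF o\<Delta>(1) Gf' GB(1)]]
      by (simp add: o\<Delta> GB Gf FG_ob(2)[OF \<Theta>])
    have obB: "ob (src (Fam S') \<Delta> B) = src (Fam S) (ob \<Delta>) (far GF \<Delta> B)"
      using src_GF[OF \<Delta> B] by simp
    have p: "pr2 S (ob \<Delta>) (far GC \<Delta> f) (far GF \<Delta> B) \<in> Over (Con S) (ob (src (Fam S') \<Delta> B))"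
      using S.pr2_hom[OF o\<Delta>(1) Gf' GB(1)] by (simp add: hom_iff obB)
    note oB = FG_ob[OF S'.F.src_Ob[OF \<Delta> B]]
    show "far GC (src (Fam S') \<Delta> B) (pr2 S' \<Delta> f B) = pr2 S (ob \<Delta>) (far GC \<Delta> f) (far GF \<Delta> B)"
      using H.hom_pr2[OF o\<Delta>(1) Gf' GB(1)] GF_con[OF oB(1) p] oB(2)
      by (simp add: o\<Delta> GB Gf obB[symmetric])
  qed
  then show thesis
    by (rule that)
      (auto simp: fun_eq_def ob S.same_Ob S'.same_Ob GF_ob FG_ob GF_ar FG_ar GF_con FG_con H.commute_Ob)
qed

section \<open>Invertibility and naturality of the unit\<close>

context small_E_system
begin

lemma bij_bang: "bij_betw bang (Ob E) (Over E r)"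
  by (rule bij_betw_byWitness[where f' = "src E r"])
    (use root_Ob in \<open>auto simp: bang_Over src_bang bang_src src_Ob\<close>)

lemma iso_unit: "iso Esys E (CE2E_ob CE) (E, trestr E unit)"
proof -
  interpret S: CE_system CE by (rule CE_system_E2CE)
  note U = pre_E_hom_unit
  have bij_ar: "bij_betw (far unit \<Gamma>) (Over E \<Gamma>) (Over (CE2E_ob CE) (fob unit \<Gamma>))" if "\<Gamma> \<in> Ob E" for \<Gamma>
    using that by (simp add: unit_def src_bang bij_betw_def inj_on_def)
  have bij_tm: "bij_betw (ftm unit \<Gamma> A) (Tm E \<Gamma> A) (Tm (CE2E_ob CE) (fob unit \<Gamma>) (far unit \<Gamma> A))"
    if "\<Gamma> \<in> Ob E" "A \<in> Over E \<Gamma>" for \<Gamma> A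
    using bij_sec[of "bang \<Gamma>" A] that by (simp add: unit_def src_bang bang_Over)
  obtain K where K: "pre_E_hom (CE2E_ob CE) E K" "tfun_eq E (tcomp K unit) tid" "tfun_eq (CE2E_ob CE) (tcomp unit K) tid"
    by (rule pre_E_hom_inverse[OF E_system_axioms S.E_system_CE2E U _ bij_ar bij_tm])
      (use bij_bang in \<open>simp add: unit_def\<close>)
  note sys = E_system_axioms S.E_system_CE2E
  show ?thesis
    unfolding iso_def
  proof (intro conjI bexI)
    show "(E, trestr E unit) \<in> hom Esys E (CE2E_ob CE)"
      using sys pre_E_hom_trestr[OF sys U] by (simp add: hom_def trestr_trestr)
    show "(CE2E_ob CE, trestr (CE2E_ob CE) K) \<in> hom Esys (CE2E_ob CE) E"
      using sys pre_E_hom_trestr[OF sys(2,1) K(1)] by (simp add: hom_def trestr_trestr)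
    show "cmp Esys (CE2E_ob CE) (E, trestr E unit) (CE2E_ob CE, trestr (CE2E_ob CE) K) = idn Esys (CE2E_ob CE)"
      using K by (simp add: trestr_tcomp_trestr_left[OF pre_E_hom.axioms(1)[OF K(1)]]
          trestr_tcomp_trestr_right trestr_eq_iff)
    show "cmp Esys E (CE2E_ob CE, trestr (CE2E_ob CE) K) (E, trestr E unit) = idn Esys E"
      using K by (simp add: trestr_tcomp_trestr_left[OF pre_E_hom.axioms(1)[OF U]]
          trestr_tcomp_trestr_right trestr_eq_iff)
  qed
qed

end

text \<open>On objects, H preserves the root and hence the arrows into it. On terms, H carries S_x
  to S_{H(x)}, and \<open>Harr_arr\<close> turns this into an equation between the corresponding
  sections.\<close>

lemma unit_natural:
  assumes "E_system E" and "E_system D" and "pre_E_hom E D H"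
  shows "tfun_eq E (tcomp (small_E_system.unit D) H)
    (tcomp (CE2E_hom (E2CE_ob E) (fst (E2CE_hom E H)) (snd (E2CE_hom E H))) (small_E_system.unit E))"
proof -
  interpret small_E_hom E D H by (rule small_E_homI[OF assms])
  have bang: "D.bang (fob H \<Gamma>) = Hr (E.bang \<Gamma>)" if "\<Gamma> \<in> Ob E" for \<Gamma>
    using D.bang_src[OF Hr_Over[OF E.bang_Over[OF that]]] that by (simp add: src_Hr E.bang_Over E.src_bang)
  have sec: "D.sec (Hr A) (far H (src E E.r A) P) (ftm H (src E E.r A) P x) = Harr (cmp E E.r A P) (E.sec A P x)"
    if A: "A \<in> Over E E.r" and P: "P \<in> Over E (src E E.r A)" and x: "x \<in> Tm E (src E E.r A) P" for A P x
    unfolding E.sec_def D.sec_def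
    using Harr_arr[OF A E.AP_Over[OF A P] E.ctx_Sub[OF A P x], of "Sub D (fob H (src E E.r A)) (far H (src E E.r A) P)
        (ftm H (src E E.r A) P x)"] hom_Sub[OF E.A_Ob[OF A P] P x] E.src_AP[OF A P] far_cmp[OF E.root_Ob A P]
    by (simp add: src_Hr A hom_root)
  have "tfun_eq E (tcomp D.unit H)
    (tcomp \<lparr>fob = fob HF, far = far HF, ftm = \<lambda>\<Gamma> A x. far HC (src (Fam E.CE) \<Gamma> A) x\<rparr> E.unit)"
    by (rule tfun_eqI)
      (auto simp: E.unit_def D.unit_def HF_def HC_def bang E.src_bang E.bang_Over sec[symmetric])
  also have "tfun_eq E \<dots> (tcomp (CE2E_hom E.CE HF HC) E.unit)"
    unfolding CE2E_hom_def
    by (rule tcomp_cong_left[OF pre_E_hom.axioms(1)[OF E.pre_E_hom_unit] tfun_eq_sym[OF tfun_eq_trestr]])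
  also have "CE2E_hom E.CE HF HC = CE2E_hom E.CE (fst (E2CE_hom E H)) (snd (E2CE_hom E H))"
    by (rule CE2E_hom_cong[OF E.CE_system_E2CE]) (simp_all only: E2CE_hom_eq fst_conv snd_conv fun_eq_sym[OF fun_eq_frestr])
  finally show ?thesis .
qed

section \<open>Invertibility of the counit at a rooted CE-system\<close>

context small_CE_system
begin

lemma iso_eps:
  assumes "rooted S"
  shows "iso rCEsys L.CE S (L.CE, frestr (Fam L.CE) epsF, frestr (Con L.CE) epsC)"
proof -
  note L = L.CE_system_E2CE and H = CE_hom_eps
  interpret L': CE_system L.CE by (rule L)
  have FamL: "Fam L.CE = slice_cat E o1" and ConL: "Con L.CE = E2C E o1" by simp_all
  \<comment> \<open>Terminality of 1 among families makes a family over 1 determined by its domain,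
    so the counit is injective on objects.\<close>
  have uniqF: "A = A'" if "A \<in> Over F o1" "A' \<in> Over F o1" "src F o1 A = src F o1 A'" for A A'
    using terminal_one that F.src_Ob[OF o1_Ob that(1)] unfolding terminal_def by (metis hom_iff)
  have uniqC: "g = g'" if "g \<in> hom C \<Delta> o1" "g' \<in> hom C \<Delta> o1" for g g' \<Delta>
    using assms that C_hom_Ob[OF o1_Ob that(1)] same_Ob unfolding rooted_def terminal_def by metis
  have bij_ob: "bij_betw (fob epsF) (Ob (Fam L.CE)) (Ob F)"
    unfolding bij_betw_def
  proof
    show "inj_on (fob epsF) (Ob (Fam L.CE))"
      using uniqF by (auto simp: inj_on_def epsF_def)
    have "\<exists>A. A \<in> Over F o1 \<and> src F o1 A = \<Gamma>" if "\<Gamma> \<in> Ob F" for \<Gamma>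
      using terminal_one that unfolding terminal_def hom_iff by blast
    then show "fob epsF ` Ob (Fam L.CE) = Ob F"
      using F.src_Ob[OF o1_Ob] by (auto simp: epsF_def image_iff)
  qed
  have bij_ar: "bij_betw (far epsF \<Gamma>) (Over (Fam L.CE) \<Gamma>) (Over F (fob epsF \<Gamma>))" for \<Gamma>
    by (simp add: epsF_def bij_betw_def inj_on_def)
  have bij_con: "bij_betw (far epsC B) (Over (Con L.CE) B) (Over C (fob epsF B))" if "B \<in> Ob (Fam L.CE)" for B
  proof -
    have B: "B \<in> Over F o1" using that by simp
    note obB = F.src_Ob[OF o1_Ob B] and IB = Inc_hom[OF o1_Ob B]
    have "bij_betw (eps B) (Over (E2C E o1) B) (Over C (src F o1 B))"
    proof (rule bij_betwI')
      fix h k assume "h \<in> Over (E2C E o1) B" "k \<in> Over (E2C E o1) B"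
      then obtain A A' where h: "h \<in> hom (E2C E o1) A B" and k: "k \<in> hom (E2C E o1) A' B"
        by (auto simp: L.Over_E2C_iff)
      have A: "A \<in> Over F o1" "A' \<in> Over F o1" using L.hom_E2C_Over h k by fastforce+
      have "h = k" if eq: "eps B h = eps B k"
      proof -
        \<comment> \<open>The image of an arrow remembers its domain, so equal images have equal
          tags. The arrows are then parallel and have the same functor.\<close>
        have "A = A'"
          using uniqF[OF A] eps_hom[OF h B] eps_hom[OF k B] eq by (simp add: hom_iff)
        with k have k': "k \<in> hom (E2C E o1) A B" by simp
        show ?thesis
          using L.hom_E2C_eqI[of o1 h A B k] tfun_eq_trans[OF sem_eps[OF h B]] tfun_eq_sym[OF sem_eps[OF k' B]] h k' B
          by (simp add: eq o1_Ob)
      qed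
      then show "(eps B h = eps B k) = (h = k)" by blast
      show "eps B h \<in> Over C (src F o1 B)" using eps_hom[OF h B] by (simp add: hom_iff)
    next
      fix g assume "g \<in> Over C (src F o1 B)"
      then obtain \<Delta> where g\<Delta>: "g \<in> hom C \<Delta> (src F o1 B)" by (auto simp: hom_iff)
      then obtain A where A: "A \<in> Over F o1" and \<Delta>: "\<Delta> = src F o1 A"
        using C_hom_Ob[OF obB] terminal_one unfolding terminal_def hom_iff by metis
      have g: "g \<in> hom C (src F o1 A) (src F o1 B)" using g\<Delta> \<Delta> by simp
      \<comment> \<open>Rootedness at work: both sides are arrows into 1 from the same object, so
        every g is an arrow over 1.\<close>
      have Ig: "cmp C o1 (Inc S o1 B) g = Inc S o1 A"
        by (rule uniqC[OF C_cmp_hom[OF o1_Ob IB g] Inc_hom[OF o1_Ob A]])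
      \<comment> \<open>Because g lies over 1, its pullback functor composed with weakening by B is
        weakening by A; it therefore has a preimage arrow.\<close>
      have ctx: "L.ctx o1 A B (pb_fun S (src F o1 B) g)"
        using pre_E_hom_pb_fun[OF obB g] tfun_eq_sym[OF pb_fun_cmp[OF o1_Ob IB g]] by (simp add: L.ctx_def Ig)
      have "L.arr o1 A B (pb_fun S (src F o1 B) g) \<in> hom (E2C E o1) A B"
        using L.arr_hom[of o1 A B, OF _ _ _ ctx] A B o1_Ob by simp
      moreover have "eps B (L.arr o1 A B (pb_fun S (src F o1 B) g)) = g"
        by (rule eps_arr[OF A B g Ig tfun_eq_refl])
      ultimately show "\<exists>h \<in> Over (E2C E o1) B. g = eps B h"
        by (metis L.Over_E2C_iff)
    qed
    then show ?thesis by (simp add: epsC_def epsF_def)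
  qed
  obtain GF GC where G: "CE_hom S L.CE GF GC"
    "fun_eq (Fam L.CE) (fcomp GF epsF) fid" "fun_eq F (fcomp epsF GF) fid"
    "fun_eq (Con L.CE) (fcomp GC epsC) fid" "fun_eq C (fcomp epsC GC) fid"
    by (rule CE_hom_inverse[OF L CE_system_axioms H bij_ob bij_ar bij_con])
  note Hr = CE_hom_frestr[OF L H] and Gr = CE_hom_frestr[OF CE_system_axioms G(1)]
  show ?thesis
    unfolding iso_def
  proof (intro conjI bexI)
    show "(L.CE, frestr (Fam L.CE) epsF, frestr (Con L.CE) epsC) \<in> hom rCEsys L.CE S"
      using L Hr L.rooted_E2CE by (simp add: hom_def rCEsys_def full_subcat_def frestr_frestr del: L.CE_simps)
    show "(S, frestr F GF, frestr C GC) \<in> hom rCEsys S L.CE"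
      using CE_system_axioms Gr assms by (simp add: hom_def rCEsys_def full_subcat_def frestr_frestr del: L.CE_simps)
    show "cmp rCEsys S (L.CE, frestr (Fam L.CE) epsF, frestr (Con L.CE) epsC) (S, frestr F GF, frestr C GC) = idn rCEsys S"
      using G by (simp add: rCEsys_def full_subcat_def frestr_fcomp_frestr_left[OF CE_hom.functor_Fam[OF G(1)]]
          frestr_fcomp_frestr_left[OF CE_hom.functor_Con[OF G(1)]] frestr_fcomp_frestr_right frestr_eq_iff del: L.CE_simps)
    show "cmp rCEsys L.CE (S, frestr F GF, frestr C GC) (L.CE, frestr (Fam L.CE) epsF, frestr (Con L.CE) epsC) = idn rCEsys L.CE"
      using G by (simp add: rCEsys_def full_subcat_def frestr_fcomp_frestr_left[OF CE_hom.functor_Fam[OF H]]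
          frestr_fcomp_frestr_left[OF CE_hom.functor_Con[OF H]] frestr_fcomp_frestr_right frestr_eq_iff del: L.CE_simps)
  qed
qed

end

section \<open>The adjunction\<close>

text \<open>The transported homomorphism acts on sections by \<open>FC\<close>, which preserves
  inclusions, projections and composition, hence also \<pi>_2(I(A), B) f.\<close>

lemma counit_natural:
  assumes "CE_system S" and "CE_system S'" and "CE_hom S S' FF FC"
  defines "E \<equiv> CE2E_ob S"
  shows "fun_eq (Fam (E2CE_ob E)) (fcomp FF (small_CE_system.epsF S))
      (fcomp (small_CE_system.epsF S') (fst (E2CE_hom E (CE2E_hom S FF FC))))"
    and "fun_eq (Con (E2CE_ob E)) (fcomp FC (small_CE_system.epsC S))
      (fcomp (small_CE_system.epsC S') (snd (E2CE_hom E (CE2E_hom S FF FC))))"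
proof -
  interpret S: small_CE_system S by (rule small_CE_system.intro) fact
  interpret S': small_CE_system S' by (rule small_CE_system.intro) fact
  interpret H: CE_hom S S' FF FC by fact
  note o1 = S.o1_Ob
  have E: "E_system E" unfolding E_def by (rule S.E_system_CE2E)
  let ?H = "\<lparr>fob = fob FF, far = far FF, ftm = \<lambda>\<Gamma> A x. far FC (src (Fam S) \<Gamma> A) x\<rparr>"
  have eq: "E2CE_hom E (CE2E_hom S FF FC) = E2CE_hom E ?H"
    unfolding CE2E_hom_def E_def by (rule E2CE_hom_cong[OF S.E_system_CE2E tfun_eq_trestr])
  show "fun_eq (Fam (E2CE_ob E)) (fcomp FF S.epsF) (fcomp S'.epsF (fst (E2CE_hom E (CE2E_hom S FF FC))))"
    unfolding eq unfolding E2CE_hom_eq'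
    using o1 by (auto simp: E_def fun_eq_def frestr_def S.epsF_def S'.epsF_def H.FF_src H.hom_one[symmetric])
  have "far FC (src (Fam S) S.o1 B) (S.eps B h)
    = S'.eps (far FF S.o1 B) (far (snd (E2CE_hom E ?H)) B h)"
    if B: "B \<in> Over (Fam S) S.o1" and h: "h \<in> Over (E2C E S.o1) B" for B h
  proof -
    obtain A f where f: "f \<in> sections S (src (Fam S) S.o1 A) (pb S S.o1 (Inc S S.o1 A) B)" "h = tag (A, f)"
      and A: "A \<in> Over (Fam S) S.o1"
      using h by (auto simp: E_def S.L.Over_E2C_iff S.L.hom_E2C_iff thom_def)
    note I = S.Inc_hom[OF o1 A] and p = S.pr2_hom[OF o1 S.Inc_hom[OF o1 A] B]
    have "far FC (src (Fam S) S.o1 B) (S.eps B h) = cmp (Con S') (fob FF (src (Fam S) S.o1 B))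
        (pr2 S' S'.o1 (Inc S' S'.o1 (far FF S.o1 A)) (far FF S.o1 B))
        (far FC (src (Fam S) (src (Fam S) S.o1 A) (pb S S.o1 (Inc S S.o1 A) B)) f)"
      using CE_hom_far_cmp[OF assms(1,3) S.F.src_Ob[OF o1 B] p S.sections_hom[OF f(1)]]
        H.hom_pr2[OF o1 I B] H.commute_Inc[OF o1 A] by (simp add: S.eps_def f(2) H.hom_one)
    then show ?thesis
      using B h H.FF_src[OF o1 B]
      by (simp add: E2CE_hom_eq' E_def frestr_def f(2) S'.eps_def H.hom_one)
  qed
  then show "fun_eq (Con (E2CE_ob E)) (fcomp FC S.epsC) (fcomp S'.epsC (snd (E2CE_hom E (CE2E_hom S FF FC))))"
    unfolding eq
    using o1 H.FF_src[OF o1] H.commute_Ob S.F.src_Ob[OF o1]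
    by (auto simp: E_def fun_eq_def S.epsC_def S'.epsC_def H.hom_one E2CE_hom_eq' frestr_def)
qed

text \<open>The unit turns a term f of W_A(B) into the section with functor S_f, and
  \<open>eps\<close> composes it with a projection whose functor is W_A/B. The result has functor
  S_f (W_A/B) = f^*, so it is the arrow f again.\<close>

lemma (in small_E_system) triangle_E2CE:
  defines "LH \<equiv> E2CE_hom E unit"
  shows "fun_eq (Fam CE) (fcomp (small_CE_system.epsF CE) (fst LH)) fid"
    and "fun_eq (Con CE) (fcomp (small_CE_system.epsC CE) (snd LH)) fid"
proof -
  interpret S: small_CE_system CE by (rule small_CE_system.intro) (rule CE_system_E2CE)
  note [simp] = src_idn[OF root_Ob] cmp_idn_left[OF root_Ob]
  have id: "idn E r \<in> Over E r" by (rule idn_Over[OF root_Ob])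
  show "fun_eq (Fam CE) (fcomp S.epsF (fst LH)) fid"
    using root_Ob by (auto simp: LH_def fun_eq_def E2CE_hom_eq' frestr_def S.epsF_def unit_def)
  have "S.eps B (tag (A, sec A (fob (Wk E r A) B) f)) = tag (A, f)"
    if A: "A \<in> Over E r" and B: "B \<in> Over E r" and f: "f \<in> thom E r A B" for A B f
  proof -
    let ?A = "src E r A" and ?W = "fob (Wk E r A) B"
    have h: "tag (A, f) \<in> hom (E2C E r) A B" using A f by (simp add: hom_E2C_iff)
    have W: "?W \<in> Over E ?A" by (rule Wk_fob_Over[OF root_Ob A B])
    have f': "f \<in> Tm E ?A ?W" using f by (simp add: thom_def)
    \<comment> \<open>The chosen object 1 is the identity of the root, so A is regarded as a family
      over 1, and its inclusion is an arrow from A to 1 with functor W_A.\<close>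
    have I: "Inc CE (idn E r) A \<in> hom (E2C E r) A (idn E r)" and semI: "feq r (sem r (idn E r) (Inc CE (idn E r) A)) (Wk E r A)"
      using Inc_hom[OF id, of A] sem_Inc[OF id, of A] A by simp_all
    let ?I = "Inc CE (idn E r) A"
    have pbI: "pb CE (idn E r) ?I B = ?W" using tfun_eq_fob[OF semI, of B] B by (simp add: pb_CE)
    have pr: "pr2 CE (idn E r) ?I B \<in> hom (E2C E r) (cmp E r A ?W) B"
      and sempr: "feq (src E r B) (sem r B (pr2 CE (idn E r) ?I B)) (sl r (sem r (idn E r) ?I) B)"
      using pr2_hom_CE[OF I id, of B] sem_pr2[OF I id, of B] B by (simp_all add: pbI)
    note s = sec_hom[OF A W f']
    have slW: "tfunctor (slice E (src E r B)) (slice E (src E ?A ?W)) (sl r (Wk E r A) B)"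
      using ehom_tfunctor[OF ehom_sl[OF root_Ob _ Wk_hom[OF root_Ob A] B]] A root_Ob by (simp add: src_Ob)
    have "cmp (E2C E r) B (pr2 CE (idn E r) ?I B) (sec A ?W f) = tag (A, f)"
    proof (rule hom_E2C_eqI[OF root_Ob cmp_hom[OF root_Ob pr s B] h B])
      have "feq (src E r B) (sem r B (cmp (E2C E r) B (pr2 CE (idn E r) ?I B) (sec A ?W f)))
        (tcomp (sem r (cmp E r A ?W) (sec A ?W f)) (sem r B (pr2 CE (idn E r) ?I B)))"
        by (rule sem_cmp[OF root_Ob pr s B])
      also have "feq (src E r B) \<dots> (tcomp (sem r (cmp E r A ?W) (sec A ?W f)) (sl r (Wk E r A) B))"
        by (rule tcomp_cong_right[OF tfun_eq_trans[OF sempr sl_cong[OF root_Ob B semI]]])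
      also have "feq (src E r B) \<dots> (tcomp (Sub E ?A ?W f) (sl r (Wk E r A) B))"
        by (rule tcomp_cong_left[OF slW sem_sec[OF A W f']])
      finally show "feq (src E r B) (sem r B (cmp (E2C E r) B (pr2 CE (idn E r) ?I B) (sec A ?W f))) (sem r B (tag (A, f)))"
        by (simp add: sem_def tstar_def)
    qed
    moreover obtain x where "sec A ?W f = tag (A, x)" by (auto simp: sec_def arr_def)
    ultimately show ?thesis
      using B by (simp add: S.eps_def)
  qed
  then show "fun_eq (Con CE) (fcomp S.epsC (snd LH)) fid"
    by (auto simp: LH_def fun_eq_def E2CE_hom_eq' frestr_def S.epsC_def unit_def Over_E2C_iff hom_E2C_iff bang_src)
qed


text \<open>A section x of A satisfies I(b.A) x = I(b) for the arrow b from \<Gamma> to 1, so it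
  lies over 1. The unit sends it to the arrow of its pullback functor, and \<open>eps_arr\<close>
  recovers x.\<close>

lemma (in small_CE_system) triangle_CE2E:
  "tfun_eq E (tcomp \<lparr>fob = fob epsF, far = far epsF, ftm = \<lambda>\<Gamma> A x. far epsC (src (Fam L.CE) \<Gamma> A) x\<rparr> L.unit) tid"
  (is "tfun_eq E ?T tid")
proof (rule tfun_eqI)
  fix \<Gamma> assume "\<Gamma> \<in> Ob E"
  then have \<Gamma>: "\<Gamma> \<in> Ob F" by simp
  let ?b = "L.bang \<Gamma>"
  have b: "?b \<in> Over F o1" "src F o1 ?b = \<Gamma>" using L.bang_Over[of \<Gamma>] L.src_bang[of \<Gamma>] \<Gamma> by simp_all
  then show "fob ?T \<Gamma> = fob tid \<Gamma>"
    by (simp add: L.unit_def epsF_def)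
  fix A assume "A \<in> Over E \<Gamma>"
  then have A: "A \<in> Over F \<Gamma>" by simp
  show "far ?T \<Gamma> A = far tid \<Gamma> A"
    by (simp add: L.unit_def epsF_def)
  fix x assume "x \<in> Tm E \<Gamma> A"
  then have x: "x \<in> sections S \<Gamma> A" by simp
  have bA: "cmp F o1 ?b A \<in> Over F o1" "src F o1 (cmp F o1 ?b A) = src F \<Gamma> A"
    using A b o1_Ob by (simp_all add: F_simps)
  have "cmp C o1 (Inc S o1 (cmp F o1 ?b A)) x = Inc S o1 ?b"
    using Inc_cmp[OF o1_Ob b(1), of A] C_assoc[OF o1_Ob Inc_hom[OF o1_Ob b(1), unfolded b(2)] Inc_hom[OF \<Gamma> A] sections_hom[OF x]]
      sections_cmp[OF x] C_idn_right[OF o1_Ob Inc_hom[OF o1_Ob b(1), unfolded b(2)]] A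
    by (simp add: b(2))
  then have "eps (cmp F o1 ?b A) (L.arr o1 ?b (cmp F o1 ?b A) (pb_fun S (src F \<Gamma> A) x)) = x"
    using sections_hom[OF x] by (intro eps_arr[OF b(1) bA(1)]) (simp_all add: b(2) bA(2))
  then show "ftm ?T \<Gamma> A x = ftm tid \<Gamma> A x"
    by (simp add: L.unit_def epsC_def L.sec_def b(2))
qed

definition unit_nt :: "('u::infinite, 'u, 'u) esys \<Rightarrow> ('u, 'u, 'u) esys \<times> ('u, 'u, 'u, 'u, 'u, 'u) tfnct" where
  "unit_nt E = (E, trestr E (small_E_system.unit E))"

definition counit_nt :: "('u::infinite, 'u, 'u) cesys
    \<Rightarrow> ('u, 'u, 'u) cesys \<times> ('u, 'u, 'u, 'u) fnct \<times> ('u, 'u, 'u, 'u) fnct" where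
  "counit_nt S = (let LS = E2CE_ob (CE2E_ob S) in
    (LS, frestr (Fam LS) (small_CE_system.epsF S), frestr (Con LS) (small_CE_system.epsC S)))"

lemma adjunction_E2CE_CE2E:
  "adjunction Esys CEsys (E2CE :: (('u::infinite, 'u, 'u) esys, _, _, _) fnct) CE2E unit_nt counit_nt"
proof (intro adjunction.intro nat_trans.intro strict_category_Esys strict_category_CEsys
    strict_functor_E2CE strict_functor_CE2E)
  fix E :: "('u, 'u, 'u) esys"
  assume "E \<in> Ob Esys"
  then interpret small_E_system E by (simp add: small_E_system_iff)
  interpret S: CE_system CE by (rule CE_system_E2CE)
  note U = pre_E_hom_unit
  show "unit_nt E \<in> hom Esys (fob fid E) (fob (fcomp CE2E E2CE) E)"
    using pre_E_hom_trestr[OF E_system_axioms S.E_system_CE2E U] E_system_axioms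
    by (simp add: hom_def unit_nt_def E2CE_def CE2E_def trestr_trestr)
  have C: "small_CE_system CE" by (rule small_CE_system.intro) (rule CE_system_E2CE)
  interpret S: small_CE_system CE by (rule C)
  interpret UH: small_E_hom E "CE2E_ob CE" unit
    by (rule small_E_homI[OF E_system_axioms S.E_system_CE2E U])
  have eqF: "fun_eq (Fam CE) (fcomp S.epsF UH.HF) fid" and eqC: "fun_eq (Con CE) (fcomp S.epsC UH.HC) fid"
    using triangle_E2CE[unfolded UH.E2CE_hom_eq fst_conv snd_conv]
    by (simp_all only: frestr_eq_iff[symmetric] frestr_fcomp_frestr_right)
  show "cmp CEsys (fob E2CE E) (counit_nt (fob E2CE E)) (far E2CE (fob CE2E (fob E2CE E)) (unit_nt E)) = idn CEsys (fob E2CE E)"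
    using eqF eqC CE_hom.functor_Fam[OF UH.CE_hom_H] CE_hom.functor_Con[OF UH.CE_hom_H]
    by (simp add: E2CE_def CE2E_def unit_nt_def counit_nt_def Let_def
        E2CE_hom_cong[OF E_system_axioms tfun_eq_trestr] UH.E2CE_hom_eq
        frestr_fcomp_frestr_left frestr_fcomp_frestr_right frestr_eq_iff del: CE_simps)
next
  fix E D :: "('u, 'u, 'u) esys" and f
  assume "E \<in> Ob Esys" "D \<in> Ob Esys" "f \<in> hom Esys E D"
  then obtain H where f: "f = (E, H)" and EDH: "E_system E" "E_system D" "pre_E_hom E D H"
    by (auto simp: hom_def)
  interpret small_E_hom E D H by (rule small_E_homI[OF EDH])
  have "trestr E (tcomp (trestr D D.unit) H) = trestr E (tcomp D.unit H)"
    by (rule trestr_tcomp_trestr_left[OF tfunctor_axioms])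
  also have "\<dots> = trestr E (tcomp (CE2E_hom E.CE (fst (E2CE_hom E H)) (snd (E2CE_hom E H))) (trestr E E.unit))"
    using unit_natural[OF EDH] by (simp add: trestr_tcomp_trestr_right trestr_eq_iff)
  finally show "cmp Esys (fob (fcomp CE2E E2CE) D) (unit_nt D) (far fid D f)
      = cmp Esys (fob (fcomp CE2E E2CE) D) (far (fcomp CE2E E2CE) D f) (unit_nt E)"
    by (simp add: f unit_nt_def E2CE_def CE2E_def case_prod_unfold)
next
  fix S :: "('u, 'u, 'u) cesys"
  assume "S \<in> Ob CEsys"
  then have S: "CE_system S" by simp
  interpret small_CE_system S by (rule small_CE_system.intro[OF S])
  note H = CE_hom_eps and L = L.CE_system_E2CE
  show "counit_nt S \<in> hom CEsys (fob (fcomp E2CE CE2E) S) (fob fid S)"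
    using CE_hom_frestr[OF L H] L
    by (simp add: hom_def counit_nt_def E2CE_def CE2E_def Let_def frestr_frestr del: L.CE_simps)
  have "CE2E_hom L.CE (frestr (Fam L.CE) epsF) (frestr (Con L.CE) epsC) = CE2E_hom L.CE epsF epsC"
    by (rule CE2E_hom_cong[OF L fun_eq_frestr fun_eq_frestr])
  moreover have "trestr (CE2E_ob S) (tcomp (CE2E_hom L.CE epsF epsC) L.unit) = trestr (CE2E_ob S) tid"
    unfolding CE2E_hom_def
      trestr_tcomp_trestr_left[OF pre_E_hom.axioms(1)[OF L.pre_E_hom_unit]] trestr_eq_iff
    by (rule triangle_CE2E)
  ultimately show "cmp Esys (fob CE2E S) (far CE2E S (counit_nt S)) (unit_nt (fob CE2E S)) = idn Esys (fob CE2E S)"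
    by (simp add: E2CE_def CE2E_def unit_nt_def counit_nt_def Let_def trestr_tcomp_trestr_right del: L.CE_simps)
next
  fix S S' :: "('u, 'u, 'u) cesys" and f
  assume "S \<in> Ob CEsys" "S' \<in> Ob CEsys" "f \<in> hom CEsys S S'"
  then obtain FF FC where f: "f = (S, FF, FC)" and H: "CE_system S" "CE_system S'" "CE_hom S S' FF FC"
    by (auto simp: hom_def)
  interpret S: small_CE_system S by (rule small_CE_system.intro[OF H(1)])
  interpret S': small_CE_system S' by (rule small_CE_system.intro[OF H(2)])
  let ?H = "CE2E_hom S FF FC"
  have hom: "pre_E_hom (CE2E_ob S) (CE2E_ob S') ?H"
    unfolding CE2E_hom_def by (rule pre_E_hom_trestr[OF S.E_system_CE2E S'.E_system_CE2E pre_E_hom_CE2E[OF H]])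
  interpret RH: small_E_hom "CE2E_ob S" "CE2E_ob S'" ?H
    by (rule small_E_homI[OF S.E_system_CE2E S'.E_system_CE2E hom])
  note LH = CE_hom_frestr[OF S.L.CE_system_E2CE RH.CE_hom_H]
  have "fst (E2CE_hom (CE2E_ob S) ?H) = frestr (Fam S.L.CE) RH.HF" "snd (E2CE_hom (CE2E_ob S) ?H) = frestr (Con S.L.CE) RH.HC"
    by (simp_all only: RH.E2CE_hom_eq fst_conv snd_conv)
  then have "frestr (Fam S.L.CE) (fcomp (frestr (Fam S'.L.CE) S'.epsF) (fst (E2CE_hom (CE2E_ob S) ?H)))
      = frestr (Fam S.L.CE) (fcomp FF (frestr (Fam S.L.CE) S.epsF))"
    "frestr (Con S.L.CE) (fcomp (frestr (Con S'.L.CE) S'.epsC) (snd (E2CE_hom (CE2E_ob S) ?H)))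
      = frestr (Con S.L.CE) (fcomp FC (frestr (Con S.L.CE) S.epsC))"
    using counit_natural[OF H] frestr_fcomp_frestr_left[OF CE_hom.functor_Fam[OF LH], of S'.epsF]
      frestr_fcomp_frestr_left[OF CE_hom.functor_Con[OF LH], of S'.epsC]
    by (simp_all only: frestr_fcomp_frestr_right frestr_eq_iff[symmetric])
  then show "cmp CEsys (fob fid S') (counit_nt S') (far (fcomp E2CE CE2E) S' f)
      = cmp CEsys (fob fid S') (far fid S' f) (counit_nt S)"
    by (simp add: f counit_nt_def E2CE_def CE2E_def Let_def case_prod_unfold del: S.L.CE_simps S'.L.CE_simps)
qed

section \<open>Restriction of the adjunction to rooted CE-systems\<close>

lemma rCEsys_simps [simp]:
  "Ob rCEsys = {S. CE_system S \<and> rooted S}"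
  "Over rCEsys = (\<lambda>S'. {f \<in> Over CEsys S'. rooted (src CEsys S' f)})"
  "src rCEsys = src CEsys" "idn rCEsys = idn CEsys" "cmp rCEsys = cmp CEsys"
  by (simp_all add: rCEsys_def full_subcat_def CEsys_def)

lemma strict_category_rCEsys: "strict_category rCEsys"
proof -
  interpret strict_category CEsys by (rule strict_category_CEsys)
  show ?thesis
  proof (unfold_locales, goal_cases)
    case (1 S f) then show ?case using src_Ob[of S f] by (simp del: CEsys_simps(2-)) 
  next
    case (2 S) then show ?case using idn_Over[of S] src_idn[of S] by (simp del: CEsys_simps(2-))
  next
    case (3 S) then show ?case using src_idn[of S] by (simp del: CEsys_simps(2-))
  next
    case (4 S f g) then show ?case using cmp_Over[of S f g] src_cmp[of S f g] by (simp del: CEsys_simps(2-))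
  next
    case (5 S f g) then show ?case using src_cmp[of S f g] by (simp del: CEsys_simps(2-))
  next
    case (6 S f) then show ?case using cmp_idn_left[of S f] by (simp del: CEsys_simps(2-))
  next
    case (7 S f) then show ?case using cmp_idn_right[of S f] by (simp del: CEsys_simps(2-))
  next
    case (8 S f g h) then show ?case using cmp_assoc[of S f g h] by (simp del: CEsys_simps(2-))
  qed
qed

lemma rooted_E2CE_ob: "E_system E \<Longrightarrow> rooted (E2CE_ob E)"
  by (simp add: small_E_system.rooted_E2CE small_E_system_iff)

text \<open>The left adjoint has rooted values and the subcategory is full, so unit, counit and
  triangles restrict unchanged.\<close>

lemma adjunction_rooted:
  "adjunction Esys rCEsys (E2CE :: (('u::infinite, 'u, 'u) esys, _, _, _) fnct) CE2E unit_nt counit_nt"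
proof -
  interpret A: adjunction Esys CEsys "E2CE :: (('u, 'u, 'u) esys, _, _, _) fnct" CE2E unit_nt counit_nt by (rule adjunction_E2CE_CE2E)
  interpret L: strict_functor Esys CEsys "E2CE :: (('u, 'u, 'u) esys, _, _, _) fnct" by (rule A.functor_L)
  interpret R: strict_functor CEsys Esys "CE2E :: (('u, 'u, 'u) cesys, _, _, _) fnct" by (rule A.functor_R)
  interpret eps: nat_trans CEsys CEsys "fcomp E2CE CE2E" fid "counit_nt :: ('u, 'u, 'u) cesys \<Rightarrow> _" by (rule A.counit)
  have r: "rooted (fob E2CE E)" if "E_system E" for E :: "('u, 'u, 'u) esys"
    using that by (simp add: E2CE_def rooted_E2CE_ob)
  \<comment> \<open>In this presentation only the codomain is a parameter of \<open>Over\<close>, so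
    fullness shows up as a condition on the domain alone.\<close>
  have hom_r: "hom rCEsys S S' = (if rooted S then hom CEsys S S' else {})" for S S' :: "('u, 'u, 'u) cesys"
    by (auto simp: hom_def)
  show ?thesis
  proof (intro adjunction.intro A.category_C strict_category_rCEsys A.unit)
    show "strict_functor Esys rCEsys (E2CE :: (('u, 'u, 'u) esys, _, _, _) fnct)"
    proof (unfold_locales, goal_cases)
      case (1 E) then show ?case using L.fob_Ob[of E] r by simp
    next
      case (2 D f) then show ?case using L.far_Over[of D f] L.src_far[of D f] r
        by (auto simp del: CEsys_simps(2-))
    next
      case (3 D f) then show ?case using L.src_far[of D f] by (simp del: CEsys_simps(2-) Esys_simps(2-))
    next
      case (4 E) then show ?case using L.far_idn[of E] by (simp del: CEsys_simps(2-) Esys_simps(2-))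
    next
      case (5 D f g) then show ?case using L.far_cmp[of D f g] by (simp del: CEsys_simps(2-) Esys_simps(2-))
    qed
    show "strict_functor rCEsys Esys (CE2E :: (('u, 'u, 'u) cesys, _, _, _) fnct)"
    proof (unfold_locales, goal_cases)
      case (1 S) then show ?case using R.fob_Ob[of S] by simp
    next
      case (2 S f) then show ?case using R.far_Over[of S f] by (simp del: CEsys_simps(2-) Esys_simps(2-))
    next
      case (3 S f) then show ?case using R.src_far[of S f] by (simp del: CEsys_simps(2-) Esys_simps(2-))
    next
      case (4 S) then show ?case using R.far_idn[of S] by (simp del: CEsys_simps(2-) Esys_simps(2-))
    next
      case (5 S f g) then show ?case using R.far_cmp[of S f g] by (simp del: CEsys_simps(2-) Esys_simps(2-))
    qed
    show "nat_trans rCEsys rCEsys (fcomp E2CE CE2E) fid (counit_nt :: ('u, 'u, 'u) cesys \<Rightarrow> _)"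
    proof (unfold_locales, goal_cases)
      case (1 S)
      then have "rooted (fob (fcomp E2CE CE2E) S)"
        using r R.fob_Ob[of S] by simp
      then show ?case
        using eps.component[of S] 1 unfolding hom_r by simp
    next
      case (2 S S' f)
      then show ?case
        using eps.naturality[of S S' f] by (simp add: hom_r del: CEsys_simps(2-) fcomp_simps)
    qed
    show "cmp rCEsys (fob E2CE E) (counit_nt (fob E2CE E)) (far E2CE (fob CE2E (fob E2CE E)) (unit_nt E)) = idn rCEsys (fob E2CE E)"
      if "E \<in> Ob Esys" for E :: "('u, 'u, 'u) esys"
      using A.triangle_L[OF that] by (simp del: CEsys_simps)
    show "cmp Esys (fob CE2E S) (far CE2E S (counit_nt S)) (unit_nt (fob CE2E S)) = idn Esys (fob CE2E S)"
      if "S \<in> Ob rCEsys" for S :: "('u, 'u, 'u) cesys"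
      using A.triangle_R[of S] that by (simp del: Esys_simps)
  qed
qed

theorem corollary5p35:
  shows "\<exists>\<eta> \<epsilon>.
    adjunction Esys CEsys (E2CE :: (('u::infinite, 'u, 'u) esys, _, _, _) fnct) CE2E \<eta> \<epsilon> \<and>
    adjoint_equivalence Esys rCEsys (E2CE :: (('u, 'u, 'u) esys, _, _, _) fnct) CE2E \<eta> \<epsilon>"
proof (intro exI conjI)
  show "adjunction Esys CEsys (E2CE :: (('u, 'u, 'u) esys, _, _, _) fnct) CE2E unit_nt counit_nt"
    by (rule adjunction_E2CE_CE2E)
  show "adjoint_equivalence Esys rCEsys (E2CE :: (('u, 'u, 'u) esys, _, _, _) fnct) CE2E unit_nt counit_nt"
  proof (intro adjoint_equivalence.intro adjoint_equivalence_axioms.intro adjunction_rooted)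
    show "iso Esys E (fob CE2E (fob E2CE E)) (unit_nt E)" if "E \<in> Ob Esys" for E :: "('u, 'u, 'u) esys"
      using small_E_system.iso_unit[of E] that by (simp add: unit_nt_def E2CE_def CE2E_def small_E_system_iff)
    show "iso rCEsys (fob E2CE (fob CE2E S)) S (counit_nt S)" if "S \<in> Ob rCEsys" for S :: "('u, 'u, 'u) cesys"
      using small_CE_system.iso_eps[of S] that
      by (simp add: counit_nt_def Let_def E2CE_def CE2E_def small_CE_system_def)
  qed
qed

end
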